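(* Let $(\mathfrak D, A)$ be a Manin pair over a manifold $S$ and let $J:X\to S$ be a Hamiltonian space for $(\mathfrak D, A)$ with generalized Dirac structure $F\to\operatorname{graph}J$. Let $X/{\sim}$ be the orbit space of the induced Lie algebroid action of $A$ on $J:X\to S$, and assume that $X/{\sim}$ is a smooth manifold such that the projection $X\to X/{\sim}$ is a submersion. Then the orbit space $X/{\sim}$ is a Poisson manifold.
   Context: Courant algebroid: a vector bundle $E\to S$ with a nondegenerate symmetric bilinear form $(\cdot|\cdot)$, a bundle map (anchor) $\tilde\rho:E\to TS$ and an $\mathbb R$-bilinear (Dorfman) bracket $\circ$ on $\Gamma(E)$ such that, for $e,e_1,e_2,e_3\in\Gamma(E)$ and $f\in C^\infty(S)$: $e_1\circ(e_2\circ e_3)=(e_1\circ e_2)\circ e_3+e_2\circ(e_1\circ e_3)$; $e\circ e=\tfrac12\mathcal D(e|e)$; $\tilde\rho(e)(e_1|e_2)=(e\circ e_1|e_2)+(e_1|e\circ e_2)$; $\tilde\rho(e_1\circ e_2)=[\tilde\rho(e_1),\tilde\rho(e_2)]$; $e_1\circ(fe_2)=f(e_1\circ e_2)+(\tilde\rho(e_1)f)e_2$, where $\mathcal D f\in\Gamma(E)$ is defined by $(\mathcal Df|e)=\tilde\rho(e)f$. Dirac structure in $E\to S$: a subbundle $L\subset E$ that is maximal isotropic (Lagrangian, $L=L^\perp$) with $\Gamma(L)$ closed under $\circ$. It is then a Lie algebroid over $S$ with the restricted bracket $[\![\cdot,\cdot]\!]$ and restricted anchor $\rho$. Manin pair over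 $S$: a pair $(\mathfrak D,A)$ with $\mathfrak D\to S$ a Courant algebroid and $A\to S$ a Dirac structure in it. For a manifold $X$, $TX\oplus T^*X\to X$ is the standard Courant algebroid: pairing $((X_1,\alpha_1)|(X_2,\alpha_2))=\tfrac12(\alpha_1(X_2)+\alpha_2(X_1))$, anchor the first projection, bracket $([X_1,X_2],\mathcal L_{X_1}\alpha_2-i_{X_2}d\alpha_1)$. The product $\mathfrak D\times(TX\oplus T^*X)\to S\times X$ carries the product Courant algebroid structure (sum of pairings and anchors; the bracket extends the two brackets, sections pulled back from different factors having zero bracket). Generalized Dirac structure: given a Courant algebroid $E\to M$ with anchor $\tilde\rho$ and a submanifold $Q\subset M$, it is a Lagrangian subbundle $F\to Q$ of $E|_Q$ such that $\tilde\rho(F)\subset TQ$, and such that $e_1|_Q,e_2|_Q\in\Gamma(F)$ implies $(e_1\circ e_2)|_Q\in\Gamma(F)$ for all sections $e_1,e_2$ of $E$. Hamiltonian space for a Manin pair $(\mathfrak D,A)$ over $S$: a manifold $X$ with a smooth map $J:X\to S$ for which there is a generalized Dirac structure $F\subset E=\mathfrak D\times(TX\oplus T^*X)$ over $Q=\operatorname{graph}J=\{(J(x),x)\}\subset S\times X$ such that (i) $F$ intersects $TX$ (i.e. $\{0\}\times(TX\oplus\{0\})$) trivially; (ii) the intersection of $F$ with $\mathfrak D\times(TX\oplus\{0\})$ projects onto $A$ under the natural projection $E\to\mathfrak D$, i.e. at each $x\in X$ the image in $\mathfrak D_{J(x)}$ is exactly $A_{J(x)}$. Induced action: for each $a\in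 A_{J(x)}$ there is a unique $\hat a\in T_xX$ with $(a,(\hat a,0))\in F_{(J(x),x)}$, and this gives a map $\Gamma(A)\to\mathfrak X(X)$, $a\mapsto\hat a$, which is a Lie algebroid action of $A$ on $J$, i.e. $\mathbb R$-linear with $\widehat{fa}=(J^*f)\hat a$, $\widehat{[\![a,b]\!]}=[\hat a,\hat b]$, $J_*(\hat a(x))=\rho(a(J(x)))$. Its orbits are the leaves of the singular foliation of $X$ spanned by the vector fields $\hat a$; $X/{\sim}$ is the set of orbits. *)

theory Defs
  imports "HOL-Analysis.Analysis" "HOL-Library.Function_Algebras"
begin

section \<open>Functions as a real vector space\<close>

instantiation "fun" :: (type, real_vector) real_vector
begin

definition scaleR_fun :: "real \<Rightarrow> ('a \<Rightarrow> 'b) \<Rightarrow> 'a \<Rightarrow> 'b"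
  where "scaleR_fun c f = (\<lambda>x. c *\<^sub>R f x)"

instance
  by standard (simp_all add: scaleR_fun_def fun_eq_iff scaleR_add_right scaleR_add_left)

end

lemma scaleR_fun_apply [simp]: "(c *\<^sub>R f) x = c *\<^sub>R f x"
  by (simp add: scaleR_fun_def)


section \<open>Smooth manifolds\<close>

text \<open>Manifolds are modelled on a linear subspace \<open>V\<close> of a Euclidean type rather than on the whole
  type, because every \<open>euclidean_space\<close> type has dimension at least 1 and zero-dimensional
  manifolds have to be covered. \<open>Ck_on k V U f\<close> is meant for \<open>U\<close> open in \<open>V\<close>; then \<open>f' x v\<close> is
  uniquely determined for \<open>x \<in> U\<close> and \<open>v \<in> V\<close>.\<close>

primrec Ck_on :: "nat \<Rightarrow> 'e::euclidean_space set \<Rightarrow> 'e set \<Rightarrow> ('e \<Rightarrow> 'f::real_normed_vector) \<Rightarrow> bool"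
  where
    "Ck_on 0 V U f \<longleftrightarrow> continuous_on U f"
  | "Ck_on (Suc k) V U f \<longleftrightarrow>
       (\<exists>f'. (\<forall>x\<in>U. (f has_derivative f' x) (at x within U)) \<and> (\<forall>v\<in>V. Ck_on k V U (\<lambda>x. f' x v)))"

definition smooth_on :: "'e::euclidean_space set \<Rightarrow> 'e set \<Rightarrow> ('e \<Rightarrow> 'f::real_normed_vector) \<Rightarrow> bool"
  where "smooth_on V U f \<longleftrightarrow> (\<forall>k. Ck_on k V U f)"

record ('p, 'e) mfd =
  mtop :: "'p topology"
  model :: "'e set"
  atlas :: "('p set \<times> ('p \<Rightarrow> 'e)) set"

abbreviation pts :: "('p, 'e) mfd \<Rightarrow> 'p set"
  where "pts M \<equiv> topspace (mtop M)"

definition smooth_manifold :: "('p, 'e::euclidean_space) mfd \<Rightarrow> bool"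
  where "smooth_manifold M \<longleftrightarrow>
    Hausdorff_space (mtop M) \<and> second_countable (mtop M) \<and> subspace (model M) \<and>
    (\<forall>(U, \<phi>)\<in>atlas M. openin (mtop M) U \<and> openin (top_of_set (model M)) (\<phi> ` U) \<and>
       homeomorphic_map (subtopology (mtop M) U) (top_of_set (\<phi> ` U)) \<phi>) \<and>
    (\<Union>(U, \<phi>)\<in>atlas M. U) = pts M \<and>
    (\<forall>(U, \<phi>)\<in>atlas M. \<forall>(W, \<psi>)\<in>atlas M.
       smooth_on (model M) (\<phi> ` (U \<inter> W)) (\<psi> \<circ> inv_into U \<phi>))"

definition smooth_map ::
    "('p, 'e::euclidean_space) mfd \<Rightarrow> ('q, 'f::euclidean_space) mfd \<Rightarrow> ('p \<Rightarrow> 'q) \<Rightarrow> bool"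
  where "smooth_map M N h \<longleftrightarrow> continuous_map (mtop M) (mtop N) h \<and>
    (\<forall>(U, \<phi>)\<in>atlas M. \<forall>(W, \<psi>)\<in>atlas N.
       smooth_on (model M) (\<phi> ` (U \<inter> h -` W)) (\<psi> \<circ> h \<circ> inv_into U \<phi>))"

definition smooth_fun_on :: "('p, 'e::euclidean_space) mfd \<Rightarrow> 'p set \<Rightarrow> ('p \<Rightarrow> real) \<Rightarrow> bool"
  where "smooth_fun_on M W f \<longleftrightarrow>
    (\<forall>(U, \<phi>)\<in>atlas M. smooth_on (model M) (\<phi> ` (U \<inter> W)) (f \<circ> inv_into U \<phi>))"

text \<open>Globally defined objects (functions, vector fields, forms, sections) are normalised to vanish
  outside the carrier, so that equality of such objects is equality on the carrier.\<close>

definition C_inf :: "('p, 'e::euclidean_space) mfd \<Rightarrow> ('p \<Rightarrow> real) set"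
  where "C_inf M = {f. smooth_fun_on M (pts M) f \<and> (\<forall>p. p \<notin> pts M \<longrightarrow> f p = 0)}"

definition pullback :: "('p, 'e) mfd \<Rightarrow> ('p \<Rightarrow> 'q) \<Rightarrow> ('q \<Rightarrow> real) \<Rightarrow> 'p \<Rightarrow> real"
  where "pullback M h f = (\<lambda>p. if p \<in> pts M then f (h p) else 0)"

definition prod_mfd :: "('p, 'e) mfd \<Rightarrow> ('q, 'f) mfd \<Rightarrow> ('p \<times> 'q, 'e \<times> 'f) mfd"
  where "prod_mfd M N =
    \<lparr> mtop = prod_topology (mtop M) (mtop N),
      model = model M \<times> model N,
      atlas = {(U \<times> W, map_prod \<phi> \<psi>) | U \<phi> W \<psi>. (U, \<phi>) \<in> atlas M \<and> (W, \<psi>) \<in> atlas N} \<rparr>"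

text \<open>The graph \<open>{(J x, x)}\<close> inside \<open>S \<times> X\<close>, with the manifold structure transported from \<open>X\<close>.\<close>

definition graph_mfd :: "('s, 'e) mfd \<Rightarrow> ('x, 'f) mfd \<Rightarrow> ('x \<Rightarrow> 's) \<Rightarrow> ('s \<times> 'x, 'f) mfd"
  where "graph_mfd S X J =
    \<lparr> mtop = subtopology (prod_topology (mtop S) (mtop X)) ((\<lambda>x. (J x, x)) ` pts X),
      model = model X,
      atlas = {((\<lambda>x. (J x, x)) ` U, \<phi> \<circ> snd) | U \<phi>. (U, \<phi>) \<in> atlas X} \<rparr>"


section \<open>Tangent and cotangent vectors\<close>

type_synonym 'p tvec = "('p \<Rightarrow> real) \<Rightarrow> real"
type_synonym 'p ctvec = "'p tvec \<Rightarrow> real"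

definition tangent_space :: "('p, 'e::euclidean_space) mfd \<Rightarrow> 'p \<Rightarrow> 'p tvec set"
  where "tangent_space M p = {v.
    (\<forall>f\<in>C_inf M. \<forall>g\<in>C_inf M. v (f + g) = v f + v g \<and> v (f * g) = v f * g p + f p * v g) \<and>
    (\<forall>f\<in>C_inf M. \<forall>c. v (c *\<^sub>R f) = c * v f) \<and>
    (\<forall>f. f \<notin> C_inf M \<longrightarrow> v f = 0)}"

definition cotangent_space :: "('p, 'e::euclidean_space) mfd \<Rightarrow> 'p \<Rightarrow> 'p ctvec set"
  where "cotangent_space M p = {\<alpha>.
    (\<forall>u\<in>tangent_space M p. \<forall>v\<in>tangent_space M p. \<alpha> (u + v) = \<alpha> u + \<alpha> v) \<and>
    (\<forall>v\<in>tangent_space M p. \<forall>c. \<alpha> (c *\<^sub>R v) = c * \<alpha> v) \<and>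
    (\<forall>v. v \<notin> tangent_space M p \<longrightarrow> \<alpha> v = 0)}"

definition dfun :: "('p, 'e::euclidean_space) mfd \<Rightarrow> ('p \<Rightarrow> real) \<Rightarrow> 'p \<Rightarrow> 'p ctvec"
  where "dfun M f p = (\<lambda>v. if v \<in> tangent_space M p then v f else 0)"

definition push ::
    "('p, 'e::euclidean_space) mfd \<Rightarrow> ('q, 'f::euclidean_space) mfd \<Rightarrow> ('p \<Rightarrow> 'q) \<Rightarrow> 'p tvec \<Rightarrow> 'q tvec"
  where "push M N h v = (\<lambda>f. if f \<in> C_inf N then v (pullback M h f) else 0)"

definition submersion ::
    "('p, 'e::euclidean_space) mfd \<Rightarrow> ('q, 'f::euclidean_space) mfd \<Rightarrow> ('p \<Rightarrow> 'q) \<Rightarrow> bool"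
  where "submersion M N h \<longleftrightarrow> smooth_map M N h \<and>
    (\<forall>p\<in>pts M. push M N h ` tangent_space M p = tangent_space N (h p))"

definition embedded_submanifold ::
    "('p, 'f::euclidean_space) mfd \<Rightarrow> ('p, 'e::euclidean_space) mfd \<Rightarrow> bool"
  where "embedded_submanifold Q M \<longleftrightarrow>
    smooth_manifold Q \<and> pts Q \<subseteq> pts M \<and> mtop Q = subtopology (mtop M) (pts Q) \<and>
    smooth_map Q M (\<lambda>q. q) \<and>
    (\<forall>q\<in>pts Q. inj_on (push Q M (\<lambda>q. q)) (tangent_space Q q))"

text \<open>The tangent vector of \<open>M \<times> N\<close> at \<open>(s, x)\<close> with components \<open>u\<close> at \<open>s\<close> and \<open>v\<close> at \<open>x\<close>.\<close>

definition tvec_pair ::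
    "('p, 'e::euclidean_space) mfd \<Rightarrow> ('q, 'f::euclidean_space) mfd \<Rightarrow> 'p \<times> 'q \<Rightarrow> 'p tvec \<Rightarrow> 'q tvec
      \<Rightarrow> ('p \<times> 'q) tvec"
  where "tvec_pair M N = (\<lambda>(s, x) u v f.
    if f \<in> C_inf (prod_mfd M N) then u (\<lambda>s'. f (s', x)) + v (\<lambda>x'. f (s, x')) else 0)"


section \<open>Vector fields and one-forms\<close>

definition smooth_vf_on :: "('p, 'e::euclidean_space) mfd \<Rightarrow> 'p set \<Rightarrow> ('p \<Rightarrow> 'p tvec) \<Rightarrow> bool"
  where "smooth_vf_on M W Y \<longleftrightarrow> (\<forall>p\<in>W. Y p \<in> tangent_space M p) \<and>
    (\<forall>f\<in>C_inf M. smooth_fun_on M W (\<lambda>p. Y p f))"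

definition vector_fields :: "('p, 'e::euclidean_space) mfd \<Rightarrow> ('p \<Rightarrow> 'p tvec) set"
  where "vector_fields M = {Y. smooth_vf_on M (pts M) Y \<and> (\<forall>p. p \<notin> pts M \<longrightarrow> Y p = 0)}"

definition lie_bracket :: "('p \<Rightarrow> 'p tvec) \<Rightarrow> ('p \<Rightarrow> 'p tvec) \<Rightarrow> 'p \<Rightarrow> 'p tvec"
  where "lie_bracket Y Z = (\<lambda>p f. Y p (\<lambda>q. Z q f) - Z p (\<lambda>q. Y q f))"

definition smooth_form_on :: "('p, 'e::euclidean_space) mfd \<Rightarrow> 'p set \<Rightarrow> ('p \<Rightarrow> 'p ctvec) \<Rightarrow> bool"
  where "smooth_form_on M W \<alpha> \<longleftrightarrow> (\<forall>p\<in>W. \<alpha> p \<in> cotangent_space M p) \<and>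
    (\<forall>Y\<in>vector_fields M. smooth_fun_on M W (\<lambda>p. \<alpha> p (Y p)))"

definition one_forms :: "('p, 'e::euclidean_space) mfd \<Rightarrow> ('p \<Rightarrow> 'p ctvec) set"
  where "one_forms M = {\<alpha>. smooth_form_on M (pts M) \<alpha> \<and> (\<forall>p. p \<notin> pts M \<longrightarrow> \<alpha> p = 0)}"

text \<open>The one-form with prescribed (tensorial) values \<open>\<Phi> Z\<close> on vector fields \<open>Z\<close>.\<close>

definition one_form_of ::
    "('p, 'e::euclidean_space) mfd \<Rightarrow> (('p \<Rightarrow> 'p tvec) \<Rightarrow> 'p \<Rightarrow> real) \<Rightarrow> 'p \<Rightarrow> 'p ctvec"
  where "one_form_of M \<Phi> = (THE \<beta>. \<beta> \<in> one_forms M \<and>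
    (\<forall>Z\<in>vector_fields M. \<forall>p\<in>pts M. \<beta> p (Z p) = \<Phi> Z p))"

definition lie_deriv ::
    "('p, 'e::euclidean_space) mfd \<Rightarrow> ('p \<Rightarrow> 'p tvec) \<Rightarrow> ('p \<Rightarrow> 'p ctvec) \<Rightarrow> 'p \<Rightarrow> 'p ctvec"
  where "lie_deriv M Y \<alpha> =
    one_form_of M (\<lambda>Z p. Y p (\<lambda>q. \<alpha> q (Z q)) - \<alpha> p (lie_bracket Y Z p))"

definition ext_deriv ::
    "('p \<Rightarrow> 'p ctvec) \<Rightarrow> ('p \<Rightarrow> 'p tvec) \<Rightarrow> ('p \<Rightarrow> 'p tvec) \<Rightarrow> 'p \<Rightarrow> real"
  where "ext_deriv \<alpha> Y Z = (\<lambda>p.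
    Y p (\<lambda>q. \<alpha> q (Z q)) - Z p (\<lambda>q. \<alpha> q (Y q)) - \<alpha> p (lie_bracket Y Z p))"

definition contract_d ::
    "('p, 'e::euclidean_space) mfd \<Rightarrow> ('p \<Rightarrow> 'p tvec) \<Rightarrow> ('p \<Rightarrow> 'p ctvec) \<Rightarrow> 'p \<Rightarrow> 'p ctvec"
  where "contract_d M Y \<alpha> = one_form_of M (ext_deriv \<alpha> Y)"


section \<open>Vector bundles\<close>

text \<open>The fibre over \<open>p\<close> is a linear subspace of an ambient real vector space; fibres over different
  points need not be related (an arbitrary family of vector spaces sits in its direct sum). The
  smooth structure is given by local trivialisations, i.e. by a family of local frames
  \<open>(U, e)\<close>, where \<open>e i p\<close> for \<open>i < rank\<close> is a basis of the fibre over \<open>p \<in> U\<close>.\<close>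

record ('p, 'e, 'v) vbundle =
  base :: "('p, 'e) mfd"
  fibre :: "'p \<Rightarrow> 'v set"
  rank :: nat
  frames :: "('p set \<times> (nat \<Rightarrow> 'p \<Rightarrow> 'v)) set"

definition is_basis :: "nat \<Rightarrow> (nat \<Rightarrow> 'v::real_vector) \<Rightarrow> 'v set \<Rightarrow> bool"
  where "is_basis k b V \<longleftrightarrow>
    inj_on b {..<k} \<and> independent (b ` {..<k}) \<and> span (b ` {..<k}) = V"

text \<open>Smooth sections of the restriction of \<open>E\<close> to an embedded submanifold \<open>Q\<close> of its base,
  over an open subset \<open>W\<close> of \<open>Q\<close>. For \<open>Q = base E\<close> these are the ordinary local sections.\<close>

definition smooth_section_on ::
    "('p, 'f::euclidean_space) mfd \<Rightarrow> ('p, 'e, 'v::real_vector, 'z) vbundle_scheme \<Rightarrow> 'p set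
      \<Rightarrow> ('p \<Rightarrow> 'v) \<Rightarrow> bool"
  where "smooth_section_on Q E W \<sigma> \<longleftrightarrow> (\<forall>q\<in>W. \<sigma> q \<in> fibre E q) \<and>
    (\<forall>(U, e)\<in>frames E. \<exists>c. (\<forall>i<rank E. smooth_fun_on Q (W \<inter> U) (c i)) \<and>
       (\<forall>q\<in>W \<inter> U. \<sigma> q = (\<Sum>i<rank E. c i q *\<^sub>R e i q)))"

definition vector_bundle :: "('p, 'e::euclidean_space, 'v::real_vector, 'z) vbundle_scheme \<Rightarrow> bool"
  where "vector_bundle E \<longleftrightarrow> smooth_manifold (base E) \<and>
    (\<Union>(U, e)\<in>frames E. U) = pts (base E) \<and>
    (\<forall>(U, e)\<in>frames E. openin (mtop (base E)) U \<and>
       (\<forall>p\<in>U. is_basis (rank E) (\<lambda>i. e i p) (fibre E p)) \<and>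
       (\<forall>i<rank E. smooth_section_on (base E) E U (e i)))"

definition sections :: "('p, 'e::euclidean_space, 'v::real_vector, 'z) vbundle_scheme \<Rightarrow> ('p \<Rightarrow> 'v) set"
  where "sections E = {\<sigma>. smooth_section_on (base E) E (pts (base E)) \<sigma> \<and>
    (\<forall>p. p \<notin> pts (base E) \<longrightarrow> \<sigma> p = 0)}"

definition smooth_subbundle ::
    "('p, 'f::euclidean_space) mfd \<Rightarrow> ('p, 'e, 'v::real_vector, 'z) vbundle_scheme \<Rightarrow> ('p \<Rightarrow> 'v set)
      \<Rightarrow> bool"
  where "smooth_subbundle Q E L \<longleftrightarrow> (\<forall>q\<in>pts Q. \<exists>U k \<sigma>. openin (mtop Q) U \<and> q \<in> U \<and>
    (\<forall>i<k. smooth_section_on Q E U (\<sigma> i)) \<and> (\<forall>p\<in>U. is_basis k (\<lambda>i. \<sigma> i p) (L p)))"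


section \<open>Courant algebroids and Manin pairs\<close>

record ('p, 'e, 'v) courant = "('p, 'e, 'v) vbundle" +
  pairing :: "'p \<Rightarrow> 'v \<Rightarrow> 'v \<Rightarrow> real"
  anchor :: "'p \<Rightarrow> 'v \<Rightarrow> 'p tvec"
  bracket :: "('p \<Rightarrow> 'v) \<Rightarrow> ('p \<Rightarrow> 'v) \<Rightarrow> 'p \<Rightarrow> 'v"

definition pair_fun :: "('p, 'e, 'v) courant \<Rightarrow> ('p \<Rightarrow> 'v) \<Rightarrow> ('p \<Rightarrow> 'v) \<Rightarrow> 'p \<Rightarrow> real"
  where "pair_fun E e1 e2 = (\<lambda>p. if p \<in> pts (base E) then pairing E p (e1 p) (e2 p) else 0)"

definition anchor_vf :: "('p, 'e, 'v) courant \<Rightarrow> ('p \<Rightarrow> 'v) \<Rightarrow> 'p \<Rightarrow> 'p tvec"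
  where "anchor_vf E e = (\<lambda>p. if p \<in> pts (base E) then anchor E p (e p) else 0)"

definition courant_D :: "('p, 'e, 'v::real_vector) courant \<Rightarrow> ('p \<Rightarrow> real) \<Rightarrow> 'p \<Rightarrow> 'v"
  where "courant_D E f = (\<lambda>p. if p \<in> pts (base E)
    then (THE d. d \<in> fibre E p \<and> (\<forall>u\<in>fibre E p. pairing E p d u = anchor E p u f)) else 0)"

definition courant_algebroid :: "('p, 'e::euclidean_space, 'v::real_vector) courant \<Rightarrow> bool"
  where "courant_algebroid E \<longleftrightarrow> vector_bundle E \<and>
    (\<forall>p\<in>pts (base E). \<forall>u\<in>fibre E p. \<forall>v\<in>fibre E p. pairing E p u v = pairing E p v u \<and>
       (\<forall>w\<in>fibre E p. pairing E p (u + v) w = pairing E p u w + pairing E p v w) \<and>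
       (\<forall>c. pairing E p (c *\<^sub>R u) v = c * pairing E p u v)) \<and>
    (\<forall>p\<in>pts (base E). \<forall>u\<in>fibre E p. (\<forall>v\<in>fibre E p. pairing E p u v = 0) \<longrightarrow> u = 0) \<and>
    (\<forall>e1\<in>sections E. \<forall>e2\<in>sections E. pair_fun E e1 e2 \<in> C_inf (base E)) \<and>
    (\<forall>p\<in>pts (base E). \<forall>u\<in>fibre E p. anchor E p u \<in> tangent_space (base E) p \<and>
       (\<forall>v\<in>fibre E p. anchor E p (u + v) = anchor E p u + anchor E p v) \<and>
       (\<forall>c. anchor E p (c *\<^sub>R u) = c *\<^sub>R anchor E p u)) \<and>
    (\<forall>e\<in>sections E. anchor_vf E e \<in> vector_fields (base E)) \<and>
    (\<forall>e1\<in>sections E. \<forall>e2\<in>sections E. bracket E e1 e2 \<in> sections E \<and>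
       (\<forall>c. bracket E (c *\<^sub>R e1) e2 = c *\<^sub>R bracket E e1 e2 \<and>
            bracket E e1 (c *\<^sub>R e2) = c *\<^sub>R bracket E e1 e2) \<and>
       (\<forall>e3\<in>sections E. bracket E (e1 + e2) e3 = bracket E e1 e3 + bracket E e2 e3 \<and>
            bracket E e1 (e2 + e3) = bracket E e1 e2 + bracket E e1 e3)) \<and>
    (\<forall>e1\<in>sections E. \<forall>e2\<in>sections E. \<forall>e3\<in>sections E.
       bracket E e1 (bracket E e2 e3) =
         bracket E (bracket E e1 e2) e3 + bracket E e2 (bracket E e1 e3)) \<and>
    (\<forall>e\<in>sections E. bracket E e e = (1/2) *\<^sub>R courant_D E (pair_fun E e e)) \<and>
    (\<forall>e\<in>sections E. \<forall>e1\<in>sections E. \<forall>e2\<in>sections E. \<forall>p\<in>pts (base E).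
       anchor E p (e p) (pair_fun E e1 e2) =
         pair_fun E (bracket E e e1) e2 p + pair_fun E e1 (bracket E e e2) p) \<and>
    (\<forall>e1\<in>sections E. \<forall>e2\<in>sections E.
       anchor_vf E (bracket E e1 e2) = lie_bracket (anchor_vf E e1) (anchor_vf E e2)) \<and>
    (\<forall>e1\<in>sections E. \<forall>e2\<in>sections E. \<forall>f\<in>C_inf (base E).
       bracket E e1 (\<lambda>p. f p *\<^sub>R e2 p) =
         (\<lambda>p. f p *\<^sub>R bracket E e1 e2 p + anchor_vf E e1 p f *\<^sub>R e2 p))"

definition lagrangian :: "('p, 'e, 'v) courant \<Rightarrow> 'p set \<Rightarrow> ('p \<Rightarrow> 'v set) \<Rightarrow> bool"
  where "lagrangian E Q L \<longleftrightarrow>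
    (\<forall>q\<in>Q. L q = {u \<in> fibre E q. \<forall>v\<in>L q. pairing E q u v = 0})"

definition sections_in ::
    "('p, 'e::euclidean_space, 'v::real_vector) courant \<Rightarrow> 'p set \<Rightarrow> ('p \<Rightarrow> 'v set) \<Rightarrow> ('p \<Rightarrow> 'v) set"
  where "sections_in E Q L = {e \<in> sections E. \<forall>q\<in>Q. e q \<in> L q}"

definition dirac_structure ::
    "('p, 'e::euclidean_space, 'v::real_vector) courant \<Rightarrow> ('p \<Rightarrow> 'v set) \<Rightarrow> bool"
  where "dirac_structure E L \<longleftrightarrow>
    smooth_subbundle (base E) E L \<and> lagrangian E (pts (base E)) L \<and>
    (\<forall>e1\<in>sections_in E (pts (base E)) L. \<forall>e2\<in>sections_in E (pts (base E)) L.
       bracket E e1 e2 \<in> sections_in E (pts (base E)) L)"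

definition manin_pair ::
    "('p, 'e::euclidean_space, 'v::real_vector) courant \<Rightarrow> ('p \<Rightarrow> 'v set) \<Rightarrow> bool"
  where "manin_pair D A \<longleftrightarrow> courant_algebroid D \<and> dirac_structure D A"

text \<open>The restriction to \<open>Q\<close> of a smooth section of \<open>E\<close> is automatically smooth, so it is a section
  of the subbundle \<open>L\<close> over \<open>Q\<close> iff it is pointwise in \<open>L\<close>.\<close>

definition generalized_dirac ::
    "('p, 'e::euclidean_space, 'v::real_vector) courant \<Rightarrow> ('p, 'f::euclidean_space) mfd
      \<Rightarrow> ('p \<Rightarrow> 'v set) \<Rightarrow> bool"
  where "generalized_dirac E Q L \<longleftrightarrow>
    embedded_submanifold Q (base E) \<and> smooth_subbundle Q E L \<and> lagrangian E (pts Q) L \<and>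
    (\<forall>q\<in>pts Q. anchor E q ` L q \<subseteq> push Q (base E) (\<lambda>q. q) ` tangent_space Q q) \<and>
    (\<forall>e1\<in>sections_in E (pts Q) L. \<forall>e2\<in>sections_in E (pts Q) L.
       bracket E e1 e2 \<in> sections_in E (pts Q) L)"


section \<open>The standard Courant algebroid and products\<close>

definition std_courant ::
    "('p, 'e::euclidean_space) mfd \<Rightarrow> ('p, 'e, 'p tvec \<times> 'p ctvec) courant"
  where "std_courant M =
    \<lparr> base = M,
      fibre = (\<lambda>p. tangent_space M p \<times> cotangent_space M p),
      rank = 2 * dim (model M),
      frames = {(U, e). openin (mtop M) U \<and>
        (\<forall>p\<in>U. is_basis (2 * dim (model M)) (\<lambda>i. e i p) (tangent_space M p \<times> cotangent_space M p)) \<and>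
        (\<forall>i<2 * dim (model M). smooth_vf_on M U (\<lambda>p. fst (e i p)) \<and>
           smooth_form_on M U (\<lambda>p. snd (e i p)))},
      pairing = (\<lambda>p (Y1, \<alpha>1) (Y2, \<alpha>2). (\<alpha>1 Y2 + \<alpha>2 Y1) / 2),
      anchor = (\<lambda>p. fst),
      bracket = (\<lambda>e1 e2 p.
        (lie_bracket (fst \<circ> e1) (fst \<circ> e2) p,
         lie_deriv M (fst \<circ> e1) (snd \<circ> e2) p - contract_d M (fst \<circ> e2) (snd \<circ> e1) p)) \<rparr>"

definition prod_data ::
    "('s, 'e::euclidean_space, 'v::real_vector) courant
      \<Rightarrow> ('x, 'f::euclidean_space, 'w::real_vector) courant
      \<Rightarrow> (('s \<times> 'x \<Rightarrow> 'v \<times> 'w) \<Rightarrow> ('s \<times> 'x \<Rightarrow> 'v \<times> 'w) \<Rightarrow> 's \<times> 'x \<Rightarrow> 'v \<times> 'w)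
      \<Rightarrow> ('s \<times> 'x, 'e \<times> 'f, 'v \<times> 'w) courant"
  where "prod_data D D' br =
    \<lparr> base = prod_mfd (base D) (base D'),
      fibre = (\<lambda>(s, x). fibre D s \<times> fibre D' x),
      rank = rank D + rank D',
      frames = {(U \<times> W, \<lambda>i (s, x). if i < rank D then (e i s, 0) else (0, e' (i - rank D) x))
                 | U e W e'. (U, e) \<in> frames D \<and> (W, e') \<in> frames D'},
      pairing = (\<lambda>(s, x) (d1, w1) (d2, w2). pairing D s d1 d2 + pairing D' x w1 w2),
      anchor = (\<lambda>(s, x) (d, w). tvec_pair (base D) (base D') (s, x) (anchor D s d) (anchor D' x w)),
      bracket = br \<rparr>"

definition pull1 :: "('x, 'f) mfd \<Rightarrow> ('s \<Rightarrow> 'v::zero) \<Rightarrow> 's \<times> 'x \<Rightarrow> 'v \<times> 'w::zero"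
  where "pull1 X d = (\<lambda>(s, x). if x \<in> pts X then (d s, 0) else 0)"

definition pull2 :: "('s, 'e) mfd \<Rightarrow> ('x \<Rightarrow> 'w::zero) \<Rightarrow> 's \<times> 'x \<Rightarrow> 'v::zero \<times> 'w"
  where "pull2 S w = (\<lambda>(s, x). if s \<in> pts S then (0, w x) else 0)"

text \<open>The product bracket is specified by its values on pulled back sections; the Courant
  algebroid axioms determine it on all other sections.\<close>

definition is_product_courant ::
    "('s, 'e::euclidean_space, 'v::real_vector) courant
      \<Rightarrow> ('x, 'f::euclidean_space, 'w::real_vector) courant
      \<Rightarrow> ('s \<times> 'x, 'e \<times> 'f, 'v \<times> 'w) courant \<Rightarrow> bool"
  where "is_product_courant D D' E \<longleftrightarrow>
    E = prod_data D D' (bracket E) \<and> courant_algebroid E \<and>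
    (\<forall>d1\<in>sections D. \<forall>d2\<in>sections D.
       bracket E (pull1 (base D') d1) (pull1 (base D') d2) = pull1 (base D') (bracket D d1 d2)) \<and>
    (\<forall>w1\<in>sections D'. \<forall>w2\<in>sections D'.
       bracket E (pull2 (base D) w1) (pull2 (base D) w2) = pull2 (base D) (bracket D' w1 w2)) \<and>
    (\<forall>d\<in>sections D. \<forall>w\<in>sections D'.
       bracket E (pull1 (base D') d) (pull2 (base D) w) = 0 \<and>
       bracket E (pull2 (base D) w) (pull1 (base D') d) = 0)"


section \<open>Hamiltonian spaces and their orbit spaces\<close>

definition hamiltonian_space ::
    "('s, 'e::euclidean_space, 'v::real_vector) courant \<Rightarrow> ('s \<Rightarrow> 'v set)
      \<Rightarrow> ('x, 'f::euclidean_space) mfd \<Rightarrow> ('x \<Rightarrow> 's)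
      \<Rightarrow> ('s \<times> 'x, 'e \<times> 'f, 'v \<times> ('x tvec \<times> 'x ctvec)) courant
      \<Rightarrow> ('s \<times> 'x \<Rightarrow> ('v \<times> ('x tvec \<times> 'x ctvec)) set) \<Rightarrow> bool"
  where "hamiltonian_space D A X J E F \<longleftrightarrow>
    smooth_manifold X \<and> smooth_map X (base D) J \<and>
    is_product_courant D (std_courant X) E \<and>
    generalized_dirac E (graph_mfd (base D) X J) F \<and>
    (\<forall>x\<in>pts X. F (J x, x) \<inter> {0} \<times> (tangent_space X x \<times> {0}) = {0}) \<and>
    (\<forall>x\<in>pts X. fst ` (F (J x, x) \<inter> fibre D (J x) \<times> (tangent_space X x \<times> {0})) = A (J x))"

definition induced_field ::
    "('x, 'f::euclidean_space) mfd \<Rightarrow> ('x \<Rightarrow> 's)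
      \<Rightarrow> ('s \<times> 'x \<Rightarrow> ('v \<times> ('x tvec \<times> 'x ctvec)) set) \<Rightarrow> ('s \<Rightarrow> 'v) \<Rightarrow> 'x \<Rightarrow> 'x tvec"
  where "induced_field X J F a = (\<lambda>x. if x \<in> pts X
    then (THE v. v \<in> tangent_space X x \<and> (a (J x), (v, 0)) \<in> F (J x, x)) else 0)"

definition integral_curve ::
    "('x, 'f::euclidean_space) mfd \<Rightarrow> ('x \<Rightarrow> 'x tvec) \<Rightarrow> (real \<Rightarrow> 'x) \<Rightarrow> bool"
  where "integral_curve X Y \<gamma> \<longleftrightarrow>
    continuous_map (top_of_set {0..1}) (mtop X) \<gamma> \<and>
    (\<forall>t\<in>{0..1}. \<forall>f\<in>C_inf X.
       ((\<lambda>t. f (\<gamma> t)) has_real_derivative Y (\<gamma> t) f) (at t within {0..1}))"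

text \<open>The leaves of the singular foliation are the Sussmann orbits: points joined by finitely many
  integral curves of the fields induced by sections of \<open>A\<close>. Curves over the unit interval suffice,
  and the relation is symmetric, because sections can be multiplied by real numbers.\<close>

definition orbit_rel ::
    "('s, 'e::euclidean_space, 'v::real_vector) courant \<Rightarrow> ('s \<Rightarrow> 'v set)
      \<Rightarrow> ('x, 'f::euclidean_space) mfd \<Rightarrow> ('x \<Rightarrow> 's)
      \<Rightarrow> ('s \<times> 'x \<Rightarrow> ('v \<times> ('x tvec \<times> 'x ctvec)) set) \<Rightarrow> ('x \<times> 'x) set"
  where "orbit_rel D A X J F = Restr ({(\<gamma> 0, \<gamma> 1) | \<gamma> a.
    a \<in> sections_in D (pts (base D)) A \<and> integral_curve X (induced_field X J F a) \<gamma>}\<^sup>*) (pts X)"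

definition orbit_space ::
    "('s, 'e::euclidean_space, 'v::real_vector) courant \<Rightarrow> ('s \<Rightarrow> 'v set)
      \<Rightarrow> ('x, 'f::euclidean_space) mfd \<Rightarrow> ('x \<Rightarrow> 's)
      \<Rightarrow> ('s \<times> 'x \<Rightarrow> ('v \<times> ('x tvec \<times> 'x ctvec)) set) \<Rightarrow> 'x set set"
  where "orbit_space D A X J F = pts X // orbit_rel D A X J F"

definition orbit_proj ::
    "('s, 'e::euclidean_space, 'v::real_vector) courant \<Rightarrow> ('s \<Rightarrow> 'v set)
      \<Rightarrow> ('x, 'f::euclidean_space) mfd \<Rightarrow> ('x \<Rightarrow> 's)
      \<Rightarrow> ('s \<times> 'x \<Rightarrow> ('v \<times> ('x tvec \<times> 'x ctvec)) set) \<Rightarrow> 'x \<Rightarrow> 'x set"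
  where "orbit_proj D A X J F x = orbit_rel D A X J F `` {x}"


section \<open>Poisson structures\<close>

definition poisson_structure ::
    "('p, 'e::euclidean_space) mfd \<Rightarrow> (('p \<Rightarrow> real) \<Rightarrow> ('p \<Rightarrow> real) \<Rightarrow> 'p \<Rightarrow> real) \<Rightarrow> bool"
  where "poisson_structure M br \<longleftrightarrow>
    (\<forall>f\<in>C_inf M. \<forall>g\<in>C_inf M. br f g \<in> C_inf M \<and> br f g = - br g f \<and>
       (\<forall>c. br (c *\<^sub>R f) g = c *\<^sub>R br f g) \<and>
       (\<forall>h\<in>C_inf M. br (f + g) h = br f h + br g h \<and>
          br f (g * h) = br f g * h + g * br f h \<and>
          br f (br g h) + br g (br h f) + br h (br f g) = 0))"

text \<open>A Poisson structure on the base of \<open>\<pi> : X \<rightarrow> B\<close> is the one induced by \<open>F\<close> if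
  \<open>\<pi>\<^sup>*{f, g} = v (\<pi>\<^sup>*g)\<close>, where \<open>v\<close> is the Hamiltonian vector of \<open>\<pi>\<^sup>*f\<close>, that is,
  \<open>(0, (v, d(\<pi>\<^sup>*f))) \<in> F\<close>. There is at most one such bracket when \<open>\<pi>\<close> is onto.\<close>

definition induced_bracket ::
    "('x, 'f::euclidean_space) mfd \<Rightarrow> ('x \<Rightarrow> 's)
      \<Rightarrow> ('s \<times> 'x \<Rightarrow> ('v::zero \<times> ('x tvec \<times> 'x ctvec)) set)
      \<Rightarrow> ('b, 'c::euclidean_space) mfd \<Rightarrow> ('x \<Rightarrow> 'b)
      \<Rightarrow> (('b \<Rightarrow> real) \<Rightarrow> ('b \<Rightarrow> real) \<Rightarrow> 'b \<Rightarrow> real) \<Rightarrow> bool"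
  where "induced_bracket X J F B \<pi> br \<longleftrightarrow>
    (\<forall>f\<in>C_inf B. \<forall>x\<in>pts X. \<exists>!v. v \<in> tangent_space X x \<and>
       (0, (v, dfun X (pullback X \<pi> f) x)) \<in> F (J x, x)) \<and>
    (\<forall>f\<in>C_inf B. \<forall>g\<in>C_inf B. \<forall>x\<in>pts X. \<forall>v\<in>tangent_space X x.
       (0, (v, dfun X (pullback X \<pi> f) x)) \<in> F (J x, x) \<longrightarrow>
       br f g (\<pi> x) = v (pullback X \<pi> g))"

end

theory Submission
  imports Defs
begin

text \<open>
  Write \<open>\<pi> : X \<rightarrow> X/~\<close> for the projection. A function \<open>f\<close> on the orbit space is the same as a function
  \<open>\<pi>\<^sup>*f\<close> on \<open>X\<close> that is annihilated by all fields \<open>hat a\<close> of the action. Its Hamiltonian vector field \<open>v\<^sub>f\<close> is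
  determined by \<open>(0, (v\<^sub>f, d\<pi>\<^sup>*f)) \<in> F\<close>, and the Poisson bracket is \<open>\<pi>\<^sup>*{f, g} = v\<^sub>f (\<pi>\<^sup>*g)\<close>.

  The vector \<open>v\<^sub>f\<close> is unique because \<open>F \<inter> TX = 0\<close>. It exists by linear algebra in one fibre
  (\<open>hamiltonian_vector_exists\<close>): the orthogonal complement of \<open>F + TX\<close> is \<open>F \<inter> (D \<times> TX)\<close>, whose elements
  are the \<open>(a, (hat a, 0))\<close>, and \<open>(0, (0, d\<pi>\<^sup>*f))\<close> is orthogonal to these; so it lies in \<open>F + TX\<close>. It is
  smooth because its coefficients in a local frame of \<open>F\<close> solve an injective linear system with smooth
  coefficients (\<open>lift_smooth\<close>, based on Gaussian elimination in the ring of germs).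

  All identities of the bracket come from the section \<open>(0, (v\<^sub>f, d\<pi>\<^sup>*f))\<close> of \<open>F\<close>. It is pulled back from \<open>X\<close>,
  where \<open>(v\<^sub>f, d\<pi>\<^sup>*f) \<circ> (v\<^sub>g, d\<pi>\<^sup>*g) = ([v\<^sub>f, v\<^sub>g], d(v\<^sub>f \<pi>\<^sup>*g))\<close>, and \<open>F\<close> is closed under the bracket. Hence
  \<open>(0, ([v\<^sub>f, v\<^sub>g], d(v\<^sub>f \<pi>\<^sup>*g)))\<close> lies in \<open>F\<close> (\<open>ham_bracket\<close>). Pairing it with \<open>(a, (hat a, 0))\<close> shows that
  \<open>v\<^sub>f \<pi>\<^sup>*g\<close> is invariant, so that \<open>{f, g}\<close> is well defined on orbits; uniqueness shows that the
  Hamiltonian field of \<open>{f, g}\<close> is \<open>[v\<^sub>f, v\<^sub>g]\<close>, which is the Jacobi identity. Antisymmetry is the isotropy of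
  \<open>F\<close>, and the Leibniz rule holds because \<open>v\<^sub>f\<close> is a derivation.

  The rest is analysis. Orbits are joined by integral curves, so invariance under the fields \<open>hat a\<close> is
  the same as constancy on orbits once short integral curves exist (\<open>picard\<close>,
  \<open>short_integral_curve\<close>). A function on the orbit space is smooth if its pullback is, because a submersion has
  smooth local sections (\<open>smooth_inverse_function\<close>, \<open>smooth_descends_along_submersion\<close>). Both need that
  derivations at a point of \<open>X\<close> are directional derivatives. This is a dimension count
  (\<open>tangent_is_chart_vec\<close>): the frames of the bundle \<open>TX \<oplus> T\<^sup>*X\<close> have \<open>2 dim X\<close> elements, which bounds the
  dimension of the space of derivations by \<open>dim X\<close>.
\<close>

section \<open>Calculus of functions of class \<open>C\<^sup>k\<close> on a linear subspace\<close>

lemma Ck_on_subset: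
  assumes "Ck_on k V U f" "W \<subseteq> U"
  shows "Ck_on k V W f"
  using assms
proof (induction k arbitrary: f)
  case 0
  then show ?case by (auto intro: continuous_on_subset)
next
  case (Suc k)
  then obtain f' where "\<forall>x\<in>U. (f has_derivative f' x) (at x within U)"
    and "\<forall>v\<in>V. Ck_on k V U (\<lambda>x. f' x v)" by auto
  with Suc show ?case
    by (auto intro!: exI[of _ f'] intro: has_derivative_subset)
qed

lemma Ck_on_cong:
  assumes "Ck_on k V U f" "\<And>x. x \<in> U \<Longrightarrow> f x = g x"
  shows "Ck_on k V U g"
  using assms
proof (cases k)
  case 0
  then show ?thesis using assms by (auto cong: continuous_on_cong)
next
  case (Suc j)
  then obtain f' where "\<forall>x\<in>U. (f has_derivative f' x) (at x within U)"
    and "\<forall>v\<in>V. Ck_on j V U (\<lambda>x. f' x v)" using assms by auto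
  moreover from this have "\<forall>x\<in>U. (g has_derivative f' x) (at x within U)"
    using assms(2) has_derivative_transform by metis
  ultimately show ?thesis using Suc by auto
qed

lemma Ck_on_lower:
  assumes "Ck_on (Suc k) V U f"
  shows "Ck_on k V U f"
  using assms
proof (induction k arbitrary: f)
  case 0
  then show ?case
    by (auto simp: continuous_on_eq_continuous_within dest: has_derivative_continuous)
next
  case (Suc k)
  then obtain f' where "\<forall>x\<in>U. (f has_derivative f' x) (at x within U)"
    and "\<forall>v\<in>V. Ck_on (Suc k) V U (\<lambda>x. f' x v)" using Ck_on.simps(2) by metis
  with Suc.IH show ?case unfolding Ck_on.simps(2) by blast
qed

lemma Ck_on_imp_continuous:
  assumes "Ck_on k V U f"
  shows "continuous_on U f"
  using assms by (induction k) (auto dest: Ck_on_lower simp del: Ck_on.simps(2))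

lemma Ck_on_const: "Ck_on k V U (\<lambda>x. c)"
proof (induction k arbitrary: c)
  case (Suc k)
  then show ?case by (auto intro!: exI[of _ "\<lambda>_ _. 0"])
qed auto

lemma Ck_on_bounded_linear:
  assumes "bounded_linear L"
  shows "Ck_on k V U L"
proof (cases k)
  case 0
  then show ?thesis using assms by (simp add: linear_continuous_on)
next
  case (Suc j)
  then show ?thesis using assms
    by (auto intro!: exI[of _ "\<lambda>_. L"] Ck_on_const bounded_linear_imp_has_derivative)
qed

lemma Ck_on_linear_comp:
  assumes "bounded_linear L" "Ck_on k V U f"
  shows "Ck_on k V U (\<lambda>x. L (f x))"
  using assms(2)
proof (induction k arbitrary: f)
  case 0
  then show ?case using assms(1) by (simp add: bounded_linear.continuous_on)
next
  case (Suc k)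
  then obtain f' where "\<forall>x\<in>U. (f has_derivative f' x) (at x within U)"
    and "\<forall>v\<in>V. Ck_on k V U (\<lambda>x. f' x v)" by auto
  with Suc.IH show ?case
    by (auto intro!: exI[of _ "\<lambda>x v. L (f' x v)"] bounded_linear.has_derivative[OF assms(1)])
qed

lemma Ck_on_add:
  assumes "Ck_on k V U f" "Ck_on k V U g"
  shows "Ck_on k V U (\<lambda>x. f x + g x)"
  using assms
proof (induction k arbitrary: f g)
  case 0
  then show ?case by (auto intro: continuous_on_add)
next
  case (Suc k)
  then obtain f' g' where "\<forall>x\<in>U. (f has_derivative f' x) (at x within U)"
    "\<forall>v\<in>V. Ck_on k V U (\<lambda>x. f' x v)" "\<forall>x\<in>U. (g has_derivative g' x) (at x within U)"
    "\<forall>v\<in>V. Ck_on k V U (\<lambda>x. g' x v)" by auto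
  with Suc.IH show ?case
    by (auto intro!: exI[of _ "\<lambda>x v. f' x v + g' x v"] has_derivative_add)
qed

lemma Ck_on_sum:
  assumes "\<And>i. i \<in> I \<Longrightarrow> Ck_on k V U (f i)"
  shows "Ck_on k V U (\<lambda>x. \<Sum>i\<in>I. f i x)"
  using assms by (induction I rule: infinite_finite_induct) (auto intro: Ck_on_const Ck_on_add)

lemma Ck_on_scaleR:
  assumes "Ck_on k V U f" "Ck_on k V U g"
  shows "Ck_on k V U (\<lambda>x. f x *\<^sub>R g x)"
  using assms
proof (induction k arbitrary: f g)
  case 0
  then show ?case by (auto intro: continuous_on_scaleR)
next
  case (Suc k)
  then obtain f' g' where *: "\<forall>x\<in>U. (f has_derivative f' x) (at x within U)"
    "\<forall>v\<in>V. Ck_on k V U (\<lambda>x. f' x v)" "\<forall>x\<in>U. (g has_derivative g' x) (at x within U)"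
    "\<forall>v\<in>V. Ck_on k V U (\<lambda>x. g' x v)" by auto
  have "Ck_on k V U f" "Ck_on k V U g" using Suc.prems Ck_on_lower by blast+
  with * Suc.IH show ?case
    by (auto intro!: exI[of _ "\<lambda>x v. f x *\<^sub>R g' x v + f' x v *\<^sub>R g x"] has_derivative_scaleR
      Ck_on_add)
qed

lemma Ck_on_mult:
  fixes f g :: "_ \<Rightarrow> real"
  assumes "Ck_on k V U f" "Ck_on k V U g"
  shows "Ck_on k V U (\<lambda>x. f x * g x)"
  using Ck_on_scaleR[OF assms] by simp

lemma Ck_on_inverse:
  fixes f :: "_ \<Rightarrow> real"
  assumes "Ck_on k V U f" "\<And>x. x \<in> U \<Longrightarrow> f x \<noteq> 0"
  shows "Ck_on k V U (\<lambda>x. inverse (f x))"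
  using assms
proof (induction k arbitrary: f)
  case 0
  then show ?case by (auto intro: continuous_on_inverse)
next
  case (Suc k)
  then obtain f' where *: "\<forall>x\<in>U. (f has_derivative f' x) (at x within U)"
    "\<forall>v\<in>V. Ck_on k V U (\<lambda>x. f' x v)" by auto
  have "Ck_on k V U (\<lambda>x. inverse (f x))" using Suc Ck_on_lower by blast
  then have "Ck_on k V U (\<lambda>x. - 1 * (inverse (f x) * f' x v * inverse (f x)))" if "v \<in> V" for v
    using * that by (intro Ck_on_mult Ck_on_const) auto
  with * Suc.prems(2) show ?case
    by (auto intro!: exI[of _ "\<lambda>x v. - (inverse (f x) * f' x v * inverse (f x))"] has_derivative_inverse)
qed

lemma Ck_on_euclidean:
  fixes f :: "_ \<Rightarrow> 'b::euclidean_space"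
  assumes "\<And>b. b \<in> Basis \<Longrightarrow> Ck_on k V U (\<lambda>x. f x \<bullet> b)"
  shows "Ck_on k V U f"
proof -
  have "Ck_on k V U (\<lambda>x. \<Sum>b\<in>Basis. (f x \<bullet> b) *\<^sub>R b)"
    by (intro Ck_on_sum Ck_on_scaleR Ck_on_const assms)
  then show ?thesis by (simp add: euclidean_representation)
qed

lemma subspace_orthonormal_expansion:
  fixes V :: "'b::euclidean_space set"
  assumes "subspace V"
  obtains B where "finite B" "B \<subseteq> V" "independent B" "span B = V" "card B = dim V"
    "\<And>b c. b \<in> B \<Longrightarrow> c \<in> B \<Longrightarrow> b \<bullet> c = (if b = c then 1 else 0)"
    "\<And>x. x \<in> V \<Longrightarrow> (\<Sum>b\<in>B. (x \<bullet> b) *\<^sub>R b) = x"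
proof -
  obtain B where B: "B \<subseteq> V" "pairwise orthogonal B" "\<And>x. x \<in> B \<Longrightarrow> norm x = 1"
    "independent B" "card B = dim V" "span B = V"
    using orthonormal_basis_subspace[OF assms] by metis
  have fin: "finite B" using B(4) independent_imp_finite by blast
  have ort: "b \<bullet> c = (if b = c then 1 else 0)" if "b \<in> B" "c \<in> B" for b c
    using B that by (auto simp: pairwise_def orthogonal_def norm_eq_1)
  have "(\<Sum>b\<in>B. (x \<bullet> b) *\<^sub>R b) = x" if "x \<in> V" for x
  proof -
    have "x \<in> span B" using that B by simp
    then obtain u where u: "x = (\<Sum>b\<in>B. u b *\<^sub>R b)"
      using fin by (auto simp: span_finite)
    have "x \<bullet> c = u c" if "c \<in> B" for c
    proof -
      have "x \<bullet> c = (\<Sum>b\<in>B. u b * (b \<bullet> c))" by (simp add: u inner_sum_left)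
      also have "\<dots> = (\<Sum>b\<in>B. if b = c then u b else 0)"
        by (rule sum.cong) (auto simp: ort that)
      finally show ?thesis using fin that by simp
    qed
    then show ?thesis using u by simp
  qed
  then show ?thesis using that[of B] B ort fin by blast
qed

text \<open>A derivative within a set contained in a subspace may be replaced by its composition with the
  orthogonal projection; this makes the chain rule below free of tangency considerations.\<close>

lemma has_derivative_project:
  assumes f: "(f has_derivative f') (at x within U)" and "x \<in> U" "U \<subseteq> V" "subspace V" "finite B"
    and ex: "\<And>x. x \<in> V \<Longrightarrow> (\<Sum>b\<in>B. (x \<bullet> b) *\<^sub>R b) = x"
  shows "(f has_derivative (\<lambda>v. \<Sum>b\<in>B. (v \<bullet> b) *\<^sub>R f' b)) (at x within U)"
proof -
  have lin: "bounded_linear f'" using f by (rule has_derivative_bounded_linear)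
  have eq: "(\<Sum>b\<in>B. (v \<bullet> b) *\<^sub>R f' b) = f' v" if "v \<in> V" for v
  proof -
    have "f' v = f' (\<Sum>b\<in>B. (v \<bullet> b) *\<^sub>R b)" using ex that by simp
    then show ?thesis using lin by (simp add: linear_sum linear_cmul bounded_linear.linear)
  qed
  have "bounded_linear (\<lambda>v. \<Sum>b\<in>B. (v \<bullet> b) *\<^sub>R f' b)"
    by (intro bounded_linear_sum bounded_linear_scaleR_const bounded_linear_inner_left)
  moreover have "((\<lambda>y. (1 / norm (y - x)) *\<^sub>R (f y - (f x + (\<Sum>b\<in>B. ((y - x) \<bullet> b) *\<^sub>R f' b)))) \<longlongrightarrow> 0) (at x within U)"
  proof (rule Lim_transform_eventually)
    show "((\<lambda>y. (1 / norm (y - x)) *\<^sub>R (f y - (f x + f' (y - x)))) \<longlongrightarrow> 0) (at x within U)"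
      using f by (simp add: has_derivative_within)
    show "\<forall>\<^sub>F y in at x within U. (1 / norm (y - x)) *\<^sub>R (f y - (f x + f' (y - x))) =
       (1 / norm (y - x)) *\<^sub>R (f y - (f x + (\<Sum>b\<in>B. ((y - x) \<bullet> b) *\<^sub>R f' b)))"
      unfolding eventually_at_filter
      using assms(2-4) eq by (auto intro!: always_eventually simp: subspace_diff subset_iff)
  qed
  ultimately show ?thesis by (simp add: has_derivative_within)
qed

lemma Ck_on_compose:
  fixes f :: "'b::euclidean_space \<Rightarrow> 'c::real_normed_vector" and g :: "'a::euclidean_space \<Rightarrow> 'b"
  assumes "Ck_on k V' W f" "Ck_on k V U g" "g ` U \<subseteq> W" "W \<subseteq> V'" "subspace V'"
  shows "Ck_on k V U (\<lambda>x. f (g x))"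
  using assms(1,2)
proof (induction k arbitrary: f)
  case 0
  then show ?case using assms(3) continuous_on_compose2 by (metis Ck_on.simps(1))
next
  case (Suc k)
  obtain f' where f': "\<forall>x\<in>W. (f has_derivative f' x) (at x within W)"
    "\<forall>v\<in>V'. Ck_on k V' W (\<lambda>x. f' x v)" using Suc.prems by auto
  obtain g' where g': "\<forall>x\<in>U. (g has_derivative g' x) (at x within U)"
    "\<forall>v\<in>V. Ck_on k V U (\<lambda>x. g' x v)" using Suc.prems by auto
  obtain B where B: "finite B" "B \<subseteq> V'" "\<And>x. x \<in> V' \<Longrightarrow> (\<Sum>b\<in>B. (x \<bullet> b) *\<^sub>R b) = x"
    using subspace_orthonormal_expansion[OF assms(5)] by metis
  have gk: "Ck_on k V U g" using Suc.prems Ck_on_lower by blast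
  show ?case unfolding Ck_on.simps
  proof (intro exI[of _ "\<lambda>x v. \<Sum>b\<in>B. (g' x v \<bullet> b) *\<^sub>R f' (g x) b"] conjI ballI)
    fix x assume x: "x \<in> U"
    then have "g x \<in> W" using assms(3) by auto
    then have "(f has_derivative (\<lambda>v. \<Sum>b\<in>B. (v \<bullet> b) *\<^sub>R f' (g x) b)) (at (g x) within W)"
      using f' B assms by (intro has_derivative_project[where V=V']) auto
    then show "((\<lambda>x. f (g x)) has_derivative (\<lambda>v. \<Sum>b\<in>B. (g' x v \<bullet> b) *\<^sub>R f' (g x) b)) (at x within U)"
      using has_derivative_in_compose has_derivative_subset[OF _ assms(3)] g'(1) x by blast
  next
    fix v assume v: "v \<in> V"
    show "Ck_on k V U (\<lambda>x. \<Sum>b\<in>B. (g' x v \<bullet> b) *\<^sub>R f' (g x) b)"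
    proof (intro Ck_on_sum Ck_on_scaleR)
      fix b assume b: "b \<in> B"
      show "Ck_on k V U (\<lambda>x. g' x v \<bullet> b)"
        using g'(2) v by (intro Ck_on_linear_comp[OF bounded_linear_inner_left]) auto
      show "Ck_on k V U (\<lambda>x. f' (g x) b)" using Suc.IH f'(2) b B gk by auto
    qed
  qed
qed

definition dir_deriv :: "('e::euclidean_space \<Rightarrow> 'f::real_normed_vector) \<Rightarrow> 'e \<Rightarrow> 'e \<Rightarrow> 'f"
  where "dir_deriv f v x = vector_derivative (\<lambda>t. f (x + t *\<^sub>R v)) (at 0)"

lemma openin_line:
  fixes V :: "'e::euclidean_space set"
  assumes "openin (top_of_set V) U" "subspace V" "x \<in> U" "v \<in> V"
  shows "open {t. x + t *\<^sub>R v \<in> U}"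
proof -
  obtain O1 where O1: "open O1" "U = V \<inter> O1" using assms(1) by (auto simp: openin_open)
  have "{t. x + t *\<^sub>R v \<in> U} = (\<lambda>t. x + t *\<^sub>R v) -` O1"
    using O1 assms by (auto intro: subspace_add subspace_scale)
  moreover have "open ((\<lambda>t. x + t *\<^sub>R v) -` O1)"
    by (intro open_vimage O1 continuous_intros)
  ultimately show ?thesis by simp
qed

lemma has_vector_derivative_line:
  fixes V :: "'e::euclidean_space set"
  assumes "openin (top_of_set V) U" "subspace V" "x \<in> U" "v \<in> V"
    and f: "(f has_derivative f') (at x within U)"
  shows "((\<lambda>t. f (x + t *\<^sub>R v)) has_vector_derivative f' v) (at 0)"
proof -
  let ?T = "{t. x + t *\<^sub>R v \<in> U}" and ?l = "\<lambda>t. x + t *\<^sub>R v"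
  have "(?l has_derivative (\<lambda>t. t *\<^sub>R v)) (at 0 within ?T)"
    by (auto intro!: derivative_eq_intros)
  moreover have "(f has_derivative f') (at (?l 0) within ?l ` ?T)"
    using f by (auto intro: has_derivative_subset)
  ultimately have "((\<lambda>t. f (?l t)) has_derivative (\<lambda>t. f' (t *\<^sub>R v))) (at 0 within ?T)"
    by (rule has_derivative_in_compose)
  moreover have "at 0 within ?T = at 0"
    by (rule at_within_open) (use openin_line[OF assms(1-4)] assms(3) in simp_all)
  moreover have "f' (t *\<^sub>R v) = t *\<^sub>R f' v" for t
    using linear_cmul[OF bounded_linear.linear[OF has_derivative_bounded_linear[OF f]]] by blast
  ultimately show ?thesis by (simp add: has_vector_derivative_def)
qed

lemma dir_deriv_eq:
  fixes V :: "'e::euclidean_space set"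
  assumes "openin (top_of_set V) U" "subspace V" "x \<in> U" "v \<in> V"
    and "(f has_derivative f') (at x within U)"
  shows "dir_deriv f v x = f' v"
  unfolding dir_deriv_def using has_vector_derivative_line[OF assms] by (rule vector_derivative_at)

text \<open>Directional derivatives do not refer to the set on which a function is considered. This
  characterisation therefore turns being of class \<open>C\<^sup>k\<close> into a local property.\<close>

lemma Ck_on_Suc_iff:
  fixes V :: "'e::euclidean_space set"
  assumes "openin (top_of_set V) U" "subspace V"
  shows "Ck_on (Suc k) V U f \<longleftrightarrow>
    (\<forall>x\<in>U. f differentiable (at x within U)) \<and> (\<forall>v\<in>V. Ck_on k V U (dir_deriv f v))"
proof
  assume "Ck_on (Suc k) V U f"
  then obtain f' where f': "\<forall>x\<in>U. (f has_derivative f' x) (at x within U)"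
    "\<forall>v\<in>V. Ck_on k V U (\<lambda>x. f' x v)" by auto
  then show "(\<forall>x\<in>U. f differentiable (at x within U)) \<and> (\<forall>v\<in>V. Ck_on k V U (dir_deriv f v))"
    by (fastforce simp: differentiable_def dest: dir_deriv_eq[OF assms]
      intro: Ck_on_cong[of _ _ _ "\<lambda>x. f' x _"])
next
  assume *: "(\<forall>x\<in>U. f differentiable (at x within U)) \<and> (\<forall>v\<in>V. Ck_on k V U (dir_deriv f v))"
  then obtain f' where f': "\<forall>x\<in>U. (f has_derivative f' x) (at x within U)"
    unfolding differentiable_def by metis
  with * show "Ck_on (Suc k) V U f"
    by (auto intro!: exI[of _ f'] intro: Ck_on_cong[of _ _ _ "dir_deriv f _"] simp: dir_deriv_eq[OF assms])
qed

lemma at_within_openin: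
  assumes "openin (top_of_set V) U" "x \<in> U"
  shows "at x within U = at x within V"
proof -
  obtain O1 where O1: "open O1" "U = V \<inter> O1" using assms(1) by (auto simp: openin_open)
  then show ?thesis using assms by (intro at_within_nhd[of _ O1]) auto
qed

lemma Ck_on_local:
  fixes V :: "'e::euclidean_space set"
  assumes V: "subspace V" "openin (top_of_set V) U"
    and loc: "\<And>x. x \<in> U \<Longrightarrow> \<exists>N. openin (top_of_set V) N \<and> x \<in> N \<and> Ck_on k V N f"
  shows "Ck_on k V U f"
  using loc
proof (induction k arbitrary: f)
  case 0
  show ?case unfolding Ck_on.simps continuous_on_eq_continuous_within
  proof
    fix x assume x: "x \<in> U"
    with 0 obtain N where N: "openin (top_of_set V) N" "x \<in> N" "continuous_on N f"
      by (metis Ck_on.simps(1))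
    then show "continuous (at x within U) f"
      using at_within_openin V(2) x by (metis continuous_on_eq_continuous_within)
  qed
next
  case (Suc k)
  show ?case unfolding Ck_on_Suc_iff[OF V(2,1)]
  proof (intro conjI ballI)
    fix x assume x: "x \<in> U"
    with Suc.prems obtain N where N: "openin (top_of_set V) N" "x \<in> N" "Ck_on (Suc k) V N f"
      by blast
    then show "f differentiable (at x within U)"
      using at_within_openin V(2) x Ck_on_Suc_iff[OF N(1) V(1)] by metis
  next
    fix v assume v: "v \<in> V"
    show "Ck_on k V U (dir_deriv f v)"
    proof (rule Suc.IH)
      fix x assume x: "x \<in> U"
      with Suc.prems obtain N where N: "openin (top_of_set V) N" "x \<in> N" "Ck_on (Suc k) V N f"
        by blast
      then show "\<exists>N. openin (top_of_set V) N \<and> x \<in> N \<and> Ck_on k V N (dir_deriv f v)"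
        using Ck_on_Suc_iff[OF N(1) V(1)] v by blast
    qed
  qed
qed

lemma smooth_on_dir_deriv:
  assumes "openin (top_of_set V) U" "subspace V" "smooth_on V U f" "v \<in> V"
  shows "smooth_on V U (dir_deriv f v)"
  using assms unfolding smooth_on_def by (metis Ck_on_Suc_iff)

lemma smooth_on_has_derivative:
  assumes "smooth_on V U f" "x \<in> U"
  obtains f' where "(f has_derivative f') (at x within U)"
  using assms unfolding smooth_on_def by (metis Ck_on.simps(2))

lemma smooth_on_subset: "smooth_on V U f \<Longrightarrow> W \<subseteq> U \<Longrightarrow> smooth_on V W f"
  unfolding smooth_on_def using Ck_on_subset by blast

lemma smooth_on_cong: "smooth_on V U f \<Longrightarrow> (\<And>x. x \<in> U \<Longrightarrow> f x = g x) \<Longrightarrow> smooth_on V U g"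
  unfolding smooth_on_def using Ck_on_cong by blast

lemma smooth_on_compose:
  fixes f :: "'b::euclidean_space \<Rightarrow> 'c::real_normed_vector" and g :: "'a::euclidean_space \<Rightarrow> 'b"
  assumes "smooth_on V' W f" "smooth_on V U g" "g ` U \<subseteq> W" "W \<subseteq> V'" "subspace V'"
  shows "smooth_on V U (\<lambda>x. f (g x))"
  using assms unfolding smooth_on_def by (metis Ck_on_compose)

lemma Ck_on_model_mono:
  assumes "Ck_on k V' U f" "V \<subseteq> V'"
  shows "Ck_on k V U f"
  using assms(1)
proof (induction k arbitrary: f)
  case (Suc k)
  then obtain f' where "\<forall>x\<in>U. (f has_derivative f' x) (at x within U)"
    "\<forall>v\<in>V'. Ck_on k V' U (\<lambda>x. f' x v)" by auto
  with Suc.IH assms(2) show ?case by (auto intro!: exI[of _ f'])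
qed simp

lemma smooth_on_model_mono:
  assumes "smooth_on V' U f" "V \<subseteq> V'" "W \<subseteq> U"
  shows "smooth_on V W f"
  unfolding smooth_on_def
proof
  fix k
  have "Ck_on k V U f" using assms(1,2) Ck_on_model_mono unfolding smooth_on_def by blast
  then show "Ck_on k V W f" using assms(3) by (rule Ck_on_subset)
qed

lemma smooth_on_add: "smooth_on V U f \<Longrightarrow> smooth_on V U g \<Longrightarrow> smooth_on V U (\<lambda>x. f x + g x)"
  unfolding smooth_on_def by (iprover intro: Ck_on_add)

lemma smooth_on_mult:
  fixes f g :: "_ \<Rightarrow> real"
  shows "smooth_on V U f \<Longrightarrow> smooth_on V U g \<Longrightarrow> smooth_on V U (\<lambda>x. f x * g x)"
  unfolding smooth_on_def by (iprover intro: Ck_on_mult)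

lemma smooth_on_sum:
  "(\<And>i. i \<in> I \<Longrightarrow> smooth_on V U (f i)) \<Longrightarrow> smooth_on V U (\<lambda>x. \<Sum>i\<in>I. f i x)"
  unfolding smooth_on_def by (blast intro: Ck_on_sum)

lemma smooth_on_local:
  fixes V :: "'e::euclidean_space set"
  assumes "subspace V" "openin (top_of_set V) U"
    and "\<And>x. x \<in> U \<Longrightarrow> \<exists>N. openin (top_of_set V) N \<and> x \<in> N \<and> smooth_on V N f"
  shows "smooth_on V U f"
  using assms unfolding smooth_on_def by (metis Ck_on_local)

lemma smooth_on_euclidean_iff:
  fixes f :: "_ \<Rightarrow> 'b::euclidean_space"
  shows "smooth_on V U f \<longleftrightarrow> (\<forall>b\<in>Basis. smooth_on V U (\<lambda>x. f x \<bullet> b))"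
  unfolding smooth_on_def
  using Ck_on_euclidean[of _ V U f] Ck_on_linear_comp[OF bounded_linear_inner_left, of _ V U f]
  by blast


section \<open>Linear systems with parameters\<close>

text \<open>Gaussian elimination shows that the solution of a linear system inherits the regularity of its
  coefficients. The argument uses nothing but a ring of germs of functions at a point in which
  non-vanishing germs are invertible.\<close>

locale local_function_ring =
  fixes P :: "('p \<Rightarrow> real) \<Rightarrow> bool" and Fl :: "'p filter" and x0 :: 'p
  assumes add: "P f \<Longrightarrow> P g \<Longrightarrow> P (\<lambda>x. f x + g x)"
    and mult: "P f \<Longrightarrow> P g \<Longrightarrow> P (\<lambda>x. f x * g x)"
    and const: "P (\<lambda>x. c)"
    and inverse: "P f \<Longrightarrow> f x0 \<noteq> 0 \<Longrightarrow> P (\<lambda>x. inverse (f x))"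
    and nonzero: "P f \<Longrightarrow> f x0 \<noteq> 0 \<Longrightarrow> eventually (\<lambda>x. f x \<noteq> 0) Fl"
    and cong: "P f \<Longrightarrow> eventually (\<lambda>x. f x = g x) Fl \<Longrightarrow> P g"
begin

lemma diff: "P f \<Longrightarrow> P g \<Longrightarrow> P (\<lambda>x. f x - g x)"
proof -
  assume *: "P f" "P g"
  have "P (\<lambda>x. f x + (-1) * g x)" by (rule add[OF *(1) mult[OF const *(2)]])
  then show ?thesis by simp
qed

lemma sum: "(\<And>i. i \<in> I \<Longrightarrow> P (f i)) \<Longrightarrow> P (\<lambda>x. \<Sum>i\<in>I. f i x)"
proof (induction I rule: infinite_finite_induct)
  case (insert i I)
  then have "P (\<lambda>x. f i x + (\<Sum>j\<in>I. f j x))" by (intro add) auto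
  then show ?case using insert.hyps by simp
qed (simp_all add: const)

lemma solve:
  assumes "finite K"
    and "\<And>i j. i \<in> I \<Longrightarrow> j \<in> K \<Longrightarrow> P (M i j)" and "\<And>i. i \<in> I \<Longrightarrow> P (b i)"
    and "\<And>i. i \<in> I \<Longrightarrow> eventually (\<lambda>x. (\<Sum>j\<in>K. M i j x * c j x) = b i x) Fl"
    and "\<And>z. \<forall>i\<in>I. (\<Sum>j\<in>K. M i j x0 * z j) = 0 \<Longrightarrow> \<forall>j\<in>K. z j = (0::real)"
  shows "\<forall>j\<in>K. P (c j)"
  using assms
proof (induction K arbitrary: M b rule: finite_induct)
  case empty
  then show ?case by simp
next
  case (insert k K)
  note PM = insert.prems(1) and Pb = insert.prems(2) and sol = insert.prems(3)
  have "\<exists>i\<in>I. M i k x0 \<noteq> 0"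
  proof (rule ccontr)
    assume "\<not> ?thesis"
    then have "\<forall>i\<in>I. (\<Sum>j\<in>insert k K. M i j x0 * (if j = k then 1 else 0)) = 0"
      using insert.hyps by (auto intro: sum.neutral)
    from insert.prems(4)[OF this] show False by auto
  qed
  then obtain i0 where i0: "i0 \<in> I" "M i0 k x0 \<noteq> 0" by blast
  define r where "r = (\<lambda>x. inverse (M i0 k x))"
  have Pr: "P r" unfolding r_def using PM i0 by (intro inverse) auto
  have nz: "eventually (\<lambda>x. M i0 k x \<noteq> 0) Fl" using PM i0 by (intro nonzero) auto
  define M' where "M' = (\<lambda>i j x. M i j x - M i k x * r x * M i0 j x)"
  define b' where "b' = (\<lambda>i x. b i x - M i k x * r x * b i0 x)"
  have row: "(\<Sum>j\<in>insert k K. M i j x * y j) = M i k x * y k + (\<Sum>j\<in>K. M i j x * y j)" for i x y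
    using insert.hyps by simp
  have row': "(\<Sum>j\<in>K. M' i j x * y j) =
      (\<Sum>j\<in>K. M i j x * y j) - M i k x * r x * (\<Sum>j\<in>K. M i0 j x * y j)" for i x y
    by (simp add: M'_def sum_subtractf sum_distrib_left algebra_simps)
  have PcK: "\<forall>j\<in>K. P (c j)"
  proof (rule insert.IH)
    show "P (M' i j)" if "i \<in> I" "j \<in> K" for i j
      unfolding M'_def using that i0 PM Pr by (intro diff mult) auto
    show "P (b' i)" if "i \<in> I" for i
      unfolding b'_def using that i0 PM Pb Pr by (intro diff mult) auto
    show "eventually (\<lambda>x. (\<Sum>j\<in>K. M' i j x * c j x) = b' i x) Fl" if "i \<in> I" for i
      using nz sol[OF that] sol[OF i0(1)]
    proof eventually_elim
      case (elim x)
      from elim(2,3) have "b i x - (\<Sum>j\<in>K. M i j x * c j x) = M i k x * c k x"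
        "b i0 x - (\<Sum>j\<in>K. M i0 j x * c j x) = M i0 k x * c k x"
        unfolding row by linarith+
      moreover from this(2) have "r x * (b i0 x - (\<Sum>j\<in>K. M i0 j x * c j x)) = c k x"
        using elim(1) by (simp add: r_def)
      ultimately have "M i k x * (r x * (b i0 x - (\<Sum>j\<in>K. M i0 j x * c j x))) =
          b i x - (\<Sum>j\<in>K. M i j x * c j x)" by simp
      then show ?case unfolding row' b'_def by (simp add: algebra_simps)
    qed
    show "\<forall>j\<in>K. z j = 0" if z: "\<forall>i\<in>I. (\<Sum>j\<in>K. M' i j x0 * z j) = 0" for z
    proof -
      define y where "y = z(k := - r x0 * (\<Sum>j\<in>K. M i0 j x0 * z j))"
      have yK: "(\<Sum>j\<in>K. M i j x0 * y j) = (\<Sum>j\<in>K. M i j x0 * z j)" for i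
        using insert.hyps by (intro sum.cong) (auto simp: y_def)
      have "\<forall>i\<in>I. (\<Sum>j\<in>insert k K. M i j x0 * y j) = 0"
        using z unfolding row row' yK by (simp add: y_def algebra_simps)
      then have "\<forall>j\<in>insert k K. y j = 0" by (rule insert.prems(4))
      then show ?thesis using insert.hyps by (auto simp: y_def split: if_splits)
    qed
  qed
  have "P (\<lambda>x. r x * (b i0 x - (\<Sum>j\<in>K. M i0 j x * c j x)))"
    using PcK PM Pb i0 Pr by (intro mult diff sum) auto
  moreover have "eventually (\<lambda>x. r x * (b i0 x - (\<Sum>j\<in>K. M i0 j x * c j x)) = c k x) Fl"
    using nz sol[OF i0(1)]
  proof eventually_elim
    case (elim x)
    from elim(2) have "b i0 x - (\<Sum>j\<in>K. M i0 j x * c j x) = M i0 k x * c k x"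
      unfolding row by linarith
    then show ?case using elim(1) by (simp add: r_def)
  qed
  ultimately have "P (c k)" by (rule cong)
  with PcK show ?case by simp
qed

end

text \<open>Germs of a fixed finite order of differentiability are considered, because the regularity of an
  inverse function is gained one order at a time.\<close>

lemma local_function_ring_Ck:
  fixes V :: "'e::euclidean_space set"
  assumes y: "y \<in> V"
  shows "local_function_ring (\<lambda>f. \<exists>N. openin (top_of_set V) N \<and> y \<in> N \<and> Ck_on k V N f)
    (nhdsin (top_of_set V) y) y"
proof -
  have two: "\<exists>N. openin (top_of_set V) N \<and> y \<in> N \<and> Ck_on k V N h"
    if op: "\<And>N. Ck_on k V N f \<Longrightarrow> Ck_on k V N g \<Longrightarrow> Ck_on k V N h" and fg:
      "\<exists>N. openin (top_of_set V) N \<and> y \<in> N \<and> Ck_on k V N f"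
      "\<exists>N. openin (top_of_set V) N \<and> y \<in> N \<and> Ck_on k V N g" for f g h :: "'e \<Rightarrow> real"
  proof -
    obtain N N' where "openin (top_of_set V) N \<and> y \<in> N \<and> Ck_on k V N f"
      "openin (top_of_set V) N' \<and> y \<in> N' \<and> Ck_on k V N' g" using fg by blast
    then show ?thesis
      using op[of "N \<inter> N'"] by (auto intro!: exI[of _ "N \<inter> N'"] intro: Ck_on_subset)
  qed
  have nz: "\<exists>N'. openin (top_of_set V) N' \<and> y \<in> N' \<and> Ck_on k V N' f \<and> (\<forall>x\<in>N'. f x \<noteq> 0)"
    if f: "\<exists>N. openin (top_of_set V) N \<and> y \<in> N \<and> Ck_on k V N f" and 0: "f y \<noteq> 0" for f :: "'e \<Rightarrow> real"
  proof -
    obtain N where N: "openin (top_of_set V) N" "y \<in> N" "Ck_on k V N f" using f by blast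
    have "openin (top_of_set N) (N \<inter> f -` (- {0}))"
      using Ck_on_imp_continuous[OF N(3)] by (rule continuous_openin_preimage_gen) auto
    then have "openin (top_of_set V) (N \<inter> f -` (- {0}))" using N(1) openin_trans by blast
    then show ?thesis using N 0
      by (intro exI[of _ "N \<inter> f -` (- {0})"]) (auto intro: Ck_on_subset)
  qed
  show ?thesis
  proof
    fix f g :: "'e \<Rightarrow> real"
    assume f: "\<exists>N. openin (top_of_set V) N \<and> y \<in> N \<and> Ck_on k V N f"
    show "\<exists>N. openin (top_of_set V) N \<and> y \<in> N \<and> Ck_on k V N (\<lambda>x. f x + g x)"
      if "\<exists>N. openin (top_of_set V) N \<and> y \<in> N \<and> Ck_on k V N g"
      using f that by (rule two[rotated]) (rule Ck_on_add)
    show "\<exists>N. openin (top_of_set V) N \<and> y \<in> N \<and> Ck_on k V N (\<lambda>x. f x * g x)"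
      if "\<exists>N. openin (top_of_set V) N \<and> y \<in> N \<and> Ck_on k V N g"
      using f that by (rule two[rotated]) (rule Ck_on_mult)
    show "\<exists>N. openin (top_of_set V) N \<and> y \<in> N \<and> Ck_on k V N (\<lambda>x. inverse (f x))" if "f y \<noteq> 0"
      using nz[OF f that] Ck_on_inverse by blast
    show "eventually (\<lambda>x. f x \<noteq> 0) (nhdsin (top_of_set V) y)" if "f y \<noteq> 0"
      using nz[OF f that] by (auto simp: eventually_nhdsin)
    show "\<exists>N. openin (top_of_set V) N \<and> y \<in> N \<and> Ck_on k V N g"
      if ev: "eventually (\<lambda>x. f x = g x) (nhdsin (top_of_set V) y)"
    proof -
      obtain S where S: "openin (top_of_set V) S" "y \<in> S" "\<forall>x\<in>S. f x = g x"
        using ev y by (auto simp: eventually_nhdsin)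
      obtain N where N: "openin (top_of_set V) N" "y \<in> N" "Ck_on k V N f" using f by blast
      have "Ck_on k V (N \<inter> S) f" using N(3) by (rule Ck_on_subset) auto
      then have "Ck_on k V (N \<inter> S) g" by (rule Ck_on_cong) (use S in auto)
      then show ?thesis using S N by (intro exI[of _ "N \<inter> S"]) auto
    qed
  next
    fix c :: real
    show "\<exists>N. openin (top_of_set V) N \<and> y \<in> N \<and> Ck_on k V N (\<lambda>x. c)"
      using y by (auto intro!: exI[of _ V] Ck_on_const)
  qed
qed


section \<open>Bump functions\<close>

text \<open>The family is closed under differentiation up to linear combinations, so that all its members
  are smooth by a simultaneous induction; \<open>flat 0\<close> is the usual \<open>exp (- 1 / t)\<close> extended by zero.\<close>

definition flat :: "nat \<Rightarrow> real \<Rightarrow> real"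
  where "flat n t = (if t > 0 then inverse t ^ n / exp (inverse t) else 0)"

lemma flat_tendsto_0: "(flat n \<longlongrightarrow> 0) (at 0)"
proof (rule filterlim_split_at)
  have "(flat n \<longlongrightarrow> 0) (at_left 0) \<longleftrightarrow> ((\<lambda>t. 0::real) \<longlongrightarrow> 0) (at_left (0::real))"
    by (rule tendsto_cong) (auto simp: flat_def eventually_at_filter)
  then show "(flat n \<longlongrightarrow> 0) (at_left 0)" by simp
  have "((\<lambda>t. inverse t ^ n / exp (inverse t)) \<longlongrightarrow> 0) (at_right (0::real))"
    by (rule filterlim_compose[OF tendsto_power_div_exp_0 filterlim_inverse_at_top_right])
  then show "(flat n \<longlongrightarrow> 0) (at_right 0)"
    by (rule Lim_transform_eventually) (auto simp: flat_def eventually_at_filter)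
qed

lemma has_derivative_flat:
  "(flat n has_real_derivative (flat (n + 2) t - real n * flat (n + 1) t)) (at t)"
proof (cases t "0::real" rule: linorder_cases)
  case less
  have "((\<lambda>t. 0) has_real_derivative 0) (at t)" by simp
  then have "(flat n has_real_derivative 0) (at t)"
    by (rule has_field_derivative_transform_within_open[where S="{..<0}"])
      (use less in \<open>auto simp: flat_def\<close>)
  with less show ?thesis by (simp add: flat_def)
next
  case greater
  define r where "r = inverse t"
  have d: "(inverse has_real_derivative - (r * r)) (at t)"
    using DERIV_inverse[of t UNIV] greater by (simp add: r_def numeral_2_eq_2)
  have "((\<lambda>t. inverse t ^ n) has_real_derivative real n * (- (r * r) * r ^ (n - 1))) (at t)"
    using DERIV_power[OF d, of n] by (simp add: r_def)
  moreover have "((\<lambda>t. exp (- inverse t)) has_real_derivative exp (- r) * (r * r)) (at t)"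
    using DERIV_chain2[OF DERIV_exp DERIV_minus[OF d]] by (simp add: r_def)
  ultimately have "((\<lambda>t. inverse t ^ n * exp (- inverse t)) has_real_derivative
     real n * (- (r * r) * r ^ (n - 1)) * exp (- r) + exp (- r) * (r * r) * r ^ n) (at t)"
    unfolding r_def by (rule DERIV_mult)
  moreover have "real n * (- (r * r) * r ^ (n - 1)) * exp (- r) + exp (- r) * (r * r) * r ^ n =
      flat (n + 2) t - real n * flat (n + 1) t"
    using greater by (cases n) (simp_all add: flat_def exp_minus divide_inverse flip: r_def)
  ultimately have "((\<lambda>t. inverse t ^ n * exp (- inverse t)) has_real_derivative
     (flat (n + 2) t - real n * flat (n + 1) t)) (at t)"
    by simp
  then show ?thesis
    by (rule has_field_derivative_transform_within_open[where S="{0<..}"])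
      (use greater in \<open>auto simp: flat_def exp_minus divide_inverse\<close>)
next
  case equal
  have "(flat (n + 1) \<longlongrightarrow> 0) (at 0)" by (rule flat_tendsto_0)
  moreover have "flat (n + 1) h = (flat n (0 + h) - flat n 0) / h" for h
    by (simp add: flat_def field_simps)
  ultimately have "((\<lambda>h. (flat n (0 + h) - flat n 0) / h) \<longlongrightarrow> 0) (at 0)"
    by (rule Lim_transform_eventually[OF _ always_eventually[OF allI]])
  then show ?thesis using equal by (simp add: DERIV_def flat_def)
qed

lemma Ck_on_flat: "Ck_on k UNIV U (flat n)"
proof (induction k arbitrary: n)
  case 0
  show ?case using has_derivative_flat
    by (auto intro!: continuous_at_imp_continuous_on DERIV_isCont)
next
  case (Suc k)
  have "Ck_on k UNIV U (\<lambda>t. v * (flat (n + 2) t + (- real n) * flat (n + 1) t))" for v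
    by (intro Ck_on_mult Ck_on_add Ck_on_const Suc)
  moreover have "(flat n has_derivative (\<lambda>v. v * (flat (n + 2) t + (- real n) * flat (n + 1) t))) (at t within U)" for t
    using has_derivative_flat[of n t]
    by (auto simp: has_field_derivative_def mult_commute_abs intro: has_derivative_at_withinI)
  ultimately show ?case by (auto intro!: exI[of _ "\<lambda>t v. v * (flat (n + 2) t + (- real n) * flat (n + 1) t)"])
qed

text \<open>The bump is \<open>u / (u + w)\<close> with \<open>u\<close> supported in the ball of radius \<open>R\<close> and \<open>w\<close> vanishing exactly on
  the ball of radius \<open>r\<close>; since \<open>r < R\<close>, the denominator has no zeros.\<close>

lemma bump_euclidean:
  fixes y0 :: "'e::euclidean_space"
  assumes "0 < r" "r < R"
  obtains b :: "'e \<Rightarrow> real" where "smooth_on V U b"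
    "\<And>y. dist y0 y \<le> r \<Longrightarrow> b y = 1" "\<And>y. R \<le> dist y0 y \<Longrightarrow> b y = 0"
proof -
  let ?q = "\<lambda>y. (y - y0) \<bullet> (y - y0)"
  define u where "u = (\<lambda>y. flat 0 (R\<^sup>2 + (-1) * ?q y))"
  define w where "w = (\<lambda>y. flat 0 (?q y + (- r\<^sup>2)))"
  define b where "b = (\<lambda>y. u y * inverse (u y + w y))"
  have q: "?q y = (dist y0 y)\<^sup>2" for y
    by (simp add: dist_norm norm_minus_commute flip: power2_norm_eq_inner)
  have rR: "r\<^sup>2 < R\<^sup>2" using assms by (intro power_strict_mono) auto
  have fl: "flat 0 t \<ge> 0" "flat 0 t > 0 \<longleftrightarrow> t > 0" for t by (auto simp: flat_def)
  have pos: "u y + w y \<noteq> 0" for y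
  proof -
    have "R\<^sup>2 + (-1) * ?q y > 0 \<or> ?q y + (- r\<^sup>2) > 0" using rR by linarith
    then have "u y > 0 \<or> w y > 0" "u y \<ge> 0" "w y \<ge> 0" unfolding u_def w_def by (simp_all only: fl)
    then show ?thesis by linarith
  qed
  have Cq: "Ck_on k UNIV UNIV ?q" for k
  proof -
    have "Ck_on k UNIV UNIV (\<lambda>y. \<Sum>i\<in>Basis. (y \<bullet> i + (- (y0 \<bullet> i))) * (y \<bullet> i + (- (y0 \<bullet> i))))"
      by (intro Ck_on_sum Ck_on_mult Ck_on_add Ck_on_const Ck_on_bounded_linear bounded_linear_inner_left)
    then show ?thesis by (rule Ck_on_cong) (subst euclidean_inner, simp add: inner_diff_left)
  qed
  have "Ck_on k UNIV UNIV (\<lambda>y. R\<^sup>2 + (-1) * ?q y)" "Ck_on k UNIV UNIV (\<lambda>y. ?q y + (- r\<^sup>2))" for k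
    by (intro Ck_on_mult Ck_on_add Ck_on_const Cq)+
  then have "Ck_on k UNIV UNIV u" "Ck_on k UNIV UNIV w" for k
    unfolding u_def w_def by (intro Ck_on_compose[OF Ck_on_flat[of _ UNIV]]; simp)+
  then have "Ck_on k UNIV UNIV b" for k
    unfolding b_def by (intro Ck_on_mult Ck_on_inverse Ck_on_add pos) auto
  then have "smooth_on UNIV UNIV b" by (simp add: smooth_on_def)
  then have "smooth_on V U b" by (rule smooth_on_model_mono) auto
  moreover have "b y = 1" if "dist y0 y \<le> r" for y
  proof -
    have "?q y \<le> r\<^sup>2" using that unfolding q by (intro power_mono) auto
    then have "w y = 0" by (simp add: w_def flat_def)
    then show ?thesis using pos[of y] by (simp add: b_def)
  qed
  moreover have "b y = 0" if "R \<le> dist y0 y" for y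
  proof -
    have "R\<^sup>2 \<le> ?q y" using that assms unfolding q by (intro power_mono) auto
    then show ?thesis by (simp add: b_def u_def flat_def)
  qed
  ultimately show ?thesis using that by blast
qed


section \<open>Inverse functions\<close>

text \<open>The inverse function theorem provides a differentiable inverse. Its derivative is the solution of a
  linear system with coefficients as regular as the inverse itself, so each order of
  differentiability yields the next.\<close>

lemma smooth_inverse_function:
  fixes f :: "'b::euclidean_space \<Rightarrow> 'b"
  assumes U: "open U" "x0 \<in> U" and f: "smooth_on UNIV U f"
    and D: "(f has_derivative D) (at x0)" "inj D"
  obtains W g where "open W" "f x0 \<in> W" "smooth_on UNIV W g" "g ` W \<subseteq> U"
    "\<And>y. y \<in> W \<Longrightarrow> f (g y) = y"
proof -
  have oU: "openin (top_of_set UNIV) U" using U by (metis open_openin subtopology_UNIV)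
  have der: "(f has_derivative (\<lambda>v. frechet_derivative f (at x) v)) (at x)" if "x \<in> U" for x
    using f that U(1) smooth_on_has_derivative[OF f that]
    by (metis at_within_open frechet_derivative_works differentiable_def)
  define f' where "f' = (\<lambda>x. Blinfun (frechet_derivative f (at x)))"
  have f': "blinfun_apply (f' x) = frechet_derivative f (at x)" if "x \<in> U" for x
    using der[OF that] has_derivative_bounded_linear by (auto simp: f'_def bounded_linear_Blinfun_apply)
  have derf: "(f has_derivative blinfun_apply (f' x)) (at x)" if "x \<in> U" for x
    using der f' that by simp
  have dir_deriv: "dir_deriv f v x = f' x v" if "x \<in> U" for x v
    using dir_deriv_eq[OF oU subspace_UNIV that UNIV_I has_derivative_at_withinI[OF derf[OF that]]] .
  have sm: "Ck_on k UNIV U (dir_deriv f v)" for k v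
    using smooth_on_dir_deriv[OF oU subspace_UNIV f] by (auto simp: smooth_on_def)
  have "continuous_on U (\<lambda>x. blinfun_apply (f' x) v)" for v
    using sm[of 0 v] by (simp add: dir_deriv cong: continuous_on_cong)
  then have cont: "continuous_on U f'" by (intro continuous_on_blinfun_componentwise)
  have Df: "D = blinfun_apply (f' x0)" using D(1) derf[OF U(2)] has_derivative_unique by blast
  then obtain L where L: "linear L" "\<And>v. L (D v) = v"
    using linear_injective_left_inverse[of D] D(2)
    by (metis blinfun.bounded_linear_right bounded_linear.linear comp_apply id_apply)
  then have "Blinfun L o\<^sub>L f' x0 = id_blinfun"
    using Df by (intro blinfun_eqI) (simp add: bounded_linear_Blinfun_apply linear_conv_bounded_linear)
  then obtain U' W g g' where W: "open U'" "U' \<subseteq> U" "open W" "f x0 \<in> W" "homeomorphism U' W f g"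
    and g': "\<And>y. y \<in> W \<Longrightarrow> (g has_derivative (g' y)) (at y)"
      "\<And>y. y \<in> W \<Longrightarrow> g' y = inv (blinfun_apply (f'(g y)))"
      "\<And>y. y \<in> W \<Longrightarrow> bij (blinfun_apply (f'(g y)))"
    using inverse_function_theorem[OF U(1) derf cont U(2)] by metis
  have gW: "g ` W \<subseteq> U" using W by (auto simp: homeomorphism_def)
  have fg: "f (g y) = y" if "y \<in> W" for y using W(5) that by (simp add: homeomorphism_def)
  have oW: "openin (top_of_set UNIV) W" using W by (metis open_openin subtopology_UNIV)
  have "Ck_on k UNIV W g" for k
  proof (induction k)
    case 0
    then show ?case using W by (auto simp: homeomorphism_def)
  next
    case (Suc k)
    have "Ck_on k UNIV W (\<lambda>y. g' y v)" for v
    proof (rule Ck_on_local[OF subspace_UNIV oW])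
      fix y0 assume y0: "y0 \<in> W"
      interpret local_function_ring "\<lambda>f. \<exists>N. openin (top_of_set UNIV) N \<and> y0 \<in> N \<and> Ck_on k UNIV N f"
        "nhdsin (top_of_set UNIV) y0" y0
        by (rule local_function_ring_Ck) simp
      \<comment> \<open>The derivative of the inverse solves a linear system whose coefficients are the
        derivatives of \<open>f\<close> along \<open>g\<close>.\<close>
      have expand: "(\<Sum>i\<in>Basis. (dir_deriv f i (g y) \<bullet> j) * (z \<bullet> i)) = f' (g y) z \<bullet> j"
        if "y \<in> W" for y z and j :: 'b
      proof -
        have "f' (g y) z = f' (g y) (\<Sum>i\<in>Basis. (z \<bullet> i) *\<^sub>R i)" by (simp add: euclidean_representation)
        also have "\<dots> = (\<Sum>i\<in>Basis. (z \<bullet> i) *\<^sub>R f' (g y) i)" by (simp add: blinfun.sum_right blinfun.scaleR_right)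
        finally show ?thesis using that gW by (auto simp: inner_sum_left dir_deriv mult.commute intro!: sum.cong)
      qed
      have ev: "eventually (\<lambda>y. y \<in> W) (nhdsin (top_of_set UNIV) y0)"
        using W y0 by (auto simp: eventually_nhdsin)
      have "\<forall>i\<in>Basis. \<exists>N. openin (top_of_set UNIV) N \<and> y0 \<in> N \<and> Ck_on k UNIV N (\<lambda>y. g' y v \<bullet> i)"
      proof (rule solve[where I=Basis and M="\<lambda>j i y. dir_deriv f i (g y) \<bullet> j" and b="\<lambda>j y. v \<bullet> j"])
        show "\<exists>N. openin (top_of_set UNIV) N \<and> y0 \<in> N \<and> Ck_on k UNIV N (\<lambda>y. dir_deriv f i (g y) \<bullet> j)" for i j
        proof -
          have "Ck_on k UNIV W (\<lambda>y. dir_deriv f i (g y))"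
            by (rule Ck_on_compose[OF sm Suc gW]) auto
          then have "Ck_on k UNIV W (\<lambda>y. dir_deriv f i (g y) \<bullet> j)"
            by (rule Ck_on_linear_comp[OF bounded_linear_inner_left])
          then show ?thesis using oW y0 by blast
        qed
        show "eventually (\<lambda>y. (\<Sum>i\<in>Basis. (dir_deriv f i (g y) \<bullet> j) * (g' y v \<bullet> i)) = v \<bullet> j) (nhdsin (top_of_set UNIV) y0)" for j
          using ev by eventually_elim (simp add: expand g'(2) surj_f_inv_f bij_is_surj[OF g'(3)])
        show "\<forall>j\<in>Basis. z j = 0" if z: "\<forall>j\<in>Basis. (\<Sum>i\<in>Basis. (dir_deriv f i (g y0) \<bullet> j) * z i) = 0" for z
        proof -
          have "f' (g y0) (\<Sum>i\<in>Basis. z i *\<^sub>R i) \<bullet> j = 0" if "j \<in> Basis" for j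
            using z that expand[OF y0, of j "\<Sum>i\<in>Basis. z i *\<^sub>R i"] by simp
          then have "f' (g y0) (\<Sum>i\<in>Basis. z i *\<^sub>R i) = 0" by (simp add: euclidean_eq_iff[where 'a='b])
          then have "(\<Sum>i\<in>Basis. z i *\<^sub>R i) = (0::'b)"
            using bij_is_inj[OF g'(3)[OF y0]] by (metis blinfun.zero_right injD)
          then have "(\<Sum>i\<in>Basis. z i *\<^sub>R i) \<bullet> j = 0" for j :: 'b by simp
          then show ?thesis by (metis inner_sum_left_Basis)
        qed
      qed (rule finite_Basis, rule const)
      then have "\<forall>i\<in>Basis. \<exists>N. openin (top_of_set UNIV) N \<and> y0 \<in> N \<and> Ck_on k UNIV N (\<lambda>y. g' y v \<bullet> i)" .
      then obtain N where N: "\<forall>i\<in>Basis. openin (top_of_set UNIV) (N i) \<and> y0 \<in> N i \<and>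
          Ck_on k UNIV (N i) (\<lambda>y. g' y v \<bullet> i)" by metis
      have "openin (top_of_set UNIV) (\<Inter>i\<in>Basis. N i)"
        using N by (intro openin_INT2) simp_all
      moreover have "Ck_on k UNIV (\<Inter>i\<in>Basis. N i) (\<lambda>y. g' y v)"
      proof (rule Ck_on_euclidean)
        fix i :: 'b assume i: "i \<in> Basis"
        show "Ck_on k UNIV (\<Inter>i\<in>Basis. N i) (\<lambda>y. g' y v \<bullet> i)"
          by (rule Ck_on_subset[of _ _ "N i"]) (use N i in auto)
      qed
      ultimately show "\<exists>N. openin (top_of_set UNIV) N \<and> y0 \<in> N \<and> Ck_on k UNIV N (\<lambda>y. g' y v)"
        using N by blast
    qed
    then show ?case using g'(1) has_derivative_at_withinI by (metis Ck_on.simps(2))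
  qed
  then have "smooth_on UNIV W g" by (simp add: smooth_on_def)
  with that W gW fg show ?thesis by blast
qed

text \<open>A linear right inverse \<open>A\<close> of the derivative selects a slice through the point on which \<open>G\<close> is a local
  diffeomorphism.\<close>

lemma submersion_local_section:
  fixes G :: "'a::euclidean_space \<Rightarrow> 'b::euclidean_space"
  assumes V: "subspace V" "subspace V'" and N: "openin (top_of_set V) N" "y0 \<in> N"
    and G: "smooth_on V N G" "G ` N \<subseteq> V'"
    and D: "(G has_derivative D) (at y0 within N)" "V' \<subseteq> D ` V"
  obtains W s where "openin (top_of_set V') W" "G y0 \<in> W" "smooth_on V' W s" "s ` W \<subseteq> N"
    "\<And>w. w \<in> W \<Longrightarrow> G (s w) = w"
proof -
  obtain B where B: "finite B" "B \<subseteq> V'" "independent B" "span B = V'"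
    and ex: "\<And>x. x \<in> V' \<Longrightarrow> (\<Sum>b\<in>B. (x \<bullet> b) *\<^sub>R b) = x"
    and on: "\<And>b c. b \<in> B \<Longrightarrow> c \<in> B \<Longrightarrow> b \<bullet> c = (if b = c then 1 else 0)"
    using subspace_orthonormal_expansion[OF V(2)] by metis
  have "\<forall>b\<in>B. \<exists>u\<in>V. D u = b" using B(2) D(2) by blast
  then obtain R where R: "\<And>b. b \<in> B \<Longrightarrow> R b \<in> V \<and> D (R b) = b" by metis
  define A where "A = (\<lambda>w. \<Sum>b\<in>B. (w \<bullet> b) *\<^sub>R R b)"
  define P where "P = (\<lambda>w. \<Sum>b\<in>B. (w \<bullet> b) *\<^sub>R b)"
  have bl: "bounded_linear A" "bounded_linear P" unfolding A_def P_def
    by (intro bounded_linear_sum bounded_linear_scaleR_const bounded_linear_inner_left)+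
  have AV: "A w \<in> V" for w unfolding A_def using R V by (auto intro: subspace_sum subspace_scale)
  have PV: "P w \<in> V'" for w unfolding P_def using B V by (auto intro!: subspace_sum subspace_scale)
  have PP: "P w = w" if "w \<in> V'" for w using ex that by (simp add: P_def)
  have linD: "linear D" using D(1) has_derivative_bounded_linear bounded_linear.linear by blast
  have DA: "D (A w) = P w" for w
    unfolding A_def P_def using R by (simp add: linear_sum[OF linD] linear_cmul[OF linD])
  \<comment> \<open>Extend the restriction of \<open>G\<close> to the slice \<open>y0 + A V'\<close> by the identity on the orthogonal
    complement of \<open>V'\<close>.\<close>
  define h where "h = (\<lambda>w. G (y0 + A w) + (w - P w))"
  define U where "U = {w. y0 + A w \<in> N}"
  obtain O1 where O1: "open O1" "N = V \<inter> O1" using N(1) by (auto simp: openin_open)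
  have "U = (\<lambda>w. y0 + A w) -` O1"
    using O1 N(2) AV V by (auto simp: U_def intro: subspace_add)
  then have "open U" using O1
    by (simp add: open_vimage continuous_on_add continuous_on_const linear_continuous_on bl)
  have A0: "A 0 = 0" "P 0 = 0" by (simp_all add: A_def P_def)
  have "0 \<in> U" using N by (simp add: U_def A0)
  have NV: "N \<subseteq> V" using O1 by simp
  have slice: "Ck_on k UNIV S (\<lambda>w. y0 + A w)" for k S
    by (intro Ck_on_add Ck_on_const Ck_on_bounded_linear bl)
  have "smooth_on UNIV U h" unfolding smooth_on_def
  proof
    fix k
    have "Ck_on k UNIV U (\<lambda>w. G (y0 + A w))"
      using G(1) V(1) NV by (intro Ck_on_compose[OF _ slice]) (auto simp: smooth_on_def U_def)
    moreover have "Ck_on k UNIV U (\<lambda>w. w - P w)"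
      by (intro Ck_on_bounded_linear bounded_linear_sub bl bounded_linear_ident)
    ultimately show "Ck_on k UNIV U h" unfolding h_def by (rule Ck_on_add)
  qed
  moreover have "(h has_derivative (\<lambda>w. w)) (at 0)"
  proof -
    have "((\<lambda>w. y0 + A w) has_derivative A) (at 0 within U)"
      using bl(1) by (auto intro!: derivative_eq_intros bounded_linear_imp_has_derivative)
    moreover have "(G has_derivative D) (at (y0 + A 0) within (\<lambda>w. y0 + A w) ` U)"
      using D(1) by (auto simp: A0 U_def intro: has_derivative_subset)
    ultimately have "((\<lambda>w. G (y0 + A w)) has_derivative (\<lambda>w. D (A w))) (at 0 within U)"
      by (rule has_derivative_in_compose)
    moreover have "((\<lambda>w. w - P w) has_derivative (\<lambda>w. w - P w)) (at 0 within U)"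
      by (intro bounded_linear_imp_has_derivative bounded_linear_sub bl bounded_linear_ident)
    ultimately have "(h has_derivative (\<lambda>w. D (A w) + (w - P w))) (at 0 within U)"
      unfolding h_def by (rule has_derivative_add)
    moreover have "at 0 within U = at 0" using \<open>0 \<in> U\<close> \<open>open U\<close> by (rule at_within_open)
    ultimately show ?thesis by (simp add: DA)
  qed
  moreover have "h 0 = G y0" by (simp add: h_def A0)
  ultimately obtain W g where W: "open W" "G y0 \<in> W" "smooth_on UNIV W g" "g ` W \<subseteq> U"
    "\<And>y. y \<in> W \<Longrightarrow> h (g y) = y"
    using smooth_inverse_function[OF \<open>open U\<close> \<open>0 \<in> U\<close>, of h "\<lambda>w. w"] by (metis inj_on_id2)
  show ?thesis
  proof (rule that[of "V' \<inter> W" "\<lambda>w. y0 + A (g w)"])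
    show "openin (top_of_set V') (V' \<inter> W)" using W(1) by blast
    show "G y0 \<in> V' \<inter> W" using W(2) G(2) N(2) by auto
    show "(\<lambda>w. y0 + A (g w)) ` (V' \<inter> W) \<subseteq> N" using W(4) by (auto simp: U_def)
    have "smooth_on V' (V' \<inter> W) g"
      using W(3) by (rule smooth_on_model_mono) auto
    then show "smooth_on V' (V' \<inter> W) (\<lambda>w. y0 + A (g w))"
      unfolding smooth_on_def by (auto intro!: Ck_on_add Ck_on_const Ck_on_linear_comp[OF bl(1)])
    show "G (y0 + A (g w)) = w" if "w \<in> V' \<inter> W" for w
    proof -
      have eq: "w = G (y0 + A (g w)) + (g w - P (g w))" using W(5)[of w] that by (simp add: h_def)
      have "G (y0 + A (g w)) \<in> V'" using W(4) that G(2) by (auto simp: U_def)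
      with eq have "g w - P (g w) \<in> V'" using that V(2) by (metis IntD1 add_diff_cancel_left' subspace_diff)
      then have "g w \<in> V'" using PV V(2) by (metis diff_add_cancel subspace_add)
      then show ?thesis using eq PP by simp
    qed
  qed
qed

section \<open>Integral curves\<close>

text \<open>The derivative within \<open>U\<close> is bounded on a compact set only in directions of \<open>V\<close>; composing it with
  the orthogonal projection onto \<open>V\<close> yields a bound for its operator norm.\<close>

lemma C1_lipschitz_on_compact_convex:
  fixes f :: "'e::euclidean_space \<Rightarrow> 'b::real_normed_vector"
  assumes f: "Ck_on 1 V U f" and S: "S \<subseteq> U" "compact S" "convex S" "U \<subseteq> V" "subspace V"
  obtains L where "0 \<le> L" "\<And>x y. x \<in> S \<Longrightarrow> y \<in> S \<Longrightarrow> norm (f x - f y) \<le> L * norm (x - y)"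
proof -
  obtain f' where f': "\<forall>x\<in>U. (f has_derivative f' x) (at x within U)"
    "\<forall>v\<in>V. continuous_on U (\<lambda>x. f' x v)" using f by auto
  obtain B where B: "finite B" "B \<subseteq> V" "\<And>b c. b \<in> B \<Longrightarrow> c \<in> B \<Longrightarrow> b \<bullet> c = (if b = c then 1 else 0)"
    "\<And>x. x \<in> V \<Longrightarrow> (\<Sum>b\<in>B. (x \<bullet> b) *\<^sub>R b) = x"
    using subspace_orthonormal_expansion[OF S(5)] by metis
  have "\<exists>C. \<forall>x\<in>S. norm (f' x b) \<le> C" if "b \<in> B" for b
  proof -
    have "continuous_on S (\<lambda>x. f' x b)" using f'(2) that B(2) S(1) continuous_on_subset by blast
    then have "bounded ((\<lambda>x. f' x b) ` S)" using S(2) compact_continuous_image compact_imp_bounded by blast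
    then show ?thesis by (auto simp: bounded_iff)
  qed
  then obtain C where C: "\<And>b x. b \<in> B \<Longrightarrow> x \<in> S \<Longrightarrow> norm (f' x b) \<le> C b" by metis
  define L where "L = (\<Sum>b\<in>B. \<bar>C b\<bar>)"
  have "norm (f x - f y) \<le> L * norm (x - y)" if "x \<in> S" "y \<in> S" for x y
  proof (rule differentiable_bound[OF S(3) _ _ that])
    fix x assume x: "x \<in> S"
    then have "(f has_derivative (\<lambda>v. \<Sum>b\<in>B. (v \<bullet> b) *\<^sub>R f' x b)) (at x within U)"
      using f' B S by (intro has_derivative_project[where V=V]) auto
    then show "(f has_derivative (\<lambda>v. \<Sum>b\<in>B. (v \<bullet> b) *\<^sub>R f' x b)) (at x within S)"
      using S(1) by (rule has_derivative_subset)
    show "onorm (\<lambda>v. \<Sum>b\<in>B. (v \<bullet> b) *\<^sub>R f' x b) \<le> L"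
    proof (rule onorm_bound)
      show "0 \<le> L" by (simp add: L_def sum_nonneg)
      fix v
      have "norm (\<Sum>b\<in>B. (v \<bullet> b) *\<^sub>R f' x b) \<le> (\<Sum>b\<in>B. norm v * \<bar>C b\<bar>)"
      proof (rule sum_norm_le)
        fix b assume b: "b \<in> B"
        have "norm b = 1" using B(3)[OF b b] by (simp add: norm_eq_1)
        then have "\<bar>v \<bullet> b\<bar> \<le> norm v" using Cauchy_Schwarz_ineq2[of v b] by simp
        moreover have "norm (f' x b) \<le> \<bar>C b\<bar>" using C[OF b x] by linarith
        ultimately show "norm ((v \<bullet> b) *\<^sub>R f' x b) \<le> norm v * \<bar>C b\<bar>"
          by (simp add: mult_mono)
      qed
      then show "norm (\<Sum>b\<in>B. (v \<bullet> b) *\<^sub>R f' x b) \<le> L * norm v"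
        by (simp add: L_def sum_distrib_left mult.commute)
    qed
  qed
  then show ?thesis using that[of L] by (simp add: L_def sum_nonneg)
qed

text \<open>The integral operator is a contraction. Clamping the time to the interval allows it to act on bounded
  continuous functions on the whole line, which form a complete space.\<close>

lemma picard_globally_lipschitz:
  fixes K :: "'e::euclidean_space \<Rightarrow> 'e"
  assumes L: "\<And>x y. norm (K x - K y) \<le> L * norm (x - y)" and M: "\<And>x. norm (K x) \<le> M"
    and d: "0 < \<delta>" "\<delta> * L < 1" "0 \<le> L"
  obtains c where "continuous_on UNIV c"
    "\<And>t. t \<in> {0..\<delta>} \<Longrightarrow> c t = y0 + integral {0..t} (\<lambda>s. K (c s))"
proof -
  have contK: "continuous_on UNIV K"
    by (rule lipschitz_on_continuous_on[of L], rule lipschitz_onI) (use L d in \<open>auto simp: dist_norm\<close>)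
  have M0: "0 \<le> M" using M[of 0] norm_ge_zero order_trans by blast
  define cl where "cl = (\<lambda>t. max 0 (min \<delta> t))"
  have cl: "cl t \<in> {0..\<delta>}" for t using d by (auto simp: cl_def)
  have contcl: "continuous_on UNIV cl" unfolding cl_def by (intro continuous_intros)
  have Kc: "continuous_on S (\<lambda>s. K (apply_bcontfun c s))" for c :: "real \<Rightarrow>\<^sub>C 'e" and S
    by (rule continuous_on_compose2[OF contK]) (auto intro: continuous_on_subset[OF continuous_on_apply_bcontfun])
  have int: "(\<lambda>s. K (apply_bcontfun c s)) integrable_on {0..t}" for c :: "real \<Rightarrow>\<^sub>C 'e" and t
    by (intro integrable_continuous_real Kc)
  define T where "T = (\<lambda>(c::real \<Rightarrow>\<^sub>C 'e) t. y0 + integral {0..cl t} (\<lambda>s. K (apply_bcontfun c s)))"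
  have bc: "T c \<in> bcontfun" for c
  proof (rule bcontfun_normI)
    have "continuous_on {0..\<delta>} (\<lambda>t. integral {0..t} (\<lambda>s. K (apply_bcontfun c s)))"
      by (rule indefinite_integral_continuous_1[OF int])
    then have "continuous_on UNIV (\<lambda>t. integral {0..cl t} (\<lambda>s. K (apply_bcontfun c s)))"
      by (rule continuous_on_compose2[OF _ contcl]) (use cl in auto)
    then show "continuous_on UNIV (T c)" unfolding T_def by (intro continuous_intros)
    fix t
    have "norm (integral {0..cl t} (\<lambda>s. K (apply_bcontfun c s))) \<le> M * (cl t - 0)"
      by (rule integral_bound[OF _ Kc]) (use M cl in auto)
    also have "\<dots> \<le> M * \<delta>" using M0 cl[of t] by (intro mult_left_mono) auto
    finally show "norm (T c t) \<le> norm y0 + M * \<delta>"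
      unfolding T_def by (intro norm_triangle_le) linarith
  qed
  have "\<exists>!c. Bcontfun (T c) = c"
  proof (rule banach_fix_type)
    show "0 \<le> \<delta> * L" "\<delta> * L < 1" using d by auto
    show "\<forall>c e. dist (Bcontfun (T c)) (Bcontfun (T e)) \<le> \<delta> * L * dist c e"
    proof (intro allI dist_bound)
      fix c e :: "real \<Rightarrow>\<^sub>C 'e" and t
      have "T c t - T e t = integral {0..cl t} (\<lambda>s. K (apply_bcontfun c s) - K (apply_bcontfun e s))"
        by (simp add: T_def integral_diff int)
      moreover have "norm (integral {0..cl t} (\<lambda>s. K (apply_bcontfun c s) - K (apply_bcontfun e s))) \<le>
          (L * dist c e) * (cl t - 0)"
      proof (rule integral_bound)
        show "continuous_on {0..cl t} (\<lambda>s. K (apply_bcontfun c s) - K (apply_bcontfun e s))"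
          by (intro continuous_on_diff Kc)
        fix s
        have "norm (K (apply_bcontfun c s) - K (apply_bcontfun e s)) \<le>
            L * dist (apply_bcontfun c s) (apply_bcontfun e s)" using L by (simp add: dist_norm)
        also have "\<dots> \<le> L * dist c e" using d by (intro mult_left_mono dist_bounded) auto
        finally show "norm (K (apply_bcontfun c s) - K (apply_bcontfun e s)) \<le> L * dist c e" .
      qed (use cl in auto)
      moreover have "(L * dist c e) * (cl t - 0) \<le> \<delta> * L * dist c e"
        using mult_left_mono[of "cl t" \<delta> "L * dist c e"] cl[of t] d by (simp add: ac_simps)
      ultimately show "dist (apply_bcontfun (Bcontfun (T c)) t) (apply_bcontfun (Bcontfun (T e)) t) \<le> \<delta> * L * dist c e"
        by (simp add: Bcontfun_inverse[OF bc] dist_norm)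
    qed
  qed
  then obtain c where "Bcontfun (T c) = c" by blast
  then have c: "apply_bcontfun c = T c" using Bcontfun_inverse[OF bc, of c] by simp
  show ?thesis
  proof (rule that[of "apply_bcontfun c"])
    show "continuous_on UNIV (apply_bcontfun c)" by (rule continuous_on_apply_bcontfun)
    fix t assume "t \<in> {0..\<delta>}"
    then have "cl t = t" by (auto simp: cl_def)
    then have "T c t = y0 + integral {0..t} (\<lambda>s. K (apply_bcontfun c s))" by (simp add: T_def)
    then show "apply_bcontfun c t = y0 + integral {0..t} (\<lambda>s. K (apply_bcontfun c s))"
      by (simp only: c)
  qed
qed

text \<open>Composing the field with the nearest-point projection onto a compact convex neighbourhood makes it
  bounded and globally Lipschitz. For short times the solution does not leave the neighbourhood, where
  the modified field agrees with the given one; it stays in \<open>V\<close> because the field has values there.\<close>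

lemma picard:
  fixes K :: "'e::euclidean_space \<Rightarrow> 'e"
  assumes V: "subspace V" and U: "openin (top_of_set V) U" "y0 \<in> U"
    and K: "Ck_on 1 V U K" "K ` U \<subseteq> V"
  obtains \<delta> c where "0 < \<delta>" "c 0 = y0" "c ` {0..\<delta>} \<subseteq> U"
    "\<And>t. t \<in> {0..\<delta>} \<Longrightarrow> (c has_vector_derivative K (c t)) (at t within {0..\<delta>})"
proof -
  obtain O1 where O1: "open O1" "U = V \<inter> O1" using U(1) by (auto simp: openin_open)
  then obtain r where r: "0 < r" "cball y0 r \<subseteq> O1" using U(2) open_contains_cball by blast
  define S where "S = cball y0 r \<inter> V"
  have "y0 \<in> S" using r O1 U(2) by (simp add: S_def)
  then have "S \<noteq> {}" by blast
  moreover have "S \<subseteq> U" "compact S" "convex S" "closed S"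
    using r O1 U(2) V by (auto simp: S_def compact_Int_closed closed_subspace convex_Int subspace_imp_convex)
  ultimately have S: "S \<subseteq> U" "compact S" "convex S" "closed S" "S \<noteq> {}" by auto
  obtain L where L: "0 \<le> L" "\<And>x y. x \<in> S \<Longrightarrow> y \<in> S \<Longrightarrow> norm (K x - K y) \<le> L * norm (x - y)"
    using C1_lipschitz_on_compact_convex[OF K(1) S(1-3) _ V] O1 by blast
  have "bounded (K ` S)"
    using Ck_on_imp_continuous[OF K(1)] S(1,2) continuous_on_subset compact_continuous_image compact_imp_bounded
    by blast
  then obtain M where M: "0 < M" "\<And>x. x \<in> S \<Longrightarrow> norm (K x) \<le> M" by (auto simp: bounded_pos)
  define Kt where "Kt = (\<lambda>y. K (closest_point S y))"
  have cp: "closest_point S y \<in> S" for y using S by (intro closest_point_in_set)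
  define \<delta> where "\<delta> = min (r / M) (1 / (2 * (L + 1)))"
  have "0 < \<delta>" using r M L by (simp add: \<delta>_def)
  have "\<delta> * L \<le> (1 / (2 * (L + 1))) * L" using L by (intro mult_right_mono) (auto simp: \<delta>_def)
  also have "\<dots> < 1" using L by (simp add: field_simps)
  finally have dL: "\<delta> * L < 1" .
  have "\<delta> * M \<le> (r / M) * M" using M by (intro mult_right_mono) (auto simp: \<delta>_def)
  then have dM: "\<delta> * M \<le> r" using M by simp
  have KtL: "norm (Kt x - Kt y) \<le> L * norm (x - y)" for x y
  proof -
    have "norm (Kt x - Kt y) \<le> L * norm (closest_point S x - closest_point S y)"
      unfolding Kt_def using L cp by blast
    also have "\<dots> \<le> L * norm (x - y)"
      using closest_point_lipschitz[OF S(3,4,5)] L(1) by (intro mult_left_mono) (auto simp: dist_norm)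
    finally show ?thesis .
  qed
  have KtM: "norm (Kt x) \<le> M" for x unfolding Kt_def using M cp by blast
  have KtV: "Kt x \<in> V" for x unfolding Kt_def using cp K(2) S(1) by blast
  obtain c where c: "continuous_on UNIV c"
    "\<And>t. t \<in> {0..\<delta>} \<Longrightarrow> c t = y0 + integral {0..t} (\<lambda>s. Kt (c s))"
    using picard_globally_lipschitz[OF KtL KtM \<open>0 < \<delta>\<close> dL L(1)] by metis
  have contKt: "continuous_on UNIV Kt"
    by (rule lipschitz_on_continuous_on[of L], rule lipschitz_onI) (use KtL L(1) in \<open>auto simp: dist_norm\<close>)
  have contKc: "continuous_on T (\<lambda>s. Kt (c s))" for T
    by (rule continuous_on_compose2[OF contKt]) (auto intro: continuous_on_subset[OF c(1)])
  obtain B where B: "finite B" "B \<subseteq> V" "\<And>x. x \<in> V \<Longrightarrow> (\<Sum>b\<in>B. (x \<bullet> b) *\<^sub>R b) = x"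
    using subspace_orthonormal_expansion[OF V] by metis
  have cS: "c t \<in> S" if t: "t \<in> {0..\<delta>}" for t
  proof -
    have "norm (integral {0..t} (\<lambda>s. Kt (c s))) \<le> M * (t - 0)"
      by (rule integral_bound[OF _ contKc]) (use KtM t in auto)
    also have "\<dots> \<le> M * \<delta>" using M(1) t by (intro mult_left_mono) auto
    also have "\<dots> \<le> r" using dM by (simp add: mult.commute)
    finally have "dist y0 (c t) \<le> r" using c(2)[OF t] by (simp add: dist_norm)
    have bl: "bounded_linear (\<lambda>x. \<Sum>b\<in>B. (x \<bullet> b) *\<^sub>R b)"
      by (intro bounded_linear_sum bounded_linear_scaleR_const bounded_linear_inner_left)
    have "integral {0..t} ((\<lambda>x. \<Sum>b\<in>B. (x \<bullet> b) *\<^sub>R b) \<circ> (\<lambda>s. Kt (c s))) =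
        (\<Sum>b\<in>B. (integral {0..t} (\<lambda>s. Kt (c s)) \<bullet> b) *\<^sub>R b)"
      by (rule integral_linear[OF integrable_continuous_real[OF contKc] bl])
    moreover have "(\<lambda>x. \<Sum>b\<in>B. (x \<bullet> b) *\<^sub>R b) \<circ> (\<lambda>s. Kt (c s)) = (\<lambda>s. Kt (c s))"
      using B(3)[OF KtV] by (simp add: fun_eq_iff)
    ultimately have "integral {0..t} (\<lambda>s. Kt (c s)) = (\<Sum>b\<in>B. (integral {0..t} (\<lambda>s. Kt (c s)) \<bullet> b) *\<^sub>R b)"
      by simp
    also have "\<dots> \<in> V" using B V by (auto intro!: subspace_sum subspace_scale)
    finally have "c t \<in> V" using c(2)[OF t] O1 U(2) V by (auto intro: subspace_add)
    with \<open>dist y0 (c t) \<le> r\<close> show ?thesis by (simp add: S_def)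
  qed
  show ?thesis
  proof (rule that[of \<delta> c])
    show "0 < \<delta>" by fact
    show "c 0 = y0" using c(2)[of 0] \<open>0 < \<delta>\<close> by simp
    show "c ` {0..\<delta>} \<subseteq> U" using cS S(1) by blast
    fix t assume t: "t \<in> {0..\<delta>}"
    have "((\<lambda>t. integral {0..t} (\<lambda>s. Kt (c s))) has_vector_derivative Kt (c t)) (at t within {0..\<delta>})"
      by (rule integral_has_vector_derivative[OF contKc t])
    then have "((\<lambda>t. y0 + integral {0..t} (\<lambda>s. Kt (c s))) has_vector_derivative 0 + Kt (c t)) (at t within {0..\<delta>})"
      by (intro has_vector_derivative_add) auto
    moreover have "Kt (c t) = K (c t)" using cS[OF t] by (simp add: Kt_def closest_point_self)
    ultimately show "(c has_vector_derivative K (c t)) (at t within {0..\<delta>})"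
      using c(2) has_vector_derivative_transform[OF t, of c] by simp
  qed
qed

section \<open>Smooth functions on manifolds\<close>

locale manifold =
  fixes M :: "('p, 'e::euclidean_space) mfd"
  assumes mfd: "smooth_manifold M"
begin

lemma model_subspace: "subspace (model M)"
  and Hausdorff: "Hausdorff_space (mtop M)"
  using mfd by (auto simp: smooth_manifold_def)

lemma
  assumes "(U, \<phi>) \<in> atlas M"
  shows chart_open: "openin (mtop M) U"
    and chart_image_open: "openin (top_of_set (model M)) (\<phi> ` U)"
    and chart_homeo: "homeomorphic_map (subtopology (mtop M) U) (top_of_set (\<phi> ` U)) \<phi>"
  using mfd assms by (auto simp: smooth_manifold_def)

lemma chart_exists:
  assumes "p \<in> pts M"
  obtains U \<phi> where "(U, \<phi>) \<in> atlas M" "p \<in> U"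
  using mfd assms unfolding smooth_manifold_def by blast

lemma chart_subset: "(U, \<phi>) \<in> atlas M \<Longrightarrow> U \<subseteq> pts M"
  using chart_open openin_subset by blast

lemma chart_inj:
  assumes "(U, \<phi>) \<in> atlas M"
  shows "inj_on \<phi> U"
  using homeomorphic_imp_injective_map[OF chart_homeo[OF assms]] chart_subset[OF assms]
  by (simp add: Int_absorb1)

lemma chart_inv [simp]: "(U, \<phi>) \<in> atlas M \<Longrightarrow> q \<in> U \<Longrightarrow> inv_into U \<phi> (\<phi> q) = q"
  using chart_inj inv_into_f_f by metis

lemma chart_image_model: "(U, \<phi>) \<in> atlas M \<Longrightarrow> q \<in> U \<Longrightarrow> \<phi> q \<in> model M"
  using chart_image_open openin_imp_subset by blast

lemma chart_inv_continuous:
  assumes "(U, \<phi>) \<in> atlas M"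
  shows "continuous_map (top_of_set (\<phi> ` U)) (mtop M) (inv_into U \<phi>)"
proof -
  obtain g where g: "homeomorphic_maps (subtopology (mtop M) U) (top_of_set (\<phi> ` U)) \<phi> g"
    using chart_homeo[OF assms] homeomorphic_map_maps by blast
  have "continuous_map (top_of_set (\<phi> ` U)) (subtopology (mtop M) U) g"
    using g by (simp add: homeomorphic_maps_def)
  then have "continuous_map (top_of_set (\<phi> ` U)) (mtop M) g"
    by (simp add: continuous_map_in_subtopology)
  moreover have "g y = inv_into U \<phi> y" if "y \<in> \<phi> ` U" for y
    using g that chart_subset[OF assms] chart_inv[OF assms]
    by (auto simp: homeomorphic_maps_def Int_absorb1)
  ultimately show ?thesis by (auto intro: continuous_map_eq)
qed

lemma chart_image_openin:
  assumes "(U, \<phi>) \<in> atlas M" "openin (mtop M) W" "W \<subseteq> U"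
  shows "openin (top_of_set (model M)) (\<phi> ` W)"
proof -
  have "openin (subtopology (mtop M) U) W" using assms chart_open openin_open_subtopology by metis
  then have "openin (top_of_set (\<phi> ` U)) (\<phi> ` W)"
    using homeomorphic_imp_open_map[OF chart_homeo[OF assms(1)]] by (simp add: open_map_def)
  then show ?thesis using chart_image_open[OF assms(1)] openin_trans by blast
qed

lemma chart_inv_openin:
  assumes "(U, \<phi>) \<in> atlas M" "openin (top_of_set (model M)) N" "N \<subseteq> \<phi> ` U"
  shows "openin (mtop M) (inv_into U \<phi> ` N)"
proof -
  have "continuous_map (subtopology (mtop M) U) (top_of_set (\<phi> ` U)) \<phi>"
    using chart_homeo[OF assms(1)] homeomorphic_imp_continuous_map by blast
  moreover have "openin (top_of_set (\<phi> ` U)) N"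
    using assms openin_subset_trans[OF assms(2,3)] openin_imp_subset[OF chart_image_open[OF assms(1)]]
    by auto
  ultimately have "openin (subtopology (mtop M) U) {q \<in> topspace (subtopology (mtop M) U). \<phi> q \<in> N}"
    by (rule openin_continuous_map_preimage)
  moreover have "{q \<in> topspace (subtopology (mtop M) U). \<phi> q \<in> N} = inv_into U \<phi> ` N"
    using assms chart_subset[OF assms(1)]
    by (auto simp: image_iff inv_into_into f_inv_into_f subset_iff intro!: bexI[rotated])
  ultimately show ?thesis using chart_open[OF assms(1)] openin_trans_full by metis
qed

lemma transition_smooth:
  assumes "(U, \<phi>) \<in> atlas M" "(W, \<psi>) \<in> atlas M"
  shows "smooth_on (model M) (\<phi> ` (U \<inter> W)) (\<lambda>y. \<psi> (inv_into U \<phi> y))"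
  proof -
  have "\<forall>(U, \<phi>)\<in>atlas M. \<forall>(W, \<psi>)\<in>atlas M.
      smooth_on (model M) (\<phi> ` (U \<inter> W)) (\<psi> \<circ> inv_into U \<phi>)"
    using mfd by (simp add: smooth_manifold_def)
  from bspec[OF bspec[OF this assms(1), simplified] assms(2)] show ?thesis by (simp add: comp_def)
qed

lemma smooth_fun_onD:
  assumes "smooth_fun_on M W f" "(U, \<phi>) \<in> atlas M"
  shows "smooth_on (model M) (\<phi> ` (U \<inter> W)) (\<lambda>y. f (inv_into U \<phi> y))"
  using bspec[OF assms(1)[unfolded smooth_fun_on_def] assms(2)] by (simp add: comp_def)

lemma smooth_fun_onI:
  assumes "\<And>U \<phi>. (U, \<phi>) \<in> atlas M \<Longrightarrow> smooth_on (model M) (\<phi> ` (U \<inter> W)) (\<lambda>y. f (inv_into U \<phi> y))"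
  shows "smooth_fun_on M W f"
  using assms by (auto simp: smooth_fun_on_def comp_def)

lemma smooth_fun_on_subset:
  assumes "smooth_fun_on M W f" "W' \<subseteq> W"
  shows "smooth_fun_on M W' f"
  by (intro smooth_fun_onI smooth_on_subset[OF smooth_fun_onD[OF assms(1)]]) (use assms(2) in auto)

lemma smooth_fun_on_cong:
  assumes "smooth_fun_on M W f" "\<And>q. q \<in> W \<Longrightarrow> f q = g q"
  shows "smooth_fun_on M W g"
  by (rule smooth_fun_onI, rule smooth_on_cong[OF smooth_fun_onD[OF assms(1)]])
    (use assms(2) in auto)

lemma smooth_fun_on_local:
  assumes "openin (mtop M) W"
    and loc: "\<And>p. p \<in> W \<Longrightarrow> \<exists>N. openin (mtop M) N \<and> p \<in> N \<and> smooth_fun_on M N f"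
  shows "smooth_fun_on M W f"
proof (rule smooth_fun_onI)
  fix U \<phi> assume c: "(U, \<phi>) \<in> atlas M"
  show "smooth_on (model M) (\<phi> ` (U \<inter> W)) (\<lambda>y. f (inv_into U \<phi> y))"
  proof (rule smooth_on_local[OF model_subspace])
    show "openin (top_of_set (model M)) (\<phi> ` (U \<inter> W))"
      using c assms(1) chart_open by (intro chart_image_openin) auto
    fix y assume "y \<in> \<phi> ` (U \<inter> W)"
    then obtain p where p: "p \<in> U \<inter> W" "y = \<phi> p" by blast
    obtain N where N: "openin (mtop M) N" "p \<in> N" "smooth_fun_on M N f" using loc p(1) by blast
    have "openin (top_of_set (model M)) (\<phi> ` (U \<inter> N))"
      using c N(1) chart_open by (intro chart_image_openin) auto
    then show "\<exists>N. openin (top_of_set (model M)) N \<and> y \<in> N \<and> smooth_on (model M) N (\<lambda>y. f (inv_into U \<phi> y))"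
      using smooth_fun_onD[OF N(3) c] N(2) p by (intro exI[of _ "\<phi> ` (U \<inter> N)"]) auto
  qed
qed

text \<open>Compatibility of the charts transfers smoothness from one chart to all others.\<close>

lemma smooth_fun_on_chartI:
  assumes c: "(U, \<phi>) \<in> atlas M" and W: "W \<subseteq> U"
    and f: "smooth_on (model M) (\<phi> ` W) (\<lambda>y. f (inv_into U \<phi> y))"
  shows "smooth_fun_on M W f"
proof (rule smooth_fun_onI)
  fix U' \<phi>' assume c': "(U', \<phi>') \<in> atlas M"
  have "smooth_on (model M) (\<phi>' ` (U' \<inter> W)) (\<lambda>y. f (inv_into U \<phi> (\<phi> (inv_into U' \<phi>' y))))"
  proof (rule smooth_on_compose[OF f _ _ _ model_subspace])
    show "smooth_on (model M) (\<phi>' ` (U' \<inter> W)) (\<lambda>y. \<phi> (inv_into U' \<phi>' y))"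
      by (rule smooth_on_subset[OF transition_smooth[OF c' c]]) (use W in auto)
    show "(\<lambda>y. \<phi> (inv_into U' \<phi>' y)) ` \<phi>' ` (U' \<inter> W) \<subseteq> \<phi> ` W" using c' by auto
    show "\<phi> ` W \<subseteq> model M" using W chart_image_model[OF c] by auto
  qed
  then show "smooth_on (model M) (\<phi>' ` (U' \<inter> W)) (\<lambda>y. f (inv_into U' \<phi>' y))"
    by (rule smooth_on_cong) (use c c' W in auto)
qed

lemma smooth_fun_on_add:
  assumes "smooth_fun_on M W f" "smooth_fun_on M W g"
  shows "smooth_fun_on M W (\<lambda>q. f q + g q)"
  by (intro smooth_fun_onI smooth_on_add smooth_fun_onD[OF assms(1)] smooth_fun_onD[OF assms(2)])

lemma smooth_fun_on_mult:
  assumes "smooth_fun_on M W f" "smooth_fun_on M W g"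
  shows "smooth_fun_on M W (\<lambda>q. f q * g q)"
  by (intro smooth_fun_onI smooth_on_mult smooth_fun_onD[OF assms(1)] smooth_fun_onD[OF assms(2)])

lemma smooth_fun_on_const: "smooth_fun_on M W (\<lambda>q. c)"
  by (intro smooth_fun_onI) (simp add: smooth_on_def Ck_on_const)

lemma smooth_fun_on_sum:
  assumes "\<And>i. i \<in> I \<Longrightarrow> smooth_fun_on M W (f i)"
  shows "smooth_fun_on M W (\<lambda>q. \<Sum>i\<in>I. f i q)"
  by (intro smooth_fun_onI smooth_on_sum smooth_fun_onD[OF assms])

lemma smooth_fun_on_inverse:
  assumes "smooth_fun_on M W f" "\<And>q. q \<in> W \<Longrightarrow> f q \<noteq> 0"
  shows "smooth_fun_on M W (\<lambda>q. inverse (f q))"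
proof (rule smooth_fun_onI)
  fix U \<phi> assume c: "(U, \<phi>) \<in> atlas M"
  show "smooth_on (model M) (\<phi> ` (U \<inter> W)) (\<lambda>y. inverse (f (inv_into U \<phi> y)))"
    unfolding smooth_on_def
  proof
    fix k
    show "Ck_on k (model M) (\<phi> ` (U \<inter> W)) (\<lambda>y. inverse (f (inv_into U \<phi> y)))"
      using smooth_fun_onD[OF assms(1) c] assms(2) c
      by (intro Ck_on_inverse) (auto simp: smooth_on_def)
  qed
qed

lemma smooth_fun_on_continuous:
  assumes f: "smooth_fun_on M W f" and W: "openin (mtop M) W" and S: "open S"
  shows "openin (mtop M) {q \<in> W. f q \<in> S}"
proof (subst openin_subopen, intro ballI)
  fix p assume p: "p \<in> {q \<in> W. f q \<in> S}"
  then obtain U \<phi> where c: "(U, \<phi>) \<in> atlas M" "p \<in> U"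
    using chart_exists openin_subset[OF W] by blast
  let ?N = "\<phi> ` (U \<inter> W) \<inter> (\<lambda>y. f (inv_into U \<phi> y)) -` S"
  have "continuous_on (\<phi> ` (U \<inter> W)) (\<lambda>y. f (inv_into U \<phi> y))"
    using smooth_fun_onD[OF f c(1)] Ck_on_imp_continuous unfolding smooth_on_def by blast
  then have "openin (top_of_set (\<phi> ` (U \<inter> W))) ?N" using S by (rule continuous_openin_preimage_gen)
  moreover have "openin (top_of_set (model M)) (\<phi> ` (U \<inter> W))"
    using c W chart_open by (intro chart_image_openin) auto
  ultimately have "openin (top_of_set (model M)) ?N" using openin_trans by blast
  then have "openin (mtop M) (inv_into U \<phi> ` ?N)" using c by (intro chart_inv_openin) auto
  moreover have "p \<in> inv_into U \<phi> ` ?N" using p c by (force simp: image_iff)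
  moreover have "inv_into U \<phi> ` ?N \<subseteq> {q \<in> W. f q \<in> S}" using c by auto
  ultimately show "\<exists>T. openin (mtop M) T \<and> p \<in> T \<and> T \<subseteq> {q \<in> W. f q \<in> S}" by blast
qed

definition smooth_at :: "'p \<Rightarrow> ('p \<Rightarrow> real) \<Rightarrow> bool"
  where "smooth_at p f \<longleftrightarrow> (\<exists>N. openin (mtop M) N \<and> p \<in> N \<and> smooth_fun_on M N f)"

lemma smooth_fun_on_iff_at:
  assumes "openin (mtop M) W"
  shows "smooth_fun_on M W f \<longleftrightarrow> (\<forall>p\<in>W. smooth_at p f)"
  using assms smooth_fun_on_local[OF assms, of f] unfolding smooth_at_def by blast

lemma local_function_ring_smooth_at:
  assumes p: "p \<in> pts M"
  shows "local_function_ring (smooth_at p) (nhdsin (mtop M) p) p"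
proof
  fix f g :: "'p \<Rightarrow> real" assume f: "smooth_at p f"
  then obtain N where N: "openin (mtop M) N" "p \<in> N" "smooth_fun_on M N f"
    by (auto simp: smooth_at_def)
  {
    assume "smooth_at p g"
    then obtain N' where N': "openin (mtop M) N'" "p \<in> N'" "smooth_fun_on M N' g"
      by (auto simp: smooth_at_def)
    have i: "openin (mtop M) (N \<inter> N')" "p \<in> N \<inter> N'" using N N' by auto
    have s: "smooth_fun_on M (N \<inter> N') f" "smooth_fun_on M (N \<inter> N') g"
      using N(3) N'(3) smooth_fun_on_subset by blast+
    show "smooth_at p (\<lambda>x. f x + g x)" "smooth_at p (\<lambda>x. f x * g x)"
      using i smooth_fun_on_add[OF s] smooth_fun_on_mult[OF s] unfolding smooth_at_def by blast+
  }
  {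
    assume "f p \<noteq> 0"
    have o: "openin (mtop M) {q \<in> N. f q \<in> - {0}}"
      by (rule smooth_fun_on_continuous[OF N(3,1)]) auto
    have "smooth_fun_on M {q \<in> N. f q \<in> - {0}} (\<lambda>x. inverse (f x))"
      by (rule smooth_fun_on_inverse[OF smooth_fun_on_subset[OF N(3)]]) auto
    then show "smooth_at p (\<lambda>x. inverse (f x))"
      using o N(2) \<open>f p \<noteq> 0\<close> unfolding smooth_at_def by blast
    show "eventually (\<lambda>x. f x \<noteq> 0) (nhdsin (mtop M) p)"
      using o N(2) \<open>f p \<noteq> 0\<close> unfolding eventually_nhdsin by blast
  }
  {
    assume "eventually (\<lambda>x. f x = g x) (nhdsin (mtop M) p)"
    then obtain S where S: "openin (mtop M) S" "p \<in> S" "\<forall>x\<in>S. f x = g x"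
      using p by (auto simp: eventually_nhdsin)
    have "smooth_fun_on M (N \<inter> S) f" using N(3) by (rule smooth_fun_on_subset) auto
    then have "smooth_fun_on M (N \<inter> S) g" by (rule smooth_fun_on_cong) (use S in auto)
    moreover have "openin (mtop M) (N \<inter> S)" "p \<in> N \<inter> S" using N S by auto
    ultimately show "smooth_at p g" unfolding smooth_at_def by blast
  }
next
  fix c :: real
  show "smooth_at p (\<lambda>x. c)"
    unfolding smooth_at_def using p smooth_fun_on_const openin_topspace by blast
qed

lemma smooth_at_cong:
  assumes "smooth_at p f" "openin (mtop M) N" "p \<in> N" "\<And>q. q \<in> N \<Longrightarrow> f q = g q"
  shows "smooth_at p g"
proof -
  have p: "p \<in> pts M" using assms openin_subset by blast
  interpret local_function_ring "smooth_at p" "nhdsin (mtop M) p" p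
    by (rule local_function_ring_smooth_at[OF p])
  show ?thesis by (rule cong[OF assms(1)]) (use assms p in \<open>auto simp: eventually_nhdsin\<close>)
qed

lemma C_inf_iff: "f \<in> C_inf M \<longleftrightarrow> (\<forall>p\<in>pts M. smooth_at p f) \<and> (\<forall>p. p \<notin> pts M \<longrightarrow> f p = 0)"
  by (simp add: C_inf_def smooth_fun_on_iff_at)

lemma C_inf_smooth_on: "f \<in> C_inf M \<Longrightarrow> W \<subseteq> pts M \<Longrightarrow> smooth_fun_on M W f"
  unfolding C_inf_def using smooth_fun_on_subset by blast

lemma C_inf_add: "f \<in> C_inf M \<Longrightarrow> g \<in> C_inf M \<Longrightarrow> f + g \<in> C_inf M"
  by (auto simp: C_inf_def plus_fun_def intro: smooth_fun_on_add)

lemma C_inf_mult: "f \<in> C_inf M \<Longrightarrow> g \<in> C_inf M \<Longrightarrow> f * g \<in> C_inf M"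
  by (auto simp: C_inf_def times_fun_def intro: smooth_fun_on_mult)

lemma C_inf_scaleR: "f \<in> C_inf M \<Longrightarrow> c *\<^sub>R f \<in> C_inf M"
  by (auto simp: C_inf_def scaleR_fun_def intro: smooth_fun_on_mult smooth_fun_on_const)

lemma C_inf_0: "0 \<in> C_inf M"
  by (auto simp: C_inf_def zero_fun_def intro: smooth_fun_on_const)

text \<open>A bump function in a chart, extended by zero, is smooth because a closed ball in the chart is
  compact, hence closed in the Hausdorff space \<open>M\<close>.\<close>

lemma bump:
  assumes W: "openin (mtop M) W" "p \<in> W"
  obtains \<eta> N K where "\<eta> \<in> C_inf M" "openin (mtop M) N" "p \<in> N" "N \<subseteq> K" "closedin (mtop M) K" "K \<subseteq> W"
    "\<And>q. q \<in> N \<Longrightarrow> \<eta> q = 1" "\<And>q. q \<notin> K \<Longrightarrow> \<eta> q = 0"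
proof -
  obtain U \<phi> where c: "(U, \<phi>) \<in> atlas M" "p \<in> U"
    using chart_exists W openin_subset by blast
  let ?V = "model M"
  have o: "openin (top_of_set ?V) (\<phi> ` (U \<inter> W))"
    using c W chart_open by (intro chart_image_openin) auto
  then obtain O1 where O1: "open O1" "\<phi> ` (U \<inter> W) = ?V \<inter> O1" by (auto simp: openin_open)
  have "\<phi> p \<in> O1" using O1 c W by blast
  then obtain R where R: "0 < R" "cball (\<phi> p) R \<subseteq> O1" using O1(1) open_contains_cball by blast
  have half: "0 < R / 2" "R / 2 < R" using R(1) by auto
  obtain b :: "'e \<Rightarrow> real" where b: "smooth_on ?V (\<phi> ` U) b" "\<And>y. dist (\<phi> p) y \<le> R / 2 \<Longrightarrow> b y = 1"
    "\<And>y. R \<le> dist (\<phi> p) y \<Longrightarrow> b y = 0"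
    by (rule bump_euclidean[OF half, where V="?V" and U="\<phi> ` U" and ?y0.0="\<phi> p"]) blast
  define K where "K = inv_into U \<phi> ` (cball (\<phi> p) R \<inter> ?V)"
  define N where "N = inv_into U \<phi> ` (ball (\<phi> p) (R / 2) \<inter> ?V)"
  define \<eta> where "\<eta> = (\<lambda>q. if q \<in> U then b (\<phi> q) else 0)"
  have sub: "cball (\<phi> p) R \<inter> ?V \<subseteq> \<phi> ` (U \<inter> W)" using O1 R by blast
  then have subU: "cball (\<phi> p) R \<inter> ?V \<subseteq> \<phi> ` U" by blast
  have "compact (cball (\<phi> p) R \<inter> ?V)" using model_subspace by (simp add: compact_Int_closed closed_subspace)
  then have "compactin (top_of_set (\<phi> ` U)) (cball (\<phi> p) R \<inter> ?V)"
    using subU by (simp add: compactin_subtopology)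
  then have "compactin (mtop M) K"
    unfolding K_def using chart_inv_continuous[OF c(1)] image_compactin by blast
  then have clK: "closedin (mtop M) K" using Hausdorff compactin_imp_closedin by blast
  have ballsub: "ball (\<phi> p) (R / 2) \<inter> ?V \<subseteq> cball (\<phi> p) R \<inter> ?V" using R(1) by auto
  have oN: "openin (mtop M) N" unfolding N_def
  proof (rule chart_inv_openin[OF c(1)])
    show "openin (top_of_set ?V) (ball (\<phi> p) (R / 2) \<inter> ?V)"
      by (metis inf_commute open_ball openin_open_Int)
    show "ball (\<phi> p) (R / 2) \<inter> ?V \<subseteq> \<phi> ` U" using ballsub subU by blast
  qed
  have inK: "q \<in> K \<longleftrightarrow> q \<in> U \<and> dist (\<phi> p) (\<phi> q) \<le> R" for q
  proof
    assume "q \<in> K"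
    then obtain y where y: "y \<in> cball (\<phi> p) R \<inter> ?V" "q = inv_into U \<phi> y" by (auto simp: K_def)
    then have "y \<in> \<phi> ` U" using subU by blast
    then show "q \<in> U \<and> dist (\<phi> p) (\<phi> q) \<le> R" using y by (simp add: inv_into_into f_inv_into_f)
  next
    assume "q \<in> U \<and> dist (\<phi> p) (\<phi> q) \<le> R"
    then have "\<phi> q \<in> cball (\<phi> p) R \<inter> ?V" "q = inv_into U \<phi> (\<phi> q)"
      using chart_image_model[OF c(1)] chart_inv[OF c(1)] by auto
    then show "q \<in> K" unfolding K_def by (metis imageI)
  qed
  have pN: "p \<in> N" unfolding N_def
  proof (rule image_eqI)
    show "p = inv_into U \<phi> (\<phi> p)" using chart_inv[OF c] by simp
    show "\<phi> p \<in> ball (\<phi> p) (R / 2) \<inter> ?V" using chart_image_model[OF c] half by simp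
  qed
  have \<eta>0: "\<eta> q = 0" if "q \<notin> K" for q
  proof (cases "q \<in> U")
    case True
    then have "R \<le> dist (\<phi> p) (\<phi> q)" using that inK[of q] by linarith
    then show ?thesis using b(3) by (simp add: \<eta>_def)
  qed (simp add: \<eta>_def)
  have \<eta>1: "\<eta> q = 1" if "q \<in> N" for q
  proof -
    obtain y where y: "y \<in> ball (\<phi> p) (R / 2) \<inter> ?V" "q = inv_into U \<phi> y" using \<open>q \<in> N\<close> unfolding N_def by blast
    then have "y \<in> \<phi> ` U" using ballsub subU by blast
    then have "q \<in> U" "\<phi> q = y" using y by (simp_all add: inv_into_into f_inv_into_f)
    then show ?thesis using y b(2)[of y] by (simp add: \<eta>_def less_imp_le)
  qed
  have "smooth_at q \<eta>" if "q \<in> pts M" for q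
  proof (cases "q \<in> U")
    case True
    have "smooth_fun_on M U (\<lambda>q. b (\<phi> q))"
    proof (rule smooth_fun_on_chartI[OF c(1) order_refl])
      show "smooth_on ?V (\<phi> ` U) (\<lambda>y. b (\<phi> (inv_into U \<phi> y)))"
        by (rule smooth_on_cong[OF b(1)]) (simp add: f_inv_into_f)
    qed
    then have "smooth_fun_on M U \<eta>" by (rule smooth_fun_on_cong) (simp add: \<eta>_def)
    then show ?thesis using True chart_open[OF c(1)] unfolding smooth_at_def by blast
  next
    case False
    then have "q \<in> pts M - K" using that inK by simp
    moreover have "openin (mtop M) (pts M - K)" using clK by blast
    moreover have "smooth_fun_on M (pts M - K) \<eta>"
      by (rule smooth_fun_on_cong[OF smooth_fun_on_const[of _ 0]]) (simp add: \<eta>0)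
    ultimately show ?thesis unfolding smooth_at_def by blast
  qed
  moreover have "\<eta> q = 0" if "q \<notin> pts M" for q
    using that chart_subset[OF c(1)] by (auto simp: \<eta>_def)
  ultimately have "\<eta> \<in> C_inf M" by (simp add: C_inf_iff)
  moreover have "N \<subseteq> K" unfolding N_def K_def using ballsub by blast
  moreover have "K \<subseteq> W"
  proof -
    have "K \<subseteq> inv_into U \<phi> ` \<phi> ` (U \<inter> W)" unfolding K_def using sub by blast
    then show ?thesis using chart_inv[OF c(1)] by auto
  qed
  ultimately show ?thesis using that[OF _ oN pN _ clK] \<eta>0 \<eta>1 by blast
qed

lemma cutoff_smooth:
  assumes W: "openin (mtop M) W" and f: "smooth_fun_on M W f" and \<eta>: "\<eta> \<in> C_inf M"
    and K: "closedin (mtop M) K" "K \<subseteq> W" "\<And>q. q \<notin> K \<Longrightarrow> \<eta> q = 0"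
  shows "(\<lambda>q. if q \<in> W then \<eta> q * f q else 0) \<in> C_inf M"
  unfolding C_inf_iff
proof (intro conjI ballI allI impI)
  fix q assume q: "q \<in> pts M"
  show "smooth_at q (\<lambda>q. if q \<in> W then \<eta> q * f q else 0)"
  proof (cases "q \<in> W")
    case True
    have "smooth_fun_on M W (\<lambda>q. \<eta> q * f q)"
      using smooth_fun_on_mult[OF C_inf_smooth_on[OF \<eta>] f] W openin_subset by blast
    then have "smooth_fun_on M W (\<lambda>q. if q \<in> W then \<eta> q * f q else 0)"
      by (rule smooth_fun_on_cong) simp
    then show ?thesis using True W unfolding smooth_at_def by blast
  next
    case False
    then have "q \<in> pts M - K" "openin (mtop M) (pts M - K)" using q K by auto
    moreover have "smooth_fun_on M (pts M - K) (\<lambda>q. if q \<in> W then \<eta> q * f q else 0)"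
      by (rule smooth_fun_on_cong[OF smooth_fun_on_const[of _ 0]]) (simp add: K(3))
    ultimately show ?thesis unfolding smooth_at_def by blast
  qed
next
  fix q assume "q \<notin> pts M"
  then show "(if q \<in> W then \<eta> q * f q else 0) = 0" using W openin_subset by auto
qed

end

lemma smooth_map_compose_at:
  assumes M: "smooth_manifold M" and N: "smooth_manifold N" and h: "smooth_map M N h"
    and p: "p \<in> pts M" and f: "manifold.smooth_at N (h p) f"
  shows "manifold.smooth_at M p (\<lambda>q. f (h q))"
proof -
  interpret M: manifold M by standard (rule M)
  interpret N: manifold N by standard (rule N)
  have cont: "continuous_map (mtop M) (mtop N) h" using h by (simp add: smooth_map_def)
  obtain N0 where N0: "openin (mtop N) N0" "h p \<in> N0" "smooth_fun_on N N0 f"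
    using f by (auto simp: N.smooth_at_def)
  obtain U \<phi> where c: "(U, \<phi>) \<in> atlas M" "p \<in> U" using M.chart_exists[OF p] by blast
  obtain W \<psi> where c': "(W, \<psi>) \<in> atlas N" "h p \<in> W"
    using N.chart_exists N0 openin_subset by blast
  define U' where "U' = {q \<in> U. h q \<in> W \<inter> N0}"
  have oU': "openin (mtop M) U'" unfolding U'_def
    using cont M.chart_open[OF c(1)] N.chart_open[OF c'(1)] N0(1)
    by (intro openin_continuous_map_preimage_gen) auto
  have h': "smooth_on (model M) (\<phi> ` (U \<inter> h -` W)) (\<lambda>y. \<psi> (h (inv_into U \<phi> y)))"
  proof -
    have "\<forall>(U, \<phi>)\<in>atlas M. \<forall>(W, \<psi>)\<in>atlas N.
        smooth_on (model M) (\<phi> ` (U \<inter> h -` W)) (\<psi> \<circ> h \<circ> inv_into U \<phi>)"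
      using h by (simp add: smooth_map_def)
    from bspec[OF bspec[OF this c(1), simplified] c'(1)] show ?thesis by (simp add: comp_def)
  qed
  have "smooth_on (model M) (\<phi> ` U') (\<lambda>y. f (inv_into W \<psi> (\<psi> (h (inv_into U \<phi> y)))))"
  proof (rule smooth_on_compose[OF N.smooth_fun_onD[OF N0(3) c'(1)] _ _ _ N.model_subspace])
    show "smooth_on (model M) (\<phi> ` U') (\<lambda>y. \<psi> (h (inv_into U \<phi> y)))"
      by (rule smooth_on_subset[OF h']) (auto simp: U'_def)
    show "(\<lambda>y. \<psi> (h (inv_into U \<phi> y))) ` \<phi> ` U' \<subseteq> \<psi> ` (W \<inter> N0)"
      using c(1) by (auto simp: U'_def)
    show "\<psi> ` (W \<inter> N0) \<subseteq> model N" using N.chart_image_model[OF c'(1)] by auto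
  qed
  then have "smooth_on (model M) (\<phi> ` U') (\<lambda>y. f (h (inv_into U \<phi> y)))"
    by (rule smooth_on_cong) (use c(1) c'(1) in \<open>auto simp: U'_def\<close>)
  then have "smooth_fun_on M U' (\<lambda>q. f (h q))"
    by (intro M.smooth_fun_on_chartI[OF c(1)]) (auto simp: U'_def)
  moreover have "p \<in> U'" using c c' N0 by (simp add: U'_def)
  ultimately show ?thesis using oU' unfolding M.smooth_at_def by blast
qed

lemma pullback_C_inf:
  assumes "smooth_manifold M" "smooth_manifold N" "smooth_map M N h" "f \<in> C_inf N"
  shows "pullback M h f \<in> C_inf M"
proof -
  interpret M: manifold M by standard (rule assms)
  interpret N: manifold N by standard (rule assms)
  have h: "h p \<in> pts N" if "p \<in> pts M" for p
  proof -
    have "continuous_map (mtop M) (mtop N) h" using assms(3) by (simp add: smooth_map_def)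
    from continuous_map_image_subset_topspace[OF this] show ?thesis using that by blast
  qed
  have "M.smooth_at p (pullback M h f)" if p: "p \<in> pts M" for p
  proof (rule M.smooth_at_cong[OF _ openin_topspace p])
    show "M.smooth_at p (\<lambda>q. f (h q))"
      by (rule smooth_map_compose_at[OF assms(1-3) p, of f]) (use assms(4) h[OF p] in \<open>simp add: N.C_inf_iff\<close>)
  qed (simp add: pullback_def)
  then show ?thesis by (simp add: M.C_inf_iff pullback_def)
qed

lemma smooth_fun_on_prod_snd:
  fixes S :: "('s, 'e::euclidean_space) mfd" and X :: "('x, 'f::euclidean_space) mfd"
  assumes S: "smooth_manifold S" and X: "smooth_manifold X" and f: "smooth_fun_on X W f" and T: "T \<subseteq> T' \<times> W"
  shows "smooth_fun_on (prod_mfd S X) T (\<lambda>(s, x). f x)"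
proof -
  interpret S: manifold S by standard (rule S)
  interpret X: manifold X by standard (rule X)
  show ?thesis unfolding smooth_fun_on_def
  proof (clarify)
    fix U \<phi> assume "(U, \<phi>) \<in> atlas (prod_mfd S X)"
    then obtain U1 \<phi>1 U2 \<phi>2 where c: "U = U1 \<times> U2" "\<phi> = map_prod \<phi>1 \<phi>2"
      "(U1, \<phi>1) \<in> atlas S" "(U2, \<phi>2) \<in> atlas X"
      by (auto simp: prod_mfd_def)
    have inj: "inj_on \<phi> U" using S.chart_inj[OF c(3)] X.chart_inj[OF c(4)]
      unfolding c by (rule map_prod_inj_on)
    have "smooth_on (model S \<times> model X) (\<phi> ` (U \<inter> T)) (\<lambda>y. f (inv_into U2 \<phi>2 (snd y)))"
    proof (rule smooth_on_compose[OF X.smooth_fun_onD[OF f c(4)] _ _ _ X.model_subspace])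
      show "smooth_on (model S \<times> model X) (\<phi> ` (U \<inter> T)) snd"
        by (simp add: smooth_on_def Ck_on_bounded_linear bounded_linear_snd)
      show "snd ` \<phi> ` (U \<inter> T) \<subseteq> \<phi>2 ` (U2 \<inter> W)" using c T by auto
      show "\<phi>2 ` (U2 \<inter> W) \<subseteq> model X" using X.chart_image_model[OF c(4)] by auto
    qed
    then have "smooth_on (model S \<times> model X) (\<phi> ` (U \<inter> T)) ((\<lambda>(s, x). f x) \<circ> inv_into U \<phi>)"
    proof (rule smooth_on_cong)
      fix y assume "y \<in> \<phi> ` (U \<inter> T)"
      then obtain s x where sx: "(s, x) \<in> U" "y = \<phi> (s, x)" by auto
      then show "f (inv_into U2 \<phi>2 (snd y)) = ((\<lambda>(s, x). f x) \<circ> inv_into U \<phi>) y"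
        using inv_into_f_f[OF inj sx(1)] X.chart_inv[OF c(4)] c by simp
    qed
    then show "smooth_on (model (prod_mfd S X)) (\<phi> ` (U \<inter> T)) ((\<lambda>(s, x). f x) \<circ> inv_into U \<phi>)"
      by (simp add: prod_mfd_def)
  qed
qed

lemma smooth_fun_on_graph:
  assumes X: "smooth_manifold X" and f: "smooth_fun_on (graph_mfd S X J) W f"
  shows "smooth_fun_on X {x. (J x, x) \<in> W} (\<lambda>x. f (J x, x))"
proof -
  interpret X: manifold X by standard (rule X)
  show ?thesis unfolding smooth_fun_on_def
proof clarify
  fix U \<phi> assume c: "(U, \<phi>) \<in> atlas X"
  let ?j = "\<lambda>x. (J x, x)"
  have "(?j ` U, \<phi> \<circ> snd) \<in> atlas (graph_mfd S X J)" using c by (auto simp: graph_mfd_def)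
  then have "smooth_on (model X) ((\<phi> \<circ> snd) ` (?j ` U \<inter> W)) (f \<circ> inv_into (?j ` U) (\<phi> \<circ> snd))"
    using bspec[OF f[unfolded smooth_fun_on_def]] by (fastforce simp only: graph_mfd_def mfd.simps prod.case)
  moreover have "(\<phi> \<circ> snd) ` (?j ` U \<inter> W) = \<phi> ` (U \<inter> {x. ?j x \<in> W})" by force
  ultimately have "smooth_on (model X) (\<phi> ` (U \<inter> {x. ?j x \<in> W})) (f \<circ> inv_into (?j ` U) (\<phi> \<circ> snd))"
    by simp
  then show "smooth_on (model X) (\<phi> ` (U \<inter> {x. ?j x \<in> W})) ((\<lambda>x. f (?j x)) \<circ> inv_into U \<phi>)"
  proof (rule smooth_on_cong)
    fix y assume "y \<in> \<phi> ` (U \<inter> {x. ?j x \<in> W})"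
    then have y: "y \<in> \<phi> ` U" by blast
    have "inj_on (\<phi> \<circ> snd) (?j ` U)" using X.chart_inj[OF c] by (auto simp: inj_on_def)
    then have "inv_into (?j ` U) (\<phi> \<circ> snd) y = ?j (inv_into U \<phi> y)"
      using y by (intro inv_into_f_eq) (auto simp: inv_into_into f_inv_into_f)
    then show "(f \<circ> inv_into (?j ` U) (\<phi> \<circ> snd)) y = ((\<lambda>x. f (?j x)) \<circ> inv_into U \<phi>) y" by simp
  qed
qed
qed

section \<open>Tangent vectors and vector fields\<close>

lemma dir_deriv_has_derivative_local:
  fixes V :: "'e::euclidean_space set"
  assumes "(g has_derivative D) (at x within N)" "openin (top_of_set V) N" "subspace V" "x \<in> N" "u \<in> V"
    "\<And>y. y \<in> N \<Longrightarrow> f y = g y"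
  shows "dir_deriv f u x = D u"
proof -
  have "(f has_derivative D) (at x within N)"
    using has_derivative_transform[OF assms(4) assms(6) assms(1)] by blast
  with assms show ?thesis by (intro dir_deriv_eq) auto
qed

context manifold
begin

lemma tangentD:
  assumes "v \<in> tangent_space M p"
  shows "f \<in> C_inf M \<Longrightarrow> g \<in> C_inf M \<Longrightarrow> v (f + g) = v f + v g"
    and "f \<in> C_inf M \<Longrightarrow> g \<in> C_inf M \<Longrightarrow> v (f * g) = v f * g p + f p * v g"
    and "f \<in> C_inf M \<Longrightarrow> v (c *\<^sub>R f) = c * v f"
    and "f \<notin> C_inf M \<Longrightarrow> v f = 0"
  using assms by (auto simp: tangent_space_def)

lemma tangent_0: "v \<in> tangent_space M p \<Longrightarrow> v 0 = 0"
  using tangentD(3)[of v p 0 0] C_inf_0 by simp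

lemma tangent_subspace: "subspace (tangent_space M p)"
  by (rule subspaceI) (auto simp: tangent_space_def algebra_simps)

lemma cotangent_subspace: "subspace (cotangent_space M p)"
  using tangent_subspace[of p]
  by (intro subspaceI) (auto simp: cotangent_space_def algebra_simps subspace_add subspace_scale)

definition chart_vec :: "'p set \<Rightarrow> ('p \<Rightarrow> 'e) \<Rightarrow> 'p \<Rightarrow> 'e \<Rightarrow> 'p tvec"
  where "chart_vec U \<phi> p u f = (if f \<in> C_inf M then dir_deriv (\<lambda>y. f (inv_into U \<phi> y)) u (\<phi> p) else 0)"

lemma chart_smooth: "(U, \<phi>) \<in> atlas M \<Longrightarrow> f \<in> C_inf M \<Longrightarrow> smooth_on (model M) (\<phi> ` U) (\<lambda>y. f (inv_into U \<phi> y))"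
  using smooth_fun_onD[OF C_inf_smooth_on[of f "pts M"], of U \<phi>] chart_subset[of U \<phi>]
  by (simp add: Int_absorb2)

lemma chart_derivative:
  assumes "(U, \<phi>) \<in> atlas M" "p \<in> U" "f \<in> C_inf M"
  obtains D where "((\<lambda>y. f (inv_into U \<phi> y)) has_derivative D) (at (\<phi> p) within \<phi> ` U)"
    "\<And>u. u \<in> model M \<Longrightarrow> chart_vec U \<phi> p u f = D u"
proof -
  obtain D where D: "((\<lambda>y. f (inv_into U \<phi> y)) has_derivative D) (at (\<phi> p) within \<phi> ` U)"
    using smooth_on_has_derivative[OF chart_smooth[OF assms(1,3)]] assms(2) by blast
  then have "chart_vec U \<phi> p u f = D u" if "u \<in> model M" for u
    using dir_deriv_eq[OF chart_image_open[OF assms(1)] model_subspace _ that D] assms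
    by (simp add: chart_vec_def)
  with D that show ?thesis by blast
qed

lemma chart_vec_tangent:
  assumes c: "(U, \<phi>) \<in> atlas M" "p \<in> U" and u: "u \<in> model M"
  shows "chart_vec U \<phi> p u \<in> tangent_space M p"
proof -
  have dir_deriv: "chart_vec U \<phi> p u f = D u"
    if "f \<in> C_inf M" "((\<lambda>y. f (inv_into U \<phi> y)) has_derivative D) (at (\<phi> p) within \<phi> ` U)" for f D
    using dir_deriv_eq[OF chart_image_open[OF c(1)] model_subspace _ u that(2)] c(2) that(1)
    by (simp add: chart_vec_def)
  have "chart_vec U \<phi> p u (f + g) = chart_vec U \<phi> p u f + chart_vec U \<phi> p u g \<and>
      chart_vec U \<phi> p u (f * g) = chart_vec U \<phi> p u f * g p + f p * chart_vec U \<phi> p u g"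
    if f: "f \<in> C_inf M" "g \<in> C_inf M" for f g
  proof -
    obtain D1 where D1: "((\<lambda>y. f (inv_into U \<phi> y)) has_derivative D1) (at (\<phi> p) within \<phi> ` U)"
      using chart_derivative[OF c f(1)] by blast
    obtain D2 where D2: "((\<lambda>y. g (inv_into U \<phi> y)) has_derivative D2) (at (\<phi> p) within \<phi> ` U)"
      using chart_derivative[OF c f(2)] by blast
    have "((\<lambda>y. (f + g) (inv_into U \<phi> y)) has_derivative (\<lambda>u. D1 u + D2 u)) (at (\<phi> p) within \<phi> ` U)"
      using has_derivative_add[OF D1 D2] by (simp add: plus_fun_def)
    from dir_deriv[OF C_inf_add[OF f] this] have 1: "chart_vec U \<phi> p u (f + g) = D1 u + D2 u" .
    have "((\<lambda>y. (f * g) (inv_into U \<phi> y)) has_derivative (\<lambda>u. f p * D2 u + D1 u * g p)) (at (\<phi> p) within \<phi> ` U)"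
      using has_derivative_mult[OF D1 D2] c by (simp add: times_fun_def)
    from dir_deriv[OF C_inf_mult[OF f] this]
    have "chart_vec U \<phi> p u (f * g) = f p * D2 u + D1 u * g p" .
    with 1 dir_deriv[OF f(1) D1] dir_deriv[OF f(2) D2] show ?thesis by simp
  qed
  moreover have "chart_vec U \<phi> p u (r *\<^sub>R f) = r * chart_vec U \<phi> p u f" if f: "f \<in> C_inf M" for f r
  proof -
    obtain D1 where D1: "((\<lambda>y. f (inv_into U \<phi> y)) has_derivative D1) (at (\<phi> p) within \<phi> ` U)"
      using chart_derivative[OF c f] by blast
    have "((\<lambda>y. (r *\<^sub>R f) (inv_into U \<phi> y)) has_derivative (\<lambda>u. r * D1 u)) (at (\<phi> p) within \<phi> ` U)"
      using has_derivative_mult_right[OF D1, of r] by simp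
    from dir_deriv[OF C_inf_scaleR[OF f] this] dir_deriv[OF f D1] show ?thesis by (simp only:)
  qed
  moreover have "chart_vec U \<phi> p u f = 0" if "f \<notin> C_inf M" for f using that by (simp add: chart_vec_def)
  ultimately show ?thesis by (auto simp: tangent_space_def)
qed

lemma chart_vec_linear:
  assumes c: "(U, \<phi>) \<in> atlas M" "p \<in> U" and B: "finite B" "B \<subseteq> model M"
  shows "chart_vec U \<phi> p (\<Sum>b\<in>B. r b *\<^sub>R b) = (\<Sum>b\<in>B. r b *\<^sub>R chart_vec U \<phi> p b)"
proof
  fix f
  have ev: "(\<Sum>b\<in>B'. r b *\<^sub>R chart_vec U \<phi> p b) f = (\<Sum>b\<in>B'. r b * chart_vec U \<phi> p b f)" for B'
    by (induction B' rule: infinite_finite_induct) auto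
  show "chart_vec U \<phi> p (\<Sum>b\<in>B. r b *\<^sub>R b) f = (\<Sum>b\<in>B. r b *\<^sub>R chart_vec U \<phi> p b) f"
  proof (cases "f \<in> C_inf M")
    case True
    obtain D where D: "((\<lambda>y. f (inv_into U \<phi> y)) has_derivative D) (at (\<phi> p) within \<phi> ` U)"
      "\<And>u. u \<in> model M \<Longrightarrow> chart_vec U \<phi> p u f = D u" using chart_derivative[OF c True] by blast
    have lin: "linear D" using D(1) has_derivative_bounded_linear bounded_linear.linear by blast
    have "(\<Sum>b\<in>B. r b *\<^sub>R b) \<in> model M"
      using B(2) model_subspace by (auto intro!: subspace_sum subspace_scale)
    then show ?thesis unfolding ev
      using D(2) B(2) by (simp add: linear_sum[OF lin] linear_cmul[OF lin] subset_iff)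
  next
    case False
    then show ?thesis unfolding ev by (simp add: chart_vec_def)
  qed
qed

text \<open>Testing on a coordinate function recovers the component of \<open>u\<close>. Coordinates are global functions
  only after a cutoff, hence the hypothesis on \<open>f\<close> near \<open>q\<close>.\<close>

lemma chart_vec_coordinate:
  assumes c: "(U, \<phi>) \<in> atlas M" and N: "openin (mtop M) N" "q \<in> N" "N \<subseteq> U"
    and f: "f \<in> C_inf M" "\<And>q. q \<in> N \<Longrightarrow> f q = \<phi> q \<bullet> w" and u: "u \<in> model M"
  shows "chart_vec U \<phi> q u f = u \<bullet> w"
proof -
  have "dir_deriv (\<lambda>y. f (inv_into U \<phi> y)) u (\<phi> q) = u \<bullet> w"
  proof (rule dir_deriv_has_derivative_local)
    show "((\<lambda>y. y \<bullet> w) has_derivative (\<lambda>u. u \<bullet> w)) (at (\<phi> q) within \<phi> ` N)"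
      by (rule bounded_linear_imp_has_derivative[OF bounded_linear_inner_left])
    show "openin (top_of_set (model M)) (\<phi> ` N)" by (rule chart_image_openin[OF c N(1,3)])
    show "f (inv_into U \<phi> y) = y \<bullet> w" if "y \<in> \<phi> ` N" for y using that f(2) c N(3) by auto
  qed (use N u model_subspace in auto)
  then show ?thesis using f(1) by (simp add: chart_vec_def)
qed

lemma coordinate_functions:
  assumes c: "(U, \<phi>) \<in> atlas M" "p \<in> U"
  obtains N y where "openin (mtop M) N" "p \<in> N" "N \<subseteq> U"
    "\<And>w. y w \<in> C_inf M" "\<And>q w. q \<in> N \<Longrightarrow> y w q = \<phi> q \<bullet> w"
proof -
  obtain \<eta> N K where \<eta>: "\<eta> \<in> C_inf M" "openin (mtop M) N" "p \<in> N" "N \<subseteq> K" "closedin (mtop M) K" "K \<subseteq> U"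
    "\<And>q. q \<in> N \<Longrightarrow> \<eta> q = 1" "\<And>q. q \<notin> K \<Longrightarrow> \<eta> q = 0"
    using bump[OF chart_open[OF c(1)] c(2)] by metis
  define y where "y = (\<lambda>w q. if q \<in> U then \<eta> q * (\<phi> q \<bullet> w) else 0)"
  have "smooth_fun_on M U (\<lambda>q. \<phi> q \<bullet> w)" for w
  proof (rule smooth_fun_on_chartI[OF c(1) order_refl])
    have "smooth_on (model M) (\<phi> ` U) (\<lambda>y. y \<bullet> w)"
      by (simp add: smooth_on_def Ck_on_bounded_linear bounded_linear_inner_left)
    then show "smooth_on (model M) (\<phi> ` U) (\<lambda>y. \<phi> (inv_into U \<phi> y) \<bullet> w)"
      by (rule smooth_on_cong) (simp add: f_inv_into_f)
  qed
  then have "y w \<in> C_inf M" for w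
    unfolding y_def using cutoff_smooth[OF chart_open[OF c(1)] _ \<eta>(1,5,6,8)] by blast
  moreover have "y w q = \<phi> q \<bullet> w" if "q \<in> N" for q w using that \<eta> by (auto simp: y_def)
  ultimately show ?thesis using that[of N y] \<eta> by blast
qed

lemma vector_fieldsD:
  assumes "Y \<in> vector_fields M"
  shows "p \<in> pts M \<Longrightarrow> Y p \<in> tangent_space M p" and "p \<notin> pts M \<Longrightarrow> Y p = 0"
    and "f \<in> C_inf M \<Longrightarrow> (\<lambda>q. Y q f) \<in> C_inf M"
  using assms by (auto simp: vector_fields_def smooth_vf_on_def C_inf_def)

lemma vector_fields_not_C_inf:
  assumes "Y \<in> vector_fields M" "f \<notin> C_inf M"
  shows "Y p f = 0"
  using vector_fieldsD(1,2)[OF assms(1), of p] tangentD(4)[OF _ assms(2)] by (cases "p \<in> pts M") auto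

lemma lie_bracket_tangent:
  assumes Y: "Y \<in> vector_fields M" and Z: "Z \<in> vector_fields M" and p: "p \<in> pts M"
  shows "lie_bracket Y Z p \<in> tangent_space M p"
proof -
  note tY = vector_fieldsD(1)[OF Y] and tZ = vector_fieldsD(1)[OF Z]
  have add: "(\<lambda>q. W q (f + g)) = (\<lambda>q. W q f) + (\<lambda>q. W q g)"
    if "W \<in> vector_fields M" "f \<in> C_inf M" "g \<in> C_inf M" for W f g
  proof
    fix q show "W q (f + g) = ((\<lambda>q. W q f) + (\<lambda>q. W q g)) q"
      using that vector_fieldsD(1,2)[OF that(1), of q] tangentD(1) by (cases "q \<in> pts M") auto
  qed
  have mult: "(\<lambda>q. W q (f * g)) = (\<lambda>q. W q f) * g + f * (\<lambda>q. W q g)"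
    if "W \<in> vector_fields M" "f \<in> C_inf M" "g \<in> C_inf M" for W f g
  proof
    fix q show "W q (f * g) = ((\<lambda>q. W q f) * g + f * (\<lambda>q. W q g)) q"
      using that vector_fieldsD(1,2)[OF that(1), of q] tangentD(2) by (cases "q \<in> pts M") auto
  qed
  have scale: "(\<lambda>q. W q (c *\<^sub>R f)) = c *\<^sub>R (\<lambda>q. W q f)"
    if "W \<in> vector_fields M" "f \<in> C_inf M" for W f c
  proof
    fix q show "W q (c *\<^sub>R f) = (c *\<^sub>R (\<lambda>q. W q f)) q"
      using that vector_fieldsD(1,2)[OF that(1), of q] tangentD(3) by (cases "q \<in> pts M") auto
  qed
  note C = vector_fieldsD(3)[OF Y] vector_fieldsD(3)[OF Z]
  note sm = C_inf_add C_inf_mult C_inf_scaleR C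
  have der: "Y p (\<lambda>q. Z q (f * g)) - Z p (\<lambda>q. Y q (f * g)) =
      (Y p (\<lambda>q. Z q f) - Z p (\<lambda>q. Y q f)) * g p + f p * (Y p (\<lambda>q. Z q g) - Z p (\<lambda>q. Y q g))"
    if "f \<in> C_inf M" "g \<in> C_inf M" for f g
    using that by (simp add: mult[OF Y] mult[OF Z] tangentD(1,2)[OF tY[OF p]] tangentD(1,2)[OF tZ[OF p]] sm
      algebra_simps)
  have lin: "Y p (\<lambda>q. Z q (f + g)) - Z p (\<lambda>q. Y q (f + g)) =
      (Y p (\<lambda>q. Z q f) - Z p (\<lambda>q. Y q f)) + (Y p (\<lambda>q. Z q g) - Z p (\<lambda>q. Y q g))"
    if "f \<in> C_inf M" "g \<in> C_inf M" for f g
    using that by (simp add: add[OF Y] add[OF Z] tangentD(1)[OF tY[OF p]] tangentD(1)[OF tZ[OF p]] sm)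
  have sc: "Y p (\<lambda>q. Z q (c *\<^sub>R f)) - Z p (\<lambda>q. Y q (c *\<^sub>R f)) = c * (Y p (\<lambda>q. Z q f) - Z p (\<lambda>q. Y q f))"
    if "f \<in> C_inf M" for f c
    using that by (simp add: scale[OF Y] scale[OF Z] tangentD(3)[OF tY[OF p]] tangentD(3)[OF tZ[OF p]] sm
      right_diff_distrib)
  have 0: "Y p (\<lambda>q. Z q f) - Z p (\<lambda>q. Y q f) = 0" if "f \<notin> C_inf M" for f
    using that vector_fields_not_C_inf[OF Y] vector_fields_not_C_inf[OF Z] tangent_0[OF tY[OF p]] tangent_0[OF tZ[OF p]]
    by (simp add: zero_fun_def)
  show ?thesis unfolding tangent_space_def lie_bracket_def using der lin sc 0 by blast
qed

lemma cutoff_vector_field: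
  assumes W: "openin (mtop M) W" and Y: "smooth_vf_on M W Y" and \<eta>: "\<eta> \<in> C_inf M"
    and K: "closedin (mtop M) K" "K \<subseteq> W" "\<And>q. q \<notin> K \<Longrightarrow> \<eta> q = 0"
  shows "(\<lambda>q. if q \<in> W then \<eta> q *\<^sub>R Y q else 0) \<in> vector_fields M"
  unfolding vector_fields_def smooth_vf_on_def
proof (intro CollectI conjI ballI allI impI)
  fix p assume "p \<in> pts M"
  show "(if p \<in> W then \<eta> p *\<^sub>R Y p else 0) \<in> tangent_space M p"
    using Y tangent_subspace[of p] by (auto simp: smooth_vf_on_def subspace_scale subspace_0)
next
  fix f assume f: "f \<in> C_inf M"
  have "(\<lambda>p. if p \<in> W then \<eta> p * Y p f else 0) \<in> C_inf M"
    using Y f by (intro cutoff_smooth[OF W _ \<eta> K]) (auto simp: smooth_vf_on_def)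
  moreover have "(\<lambda>p. if p \<in> W then \<eta> p * Y p f else 0) = (\<lambda>p. (if p \<in> W then \<eta> p *\<^sub>R Y p else 0) f)"
    by auto
  ultimately show "smooth_fun_on M (pts M) (\<lambda>p. (if p \<in> W then \<eta> p *\<^sub>R Y p else 0) f)"
    by (simp add: C_inf_def)
next
  fix p assume "p \<notin> pts M"
  then show "(if p \<in> W then \<eta> p *\<^sub>R Y p else 0) = 0" using W openin_subset by auto
qed

lemma extend_vector_field:
  assumes W: "openin (mtop M) W" "p \<in> W" and Y: "smooth_vf_on M W Y"
  obtains Z N where "Z \<in> vector_fields M" "openin (mtop M) N" "p \<in> N" "N \<subseteq> W" "\<And>q. q \<in> N \<Longrightarrow> Z q = Y q"
proof -
  obtain \<eta> N K where \<eta>: "\<eta> \<in> C_inf M" "openin (mtop M) N" "p \<in> N" "N \<subseteq> K" "closedin (mtop M) K" "K \<subseteq> W"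
    "\<And>q. q \<in> N \<Longrightarrow> \<eta> q = 1" "\<And>q. q \<notin> K \<Longrightarrow> \<eta> q = 0"
    using bump[OF W] by metis
  show ?thesis
  proof (rule that[of "\<lambda>q. if q \<in> W then \<eta> q *\<^sub>R Y q else 0" N])
    show "(\<lambda>q. if q \<in> W then \<eta> q *\<^sub>R Y q else 0) \<in> vector_fields M"
      by (rule cutoff_vector_field[OF W(1) Y \<eta>(1,5,6,8)])
  qed (use \<eta> in auto)
qed

text \<open>Smoothness of one-forms is defined by testing on global vector fields; a local field agrees with a
  global one near any given point.\<close>

lemma smooth_form_apply:
  assumes W: "openin (mtop M) W" and \<alpha>: "smooth_form_on M W \<alpha>" and Y: "smooth_vf_on M W Y"
  shows "smooth_fun_on M W (\<lambda>q. \<alpha> q (Y q))"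
proof (rule smooth_fun_on_local[OF W])
  fix p assume p: "p \<in> W"
  obtain Z N where Z: "Z \<in> vector_fields M" "openin (mtop M) N" "p \<in> N" "N \<subseteq> W" "\<And>q. q \<in> N \<Longrightarrow> Z q = Y q"
    using extend_vector_field[OF W p Y] by metis
  have "smooth_fun_on M W (\<lambda>q. \<alpha> q (Z q))" using \<alpha> Z(1) by (simp add: smooth_form_on_def)
  then have "smooth_fun_on M N (\<lambda>q. \<alpha> q (Z q))" using Z(4) by (rule smooth_fun_on_subset)
  then have "smooth_fun_on M N (\<lambda>q. \<alpha> q (Y q))" by (rule smooth_fun_on_cong) (simp add: Z(5))
  then show "\<exists>N. openin (mtop M) N \<and> p \<in> N \<and> smooth_fun_on M N (\<lambda>q. \<alpha> q (Y q))" using Z by blast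
qed

lemma dfun_cotangent: "f \<in> C_inf M \<Longrightarrow> dfun M f p \<in> cotangent_space M p"
  using tangent_subspace[of p] by (auto simp: dfun_def cotangent_space_def subspace_add subspace_scale)

text \<open>The differential, set to zero outside the carrier as membership in \<open>one_forms\<close> demands.\<close>

definition exact_form :: "('p \<Rightarrow> real) \<Rightarrow> 'p \<Rightarrow> 'p ctvec"
  where "exact_form f p = (if p \<in> pts M then dfun M f p else 0)"

lemma exact_form_one_form:
  assumes "f \<in> C_inf M"
  shows "exact_form f \<in> one_forms M"
  unfolding one_forms_def smooth_form_on_def
proof (intro CollectI conjI ballI allI impI)
  fix Y assume Y: "Y \<in> vector_fields M"
  have "smooth_fun_on M (pts M) (\<lambda>p. Y p f)"
    using vector_fieldsD(3)[OF Y assms] by (simp add: C_inf_def)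
  then show "smooth_fun_on M (pts M) (\<lambda>p. exact_form f p (Y p))"
    by (rule smooth_fun_on_cong) (simp add: exact_form_def dfun_def vector_fieldsD(1)[OF Y])
qed (simp_all add: exact_form_def dfun_cotangent assms)

text \<open>The components of a vector field in a chart are its values on coordinate functions, hence smooth,
  and solving the resulting differential equation gives an integral curve. Rescaling the field by
  \<open>\<delta>\<close> stretches the short time interval to \<open>{0..1}\<close>.\<close>

lemma short_integral_curve:
  assumes charts: "\<And>U \<phi> q v. (U, \<phi>) \<in> atlas M \<Longrightarrow> q \<in> U \<Longrightarrow> v \<in> tangent_space M q \<Longrightarrow>
      \<exists>u\<in>model M. v = chart_vec U \<phi> q u"
    and Y: "Y \<in> vector_fields M" and p: "p \<in> pts M"
  obtains \<delta> \<gamma> where "0 < \<delta>" "\<gamma> 0 = p" "integral_curve M (\<lambda>q. \<delta> *\<^sub>R Y q) \<gamma>"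
proof -
  obtain U \<phi> where c: "(U, \<phi>) \<in> atlas M" "p \<in> U" using chart_exists[OF p] by blast
  obtain N y where N: "openin (mtop M) N" "p \<in> N" "N \<subseteq> U"
    and y: "\<And>w. y w \<in> C_inf M" "\<And>q w. q \<in> N \<Longrightarrow> y w q = \<phi> q \<bullet> w"
    using coordinate_functions[OF c] by metis
  define h where "h = (\<lambda>q. \<Sum>b\<in>Basis. Y q (y b) *\<^sub>R b)"
  have h: "h q \<in> model M \<and> Y q = chart_vec U \<phi> q (h q)" if q: "q \<in> N" for q
  proof -
    have "q \<in> pts M" using q N openin_subset by blast
    then obtain u where u: "u \<in> model M" "Y q = chart_vec U \<phi> q u"
      using charts[OF c(1), of q "Y q"] vector_fieldsD(1)[OF Y] q N(3) by blast
    have "Y q (y b) = u \<bullet> b" for b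
      unfolding u(2) using chart_vec_coordinate[OF c(1) N(1) q N(3) y(1) y(2) u(1)] by blast
    then have "h q = u" by (simp add: h_def euclidean_representation)
    with u show ?thesis by simp
  qed
  define k where "k = (\<lambda>z. h (inv_into U \<phi> z))"
  have oN: "openin (top_of_set (model M)) (\<phi> ` N)" by (rule chart_image_openin[OF c(1) N(1,3)])
  have "smooth_on (model M) (\<phi> ` N) (\<lambda>z. k z \<bullet> b)" if b: "b \<in> Basis" for b
  proof -
    have "smooth_on (model M) (\<phi> ` U) (\<lambda>z. Y (inv_into U \<phi> z) (y b))"
      by (rule chart_smooth[OF c(1) vector_fieldsD(3)[OF Y y(1)]])
    then have "smooth_on (model M) (\<phi> ` N) (\<lambda>z. Y (inv_into U \<phi> z) (y b))"
      by (rule smooth_on_subset) (use N(3) in auto)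
    then show ?thesis using b by (simp add: k_def h_def)
  qed
  then have "smooth_on (model M) (\<phi> ` N) k" by (subst smooth_on_euclidean_iff) blast
  then have k1: "Ck_on 1 (model M) (\<phi> ` N) k" by (simp only: smooth_on_def)
  have k2: "k ` \<phi> ` N \<subseteq> model M" using h N(3) c(1) by (auto simp: k_def)
  have p': "\<phi> p \<in> \<phi> ` N" using N(2) by blast
  obtain \<delta> \<sigma> where \<sigma>: "0 < \<delta>" "\<sigma> 0 = \<phi> p" "\<sigma> ` {0..\<delta>} \<subseteq> \<phi> ` N"
    "\<And>t. t \<in> {0..\<delta>} \<Longrightarrow> (\<sigma> has_vector_derivative k (\<sigma> t)) (at t within {0..\<delta>})"
    using picard[OF model_subspace oN p' k1 k2] by metis
  define c' where "c' = (\<lambda>t. \<sigma> (\<delta> * t))"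
  define \<gamma> where "\<gamma> = (\<lambda>t. inv_into U \<phi> (c' t))"
  have I: "\<delta> * t \<in> {0..\<delta>}" if "t \<in> {0..1}" for t
    using that \<sigma>(1) by (auto intro: mult_left_le)
  have c'N: "c' t \<in> \<phi> ` N" if "t \<in> {0..1}" for t using I[OF that] \<sigma>(3) by (auto simp: c'_def)
  have c'der: "(c' has_vector_derivative \<delta> *\<^sub>R k (c' t)) (at t within {0..1})" if t: "t \<in> {0..1}" for t
  proof -
    have "((*) \<delta> has_vector_derivative \<delta>) (at t within {0..1})"
      by (auto intro!: derivative_eq_intros simp: has_real_derivative_iff_has_vector_derivative[symmetric])
    moreover have "(\<sigma> has_vector_derivative k (c' t)) (at (\<delta> * t) within (*) \<delta> ` {0..1})"
      unfolding c'_def by (rule has_vector_derivative_within_subset[OF \<sigma>(4)]) (use I t in blast)+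
    ultimately have "(\<sigma> \<circ> (*) \<delta> has_vector_derivative \<delta> *\<^sub>R k (c' t)) (at t within {0..1})"
      by (rule vector_diff_chain_within)
    then show ?thesis by (simp add: c'_def comp_def)
  qed
  have N': "\<gamma> t \<in> N" "\<phi> (\<gamma> t) = c' t" if t: "t \<in> {0..1}" for t
    using c'N[OF t] N(3) c(1) by (auto simp: \<gamma>_def)
  show ?thesis
  proof (rule that[of \<delta> \<gamma>])
    show "0 < \<delta>" by fact
    show "\<gamma> 0 = p" using \<sigma>(2) c by (simp add: \<gamma>_def c'_def)
    show "integral_curve M (\<lambda>q. \<delta> *\<^sub>R Y q) \<gamma>" unfolding integral_curve_def
    proof (intro conjI ballI)
      have "continuous_on {0..1} c'"
        using c'der has_vector_derivative_continuous continuous_on_eq_continuous_within by blast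
      moreover have "c' ` {0..1} \<subseteq> \<phi> ` U" using c'N N(3) by blast
      ultimately have "continuous_map (top_of_set {0..1}) (top_of_set (\<phi> ` U)) c'"
        by (simp add: continuous_map_in_subtopology image_subset_iff_funcset)
      then have "continuous_map (top_of_set {0..1}) (mtop M) (inv_into U \<phi> \<circ> c')"
        using chart_inv_continuous[OF c(1)] by (rule continuous_map_compose)
      then show "continuous_map (top_of_set {0..1}) (mtop M) \<gamma>" by (simp add: \<gamma>_def comp_def)
    next
      fix t f assume t: "t \<in> {0..1::real}" and f: "f \<in> C_inf M"
      have q: "\<gamma> t \<in> U" using N'(1)[OF t] N(3) by blast
      obtain D where D: "((\<lambda>y. f (inv_into U \<phi> y)) has_derivative D) (at (\<phi> (\<gamma> t)) within \<phi> ` U)"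
        "\<And>u. u \<in> model M \<Longrightarrow> chart_vec U \<phi> (\<gamma> t) u f = D u" using chart_derivative[OF c(1) q f] by blast
      have "((\<lambda>y. f (inv_into U \<phi> y)) has_derivative D) (at (c' t) within c' ` {0..1})"
        using D(1) unfolding N'(2)[OF t] by (rule has_derivative_subset) (use c'N N(3) in blast)
      then have "((\<lambda>s. f (inv_into U \<phi> (c' s))) has_derivative (\<lambda>s. D (s *\<^sub>R \<delta> *\<^sub>R k (c' t)))) (at t within {0..1})"
        using c'der[OF t] unfolding has_vector_derivative_def by (rule_tac has_derivative_in_compose)
      moreover have "linear D" using D(1) has_derivative_bounded_linear bounded_linear.linear by blast
      moreover have "k (c' t) = h (\<gamma> t)" by (simp add: k_def \<gamma>_def)
      ultimately have "((\<lambda>s. f (\<gamma> s)) has_derivative (\<lambda>s. s * (\<delta> * D (h (\<gamma> t))))) (at t within {0..1})"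
        by (simp add: \<gamma>_def linear_cmul mult.assoc)
      moreover have "D (h (\<gamma> t)) = Y (\<gamma> t) f" using D(2) h[OF N'(1)[OF t]] by simp
      ultimately show "((\<lambda>t. f (\<gamma> t)) has_real_derivative (\<delta> *\<^sub>R Y (\<gamma> t)) f) (at t within {0..1})"
        by (simp add: has_field_derivative_def mult.commute[of _ "\<delta> * _"])
    qed
  qed
qed

end

text \<open>Locally the function is its pullback composed with a smooth section of \<open>h\<close>. That the derivative of
  \<open>h\<close> in charts is onto, as needed for such sections, follows from surjectivity on derivations by testing
  against coordinate functions.\<close>

lemma smooth_descends_along_submersion:
  assumes X: "smooth_manifold X" and B: "smooth_manifold B" and sub: "submersion X B h"
    and charts: "\<And>U \<phi> q v. (U, \<phi>) \<in> atlas X \<Longrightarrow> q \<in> U \<Longrightarrow> v \<in> tangent_space X q \<Longrightarrow>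
      \<exists>u\<in>model X. v = manifold.chart_vec X U \<phi> q u"
    and surj: "h ` pts X = pts B" and f: "pullback X h f \<in> C_inf X" and f0: "\<And>b. b \<notin> pts B \<Longrightarrow> f b = 0"
  shows "f \<in> C_inf B"
proof -
  interpret X: manifold X by standard (rule X)
  interpret B: manifold B by standard (rule B)
  have hs: "smooth_map X B h" using sub by (simp add: submersion_def)
  have cont: "continuous_map (mtop X) (mtop B) h" using hs by (simp add: smooth_map_def)
  have "B.smooth_at (h x) f" if x: "x \<in> pts X" for x
  proof -
    obtain U \<phi> where c: "(U, \<phi>) \<in> atlas X" "x \<in> U" using X.chart_exists[OF x] by blast
    have hx: "h x \<in> pts B" using surj x by blast
    obtain W \<psi> where c': "(W, \<psi>) \<in> atlas B" "h x \<in> W" using B.chart_exists[OF hx] by blast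
    define U' where "U' = {q \<in> U. h q \<in> W}"
    have oU': "openin (mtop X) U'" unfolding U'_def
      using cont X.chart_open[OF c(1)] B.chart_open[OF c'(1)] by (rule openin_continuous_map_preimage_gen)
    have xU': "x \<in> U'" and U'U: "U' \<subseteq> U" using c c' by (auto simp: U'_def)
    define G where "G = (\<lambda>y. \<psi> (h (inv_into U \<phi> y)))"
    have "smooth_on (model X) (\<phi> ` (U \<inter> h -` W)) G"
    proof -
      have "\<forall>(U, \<phi>)\<in>atlas X. \<forall>(W, \<psi>)\<in>atlas B.
          smooth_on (model X) (\<phi> ` (U \<inter> h -` W)) (\<psi> \<circ> h \<circ> inv_into U \<phi>)"
        using hs by (simp add: smooth_map_def)
      from bspec[OF bspec[OF this c(1), simplified] c'(1)] show ?thesis by (simp add: comp_def G_def)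
    qed
    moreover have "U \<inter> h -` W = U'" by (auto simp: U'_def)
    ultimately have G: "smooth_on (model X) (\<phi> ` U') G" by simp
    have oN: "openin (top_of_set (model X)) (\<phi> ` U')" by (rule X.chart_image_openin[OF c(1) oU' U'U])
    have GV: "G ` \<phi> ` U' \<subseteq> \<psi> ` W" using c(1) by (auto simp: G_def U'_def)
    have \<psi>W: "\<psi> ` W \<subseteq> model B" using B.chart_image_model[OF c'(1)] by blast
    obtain D where D: "(G has_derivative D) (at (\<phi> x) within \<phi> ` U')"
      using smooth_on_has_derivative[OF G] xU' by blast
    have linD: "linear D" using D has_derivative_bounded_linear bounded_linear.linear by blast
    obtain N y where N: "openin (mtop B) N" "h x \<in> N" "N \<subseteq> W"
      and y: "\<And>w. y w \<in> C_inf B" "\<And>q w. q \<in> N \<Longrightarrow> y w q = \<psi> q \<bullet> w"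
      using B.coordinate_functions[OF c'] by metis
    have "model B \<subseteq> D ` model X"
    proof
      fix w assume w: "w \<in> model B"
      have "B.chart_vec W \<psi> (h x) w \<in> push X B h ` tangent_space X x"
        using sub x B.chart_vec_tangent[OF c' w] by (simp add: submersion_def)
      then obtain u where u: "u \<in> model X" "B.chart_vec W \<psi> (h x) w = push X B h (X.chart_vec U \<phi> x u)"
        using charts[OF c] by blast
      have "D u \<bullet> b = w \<bullet> b" for b
      proof -
        have "w \<bullet> b = B.chart_vec W \<psi> (h x) w (y b)"
          using B.chart_vec_coordinate[OF c'(1) N y(1) y(2) w] by simp
        also have "\<dots> = X.chart_vec U \<phi> x u (pullback X h (y b))" by (simp add: u(2) push_def y(1))
        also have "\<dots> = dir_deriv (\<lambda>z. pullback X h (y b) (inv_into U \<phi> z)) u (\<phi> x)"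
          using pullback_C_inf[OF X B hs y(1)] by (simp add: X.chart_vec_def)
        also have "\<dots> = D u \<bullet> b"
        proof (rule dir_deriv_has_derivative_local[OF _ _ X.model_subspace _ u(1)])
          let ?N = "{q \<in> U'. h q \<in> N}"
          have oN': "openin (mtop X) ?N"
            using cont oU' N(1) by (rule openin_continuous_map_preimage_gen)
          then show "openin (top_of_set (model X)) (\<phi> ` ?N)"
            by (rule X.chart_image_openin[OF c(1)]) (use U'U in auto)
          show "\<phi> x \<in> \<phi> ` ?N" using xU' N(2) by blast
          have "(G has_derivative D) (at (\<phi> x) within \<phi> ` ?N)"
            using D by (rule has_derivative_subset) auto
          then show "((\<lambda>z. G z \<bullet> b) has_derivative (\<lambda>u. D u \<bullet> b)) (at (\<phi> x) within \<phi> ` ?N)"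
            by (rule has_derivative_inner_left)
          fix z assume "z \<in> \<phi> ` ?N"
          then obtain q where q: "q \<in> U'" "h q \<in> N" "z = \<phi> q" by blast
          then have "q \<in> U" "q \<in> pts X" using U'U X.chart_subset[OF c(1)] by auto
          then show "pullback X h (y b) (inv_into U \<phi> z) = G z \<bullet> b"
            using c(1) y(2) q by (simp add: pullback_def G_def)
        qed
        finally show ?thesis by simp
      qed
      then have "D u = w" by (simp add: euclidean_eq_iff[of "D u" w])
      then show "w \<in> D ` model X" using u(1) by blast
    qed
    moreover have "G ` \<phi> ` U' \<subseteq> model B" using GV \<psi>W by blast
    ultimately obtain W' s where s: "openin (top_of_set (model B)) W'" "G (\<phi> x) \<in> W'"
      "smooth_on (model B) W' s" "s ` W' \<subseteq> \<phi> ` U'" "\<And>w. w \<in> W' \<Longrightarrow> G (s w) = w"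
      using submersion_local_section[OF X.model_subspace B.model_subspace oN imageI[OF xU'] G _ D] by metis
    have W'W: "W' \<subseteq> \<psi> ` W" using s(4,5) GV by force
    have "smooth_on (model B) W' (\<lambda>w. pullback X h f (inv_into U \<phi> (s w)))"
    proof (rule smooth_on_compose[OF X.chart_smooth[OF c(1) f] s(3) _ _ X.model_subspace])
      show "s ` W' \<subseteq> \<phi> ` U" using s(4) U'U by blast
      show "\<phi> ` U \<subseteq> model X" using X.chart_image_model[OF c(1)] by blast
    qed
    then have "smooth_on (model B) W' (\<lambda>w. f (inv_into W \<psi> w))"
    proof (rule smooth_on_cong)
      fix w assume w: "w \<in> W'"
      then obtain q where q: "q \<in> U'" "s w = \<phi> q" using s(4) by blast
      then have "q \<in> U" "h q \<in> W" "q \<in> pts X" using U'U X.chart_subset[OF c(1)] by (auto simp: U'_def)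
      moreover from this have "w = \<psi> (h q)" using s(5)[OF w] q c(1) by (simp add: G_def)
      ultimately show "pullback X h f (inv_into U \<phi> (s w)) = f (inv_into W \<psi> w)"
        using q c(1) c'(1) by (simp add: pullback_def)
    qed
    moreover have "\<psi> ` inv_into W \<psi> ` W' = W'" by (rule image_inv_into_cancel[OF refl W'W])
    ultimately have "smooth_fun_on B (inv_into W \<psi> ` W') f"
      using W'W by (intro B.smooth_fun_on_chartI[OF c'(1)]) (auto intro: inv_into_into)
    moreover have "openin (mtop B) (inv_into W \<psi> ` W')" by (rule B.chart_inv_openin[OF c'(1) s(1) W'W])
    moreover have "h x \<in> inv_into W \<psi> ` W'"
    proof (rule image_eqI[OF _ s(2)])
      show "h x = inv_into W \<psi> (G (\<phi> x))" using c c' by (simp add: G_def)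
    qed
    ultimately show ?thesis unfolding B.smooth_at_def by blast
  qed
  then have "\<forall>b\<in>h ` pts X. B.smooth_at b f" by blast
  then show ?thesis using f0 by (simp add: B.C_inf_iff surj)
qed

section \<open>Linear algebra of bases and bilinear forms\<close>

lemma sum_fun_apply: "(\<Sum>i\<in>I. f i) x = (\<Sum>i\<in>I. f i x)"
  by (induction I rule: infinite_finite_induct) auto

lemma sum_lessThan_add:
  fixes f :: "nat \<Rightarrow> 'a::comm_monoid_add"
  shows "(\<Sum>l<m + n. f l) = (\<Sum>l<m. f l) + (\<Sum>l<n. f (m + l))"
  by (induction n) (simp_all add: add.assoc)

lemma is_basis_repr:
  assumes "is_basis k b V" "v \<in> V"
  obtains c where "v = (\<Sum>i<k. c i *\<^sub>R b i)"
proof -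
  have "v \<in> span (b ` {..<k})" using assms by (simp add: is_basis_def)
  then obtain u where "v = (\<Sum>w\<in>b ` {..<k}. u w *\<^sub>R w)" by (auto simp: span_finite)
  also have "\<dots> = (\<Sum>i<k. u (b i) *\<^sub>R b i)"
    using assms(1) by (simp add: is_basis_def sum.reindex)
  finally show ?thesis by (rule that)
qed

lemma is_basis_independent:
  assumes b: "is_basis k b V" and 0: "(\<Sum>i<k. c i *\<^sub>R b i) = 0" and i: "i < k"
  shows "c i = 0"
proof -
  have inj: "inj_on b {..<k}" using b by (simp add: is_basis_def)
  define u where "u = (\<lambda>w. c (inv_into {..<k} b w))"
  have u: "u (b j) = c j" if "j < k" for j using inj that by (simp add: u_def)
  have "(\<Sum>w\<in>b ` {..<k}. u w *\<^sub>R w) = 0" using 0 u by (simp add: sum.reindex[OF inj])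
  then have "\<forall>w\<in>b ` {..<k}. u w = 0"
    using b dependent_finite[of "b ` {..<k}"] by (auto simp: is_basis_def)
  then show ?thesis using u[OF i] i by auto
qed

lemma is_basis_unique:
  assumes b: "is_basis k b V" and eq: "(\<Sum>i<k. c i *\<^sub>R b i) = (\<Sum>i<k. d i *\<^sub>R b i)" and i: "i < k"
  shows "c i = d i"
proof -
  have "(\<Sum>i<k. (c i - d i) *\<^sub>R b i) = 0" using eq by (simp add: scaleR_left_diff_distrib sum_subtractf)
  from is_basis_independent[OF b this i] show ?thesis by simp
qed

lemma is_basis_mem: "is_basis k b V \<Longrightarrow> i < k \<Longrightarrow> b i \<in> V"
  unfolding is_basis_def by (metis imageI lessThan_iff span_base)

lemma is_basis_subspace: "is_basis k b V \<Longrightarrow> subspace V"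
  unfolding is_basis_def using subspace_span by blast

lemma linear_on_subspace_sum:
  fixes a :: "'v::real_vector \<Rightarrow> real"
  assumes T: "subspace T" and add: "\<And>u v. u \<in> T \<Longrightarrow> v \<in> T \<Longrightarrow> a (u + v) = a u + a v"
    and scale: "\<And>v c. v \<in> T \<Longrightarrow> a (c *\<^sub>R v) = c * a v" and v: "\<And>i. i \<in> I \<Longrightarrow> v i \<in> T"
  shows "a (\<Sum>i\<in>I. c i *\<^sub>R v i) = (\<Sum>i\<in>I. c i * a (v i))"
proof -
  have a0: "a 0 = 0" using scale[OF subspace_0[OF T], of 0] by simp
  from v show ?thesis
  proof (induction I rule: infinite_finite_induct)
    case (insert i I)
    then have "(\<Sum>i\<in>I. c i *\<^sub>R v i) \<in> T" "c i *\<^sub>R v i \<in> T"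
      using T by (auto intro: subspace_sum subspace_scale)
    with insert show ?case by (simp add: add scale)
  qed (simp_all add: a0)
qed

lemma independent_maximal_spans:
  fixes T S :: "'a::real_vector set"
  assumes "finite T" "independent S" "S \<subseteq> span T" "card T \<le> card S"
  shows "span T \<subseteq> span S"
proof (rule ccontr)
  assume "\<not> ?thesis"
  then obtain x where x: "x \<in> span T" "x \<notin> span S" by blast
  have S: "finite S" using independent_span_bound[OF assms(1-3)] by blast
  have "independent (insert x S)" using x assms(2) by (simp add: independent_insert)
  then have "card (insert x S) \<le> card T"
    using independent_span_bound[OF assms(1), of "insert x S"] assms(3) x(1) by blast
  moreover have "x \<notin> S" using x(2) span_superset by blast
  ultimately show False using S assms(4) by simp
qed

text \<open>The coordinate map given by pairing with a basis is injective, hence onto by dimension.\<close>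

lemma nondegenerate_represent:
  fixes pr :: "'v::real_vector \<Rightarrow> 'v \<Rightarrow> real"
  assumes b: "is_basis k b W"
    and add: "\<And>u v w. u \<in> W \<Longrightarrow> v \<in> W \<Longrightarrow> w \<in> W \<Longrightarrow> pr (u + v) w = pr u w + pr v w"
    and scale: "\<And>c u w. u \<in> W \<Longrightarrow> w \<in> W \<Longrightarrow> pr (c *\<^sub>R u) w = c * pr u w"
    and sym: "\<And>u v. u \<in> W \<Longrightarrow> v \<in> W \<Longrightarrow> pr u v = pr v u"
    and nondeg: "\<And>u. u \<in> W \<Longrightarrow> \<forall>v\<in>W. pr u v = 0 \<Longrightarrow> u = 0"
    and l: "linear l"
  shows "\<exists>w\<in>W. \<forall>g\<in>W. pr g w = l g"
proof -
  have W: "subspace W" by (rule is_basis_subspace[OF b])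
  have bW: "b i \<in> W" if "i < k" for i using b that by (rule is_basis_mem)
  have comb: "(\<Sum>i\<in>I. c i *\<^sub>R b i) \<in> W" if "I \<subseteq> {..<k}" for c I
    using that bW W by (auto intro!: subspace_sum subspace_scale)
  have pr_sum: "pr (\<Sum>i\<in>I. c i *\<^sub>R b i) w = (\<Sum>i\<in>I. c i * pr (b i) w)"
    if "I \<subseteq> {..<k}" "w \<in> W" for c I w
    using that add scale bW by (intro linear_on_subspace_sum[OF W, of "\<lambda>u. pr u w"]) auto
  define T where "T = (\<lambda>w i. if i < k then pr (b i) w else (0::real))"
  define e where "e = (\<lambda>(j::nat) (i::nat). if i = j then 1 else (0::real))"
  have expand: "f = (\<Sum>i<k. f i *\<^sub>R e i)" if "\<And>i. i \<ge> k \<Longrightarrow> f i = 0" for f :: "nat \<Rightarrow> real"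
  proof
    fix j
    have "(\<Sum>i<k. f i *\<^sub>R e i) j = (\<Sum>i<k. if j = i then f i else 0)"
      unfolding sum_fun_apply by (intro sum.cong) (auto simp: e_def)
    then show "f j = (\<Sum>i<k. f i *\<^sub>R e i) j" using that by simp
  qed
  have span_e: "f \<in> span (e ` {..<k})" if "\<And>i. i \<ge> k \<Longrightarrow> f i = 0" for f :: "nat \<Rightarrow> real"
  proof (subst expand[OF that])
    show "(\<Sum>i<k. f i *\<^sub>R e i) \<in> span (e ` {..<k})"
      by (intro span_sum span_scale span_base) auto
  qed
  have T_comb: "(\<Sum>j<k. c j *\<^sub>R T (b j)) = T (\<Sum>j<k. c j *\<^sub>R b j)" for c
  proof
    fix i
    have "pr (b i) (\<Sum>j<k. c j *\<^sub>R b j) = (\<Sum>j<k. c j * pr (b i) (b j))" if i: "i < k"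
    proof -
      have "pr (b i) (\<Sum>j<k. c j *\<^sub>R b j) = (\<Sum>j<k. c j * pr (b j) (b i))"
        using sym[OF bW[OF i] comb[of "{..<k}" c]] pr_sum[of "{..<k}" "b i" c] bW[OF i] by simp
      also have "\<dots> = (\<Sum>j<k. c j * pr (b i) (b j))" using sym bW i by (intro sum.cong) auto
      finally show ?thesis .
    qed
    then show "(\<Sum>j<k. c j *\<^sub>R T (b j)) i = T (\<Sum>j<k. c j *\<^sub>R b j) i"
      by (simp add: sum_fun_apply T_def)
  qed
  \<comment> \<open>Nondegeneracy enters as injectivity of the coordinate map \<open>T\<close>.\<close>
  have T0: "w = 0" if w: "w \<in> W" and 0: "T w = 0" for w
  proof (rule nondeg[OF w], rule ballI)
    fix v assume v: "v \<in> W"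
    obtain c where c: "v = (\<Sum>i<k. c i *\<^sub>R b i)" using is_basis_repr[OF b v] .
    have "pr (b i) w = 0" if "i < k" for i using fun_cong[OF 0, of i] that by (simp add: T_def)
    then have "pr v w = 0" using pr_sum[of "{..<k}" w c] w by (simp add: c)
    then show "pr w v = 0" using sym w v by simp
  qed
  have ind: "c j = 0" if "(\<Sum>j<k. c j *\<^sub>R T (b j)) = 0" "j < k" for c j
    using T0[OF comb[of "{..<k}" c]] that is_basis_independent[OF b] unfolding T_comb by blast
  have inj: "inj_on (\<lambda>j. T (b j)) {..<k}"
  proof (rule inj_onI, rule ccontr)
    fix i j assume ij: "i \<in> {..<k}" "j \<in> {..<k}" "T (b i) = T (b j)" "i \<noteq> j"
    have "(\<Sum>m<k. ((if m = i then 1 else 0) - (if m = j then 1 else 0)) *\<^sub>R T (b m)) =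
        (\<Sum>m<k. if m = i then T (b m) else 0) - (\<Sum>m<k. if m = j then T (b m) else 0)"
      unfolding sum_subtractf[symmetric] by (intro sum.cong) auto
    also have "\<dots> = 0" using ij by simp
    finally have "(if i = i then 1 else 0) - (if i = j then 1 else 0) = (0::real)"
      using ij(1) by (intro ind) auto
    then show False using ij(4) by simp
  qed
  have "independent ((\<lambda>j. T (b j)) ` {..<k})"
  proof -
    have "\<forall>j<k. u (T (b j)) = 0" if "(\<Sum>v\<in>(\<lambda>j. T (b j)) ` {..<k}. u v *\<^sub>R v) = 0" for u
      using that ind[of "\<lambda>j. u (T (b j))"] by (simp add: sum.reindex[OF inj])
    then show ?thesis by (subst dependent_finite) auto
  qed
  moreover have "(\<lambda>j. T (b j)) ` {..<k} \<subseteq> span (e ` {..<k})"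
    using span_e by (auto simp: T_def)
  moreover have "card (e ` {..<k}) \<le> card ((\<lambda>j. T (b j)) ` {..<k})"
    using card_image_le[of "{..<k}" e] by (simp add: card_image[OF inj])
  ultimately have sub: "span (e ` {..<k}) \<subseteq> span ((\<lambda>j. T (b j)) ` {..<k})"
    by (intro independent_maximal_spans) auto
  have "(\<lambda>i. if i < k then l (b i) else 0) \<in> span ((\<lambda>j. T (b j)) ` {..<k})"
    using sub span_e[of "\<lambda>i. if i < k then l (b i) else 0"] by auto
  then obtain u where "(\<lambda>i. if i < k then l (b i) else 0) = (\<Sum>j<k. u (T (b j)) *\<^sub>R T (b j))"
    by (auto simp: span_finite sum.reindex[OF inj])
  then have Tw: "T (\<Sum>j<k. u (T (b j)) *\<^sub>R b j) = (\<lambda>i. if i < k then l (b i) else 0)"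
    using T_comb[of "\<lambda>j. u (T (b j))"] by simp
  define w where "w = (\<Sum>j<k. u (T (b j)) *\<^sub>R b j)"
  have w: "w \<in> W" unfolding w_def by (rule comb) simp
  have bw: "pr (b i) w = l (b i)" if "i < k" for i
    using fun_cong[OF Tw, of i] that by (simp add: w_def T_def)
  show ?thesis
  proof (rule bexI[OF _ w], rule ballI)
    fix g assume "g \<in> W"
    then obtain c where c: "g = (\<Sum>i<k. c i *\<^sub>R b i)" using is_basis_repr[OF b] by blast
    show "pr g w = l g"
      using pr_sum[of "{..<k}" w c] w bw by (simp add: c linear_sum[OF l] linear_cmul[OF l])
  qed
qed

text \<open>If \<open>u\<close> were not in \<open>G\<close>, a functional vanishing on \<open>G\<close> but not at \<open>u\<close> would be represented by a vector
  orthogonal to \<open>G\<close> but not to \<open>u\<close>.\<close>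

lemma double_orthogonal:
  fixes pr :: "'v::real_vector \<Rightarrow> 'v \<Rightarrow> real"
  assumes b: "is_basis k b W"
    and add: "\<And>u v w. u \<in> W \<Longrightarrow> v \<in> W \<Longrightarrow> w \<in> W \<Longrightarrow> pr (u + v) w = pr u w + pr v w"
    and scale: "\<And>c u w. u \<in> W \<Longrightarrow> w \<in> W \<Longrightarrow> pr (c *\<^sub>R u) w = c * pr u w"
    and sym: "\<And>u v. u \<in> W \<Longrightarrow> v \<in> W \<Longrightarrow> pr u v = pr v u"
    and nondeg: "\<And>u. u \<in> W \<Longrightarrow> \<forall>v\<in>W. pr u v = 0 \<Longrightarrow> u = 0"
    and G: "subspace G" "G \<subseteq> W" and u: "u \<in> W"
    and orth: "\<And>w. w \<in> W \<Longrightarrow> \<forall>g\<in>G. pr g w = 0 \<Longrightarrow> pr u w = 0"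
  shows "u \<in> G"
proof (rule ccontr)
  assume "u \<notin> G"
  obtain C where C: "C \<subseteq> G" "independent C" "G \<subseteq> span C" using maximal_independent_subset by blast
  have "span C \<subseteq> G" using C(1) G(1) by (rule span_minimal)
  then have "u \<notin> span C" using \<open>u \<notin> G\<close> by blast
  then have "independent (insert u C)" using C(2) by (simp add: independent_insert)
  then obtain l where l: "linear l" "\<forall>x\<in>insert u C. l x = (if x = u then 1 else (0::real))"
    using linear_independent_extend[of "insert u C" "\<lambda>x. if x = u then 1 else (0::real)"] by metis
  have "u \<notin> C" using C(1) \<open>u \<notin> G\<close> by blast
  then have "l x = 0" if "x \<in> C" for x using l(2) that by auto
  then have lG: "l g = 0" if "g \<in> G" for g
    using linear_eq_0_on_span[OF l(1), of C g] C(3) that by blast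
  have "\<exists>w\<in>W. \<forall>g\<in>W. pr g w = l g"
    by (rule nondegenerate_represent[OF b add scale sym nondeg l(1)])
  then obtain w where w: "w \<in> W" "\<forall>g\<in>W. pr g w = l g" by blast
  have "pr u w = 0" using w(2) G(2) lG by (intro orth[OF w(1)]) auto
  then show False using w(2) u l(2) by simp
qed


section \<open>The standard Courant algebroid\<close>

context manifold
begin

lemma cotangentD:
  assumes "\<alpha> \<in> cotangent_space M p"
  shows "u \<in> tangent_space M p \<Longrightarrow> v \<in> tangent_space M p \<Longrightarrow> \<alpha> (u + v) = \<alpha> u + \<alpha> v"
    and "v \<in> tangent_space M p \<Longrightarrow> \<alpha> (c *\<^sub>R v) = c * \<alpha> v"
    and "v \<notin> tangent_space M p \<Longrightarrow> \<alpha> v = 0"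
  using assms by (auto simp: cotangent_space_def)

lemma cotangent_sum:
  assumes \<alpha>: "\<alpha> \<in> cotangent_space M p" and v: "\<And>i. i \<in> I \<Longrightarrow> v i \<in> tangent_space M p"
  shows "\<alpha> (\<Sum>i\<in>I. c i *\<^sub>R v i) = (\<Sum>i\<in>I. c i * \<alpha> (v i))"
  by (rule linear_on_subspace_sum[OF tangent_subspace cotangentD(1,2)[OF \<alpha>] v])

text \<open>A family of \<open>m\<close> independent derivations together with a dual family of covectors gives \<open>2 m\<close>
  independent elements of \<open>T\<^sub>pM \<times> T\<^sub>p\<^sup>*M\<close>.\<close>

lemma independent_tangent_bound:
  assumes e: "is_basis (2 * n) e (tangent_space M p \<times> cotangent_space M p)"
    and I: "finite I" "independent I" "I \<subseteq> tangent_space M p"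
  shows "card I \<le> n"
proof -
  have "\<exists>l. linear l \<and> (\<forall>x\<in>I. l x = (if x = i then 1 else (0::real)))" for i
    by (rule linear_independent_extend[OF I(2)])
  then obtain l where l: "\<And>i. linear (l i)" "\<And>i x. x \<in> I \<Longrightarrow> l i x = (if x = i then 1 else (0::real))"
    by metis
  define d where "d = (\<lambda>i v. if v \<in> tangent_space M p then l i v else 0)"
  have d: "d i \<in> cotangent_space M p" for i
    using tangent_subspace[of p]
    by (auto simp: cotangent_space_def d_def subspace_add subspace_scale linear_add[OF l(1)] linear_cmul[OF l(1)])
  have di: "d i x = (if x = i then 1 else 0)" if "x \<in> I" for i x
    using that I(3) l(2) by (auto simp: d_def)
  have injd: "inj_on d I" by (rule inj_onI) (metis di zero_neq_one)
  let ?S = "(\<lambda>i. (i, 0)) ` I \<union> (\<lambda>i. (0, d i)) ` I"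
  have i0: "0 \<notin> I" using I(2) dependent_zero by blast
  have disj: "(\<lambda>i. (i, 0)) ` I \<inter> (\<lambda>i. (0, d i)) ` I = {}" using i0 by auto
  have inj1: "inj_on (\<lambda>i. (i, 0::'p ctvec)) I" and inj2: "inj_on (\<lambda>i. (0::'p tvec, d i)) I"
    using injd by (auto simp: inj_on_def)
  have card: "card ?S = 2 * card I"
    using card_Un_disjoint[OF finite_imageI finite_imageI disj] I(1) card_image[OF inj1] card_image[OF inj2]
    by simp
  have "independent ?S"
  proof -
    have "u w = 0" if u: "(\<Sum>w\<in>?S. u w *\<^sub>R w) = 0" and w: "w \<in> ?S" for u w
    proof -
      have "(\<Sum>w\<in>?S. u w *\<^sub>R w) = (\<Sum>i\<in>I. u (i, 0) *\<^sub>R (i, 0)) + (\<Sum>i\<in>I. u (0, d i) *\<^sub>R (0, d i))"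
        using I(1) disj by (simp add: sum.union_disjoint sum.reindex[OF inj1] sum.reindex[OF inj2])
      with u have eq: "(\<Sum>i\<in>I. u (i, 0) *\<^sub>R (i, 0::'p ctvec)) + (\<Sum>i\<in>I. u (0, d i) *\<^sub>R (0, d i)) = 0" by simp
      from arg_cong[OF eq, of fst] have "(\<Sum>i\<in>I. u (i, 0) *\<^sub>R i) = 0" by (simp add: fst_sum)
      moreover have "\<not> (\<exists>u. (\<exists>v\<in>I. u v \<noteq> 0) \<and> (\<Sum>v\<in>I. u v *\<^sub>R v) = 0)"
        using I(2) unfolding dependent_finite[OF I(1)] .
      from this[unfolded not_ex, rule_format, of "\<lambda>i. u (i, 0)"]
      have "\<not> ((\<exists>v\<in>I. u (v, 0) \<noteq> 0) \<and> (\<Sum>v\<in>I. u (v, 0) *\<^sub>R v) = 0)" .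
      ultimately have u1: "\<forall>i\<in>I. u (i, 0) = 0" by simp
      from arg_cong[OF eq, of snd] have eq2: "(\<Sum>i\<in>I. u (0, d i) *\<^sub>R d i) = 0" by (simp add: snd_sum)
      have "u (0, d j) = 0" if j: "j \<in> I" for j
      proof -
        have "(\<Sum>i\<in>I. u (0, d i) *\<^sub>R d i) j = (\<Sum>i\<in>I. if j = i then u (0, d i) else 0)"
          unfolding sum_fun_apply using di j by (intro sum.cong) auto
        then show ?thesis using eq2 I(1) j by simp
      qed
      with u1 w show ?thesis by auto
    qed
    then show ?thesis using I(1) by (subst dependent_finite) auto
  qed
  moreover have "?S \<subseteq> span (e ` {..<2 * n})"
    using e I(3) d subspace_0[OF tangent_subspace] subspace_0[OF cotangent_subspace]
    by (auto simp: is_basis_def)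
  ultimately have "card ?S \<le> card (e ` {..<2 * n})"
    using independent_span_bound[of "e ` {..<2 * n}"] by blast
  also have "\<dots> \<le> 2 * n" using card_image_le[of "{..<2 * n}" e] by simp
  finally show ?thesis using card by simp
qed

text \<open>Directional derivatives already form a space of dimension \<open>dim (model M)\<close>, the largest that the given
  basis of \<open>T\<^sub>pM \<times> T\<^sub>p\<^sup>*M\<close> allows for the space of all derivations.\<close>

lemma tangent_is_chart_vec:
  assumes e: "is_basis (2 * dim (model M)) e (tangent_space M p \<times> cotangent_space M p)"
    and c: "(U, \<phi>) \<in> atlas M" "p \<in> U" and v: "v \<in> tangent_space M p"
  shows "\<exists>u\<in>model M. v = chart_vec U \<phi> p u"
proof -
  obtain B where "finite B" "B \<subseteq> model M" "independent B" "span B = model M" "card B = dim (model M)"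
    "\<And>b c. b \<in> B \<Longrightarrow> c \<in> B \<Longrightarrow> b \<bullet> c = (if b = c then 1 else 0)"
    "\<And>x. x \<in> model M \<Longrightarrow> (\<Sum>b\<in>B. (x \<bullet> b) *\<^sub>R b) = x"
    by (rule subspace_orthonormal_expansion[OF model_subspace]) blast
  note B = this(1,2,5,6)
  let ?d = "chart_vec U \<phi> p"
  obtain N y where N: "openin (mtop M) N" "p \<in> N" "N \<subseteq> U"
    and y: "\<And>w. y w \<in> C_inf M" "\<And>q w. q \<in> N \<Longrightarrow> y w q = \<phi> q \<bullet> w"
    using coordinate_functions[OF c] by metis
  have coord: "?d u (y w) = u \<bullet> w" if "u \<in> model M" for u w
    by (rule chart_vec_coordinate[OF c(1) N y(1) y(2) that])
  have inj: "inj_on ?d B"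
  proof (rule inj_onI)
    fix b c assume bc: "b \<in> B" "c \<in> B" "?d b = ?d c"
    then have "b \<bullet> b = c \<bullet> b" using coord[of b b] coord[of c b] B(2) by (simp add: subset_iff)
    then have "(if c = b then 1 else 0) = (1::real)" using B(4)[OF bc(1,1)] B(4)[OF bc(2,1)] by simp
    then show "b = c" by (simp split: if_splits)
  qed
  have ind: "independent (?d ` B)"
  proof -
    have "u (?d a) = 0" if 0: "(\<Sum>v\<in>?d ` B. u v *\<^sub>R v) = 0" and a: "a \<in> B" for u a
    proof -
      have "?d (\<Sum>b\<in>B. u (?d b) *\<^sub>R b) = 0"
        using 0 by (simp add: sum.reindex[OF inj] chart_vec_linear[OF c B(1,2)])
      moreover have "(\<Sum>b\<in>B. u (?d b) *\<^sub>R b) \<in> model M"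
        using B(2) model_subspace by (auto intro!: subspace_sum subspace_scale)
      ultimately have "(\<Sum>b\<in>B. u (?d b) *\<^sub>R b) \<bullet> a = (0 :: 'p tvec) (y a)"
        using coord[of "\<Sum>b\<in>B. u (?d b) *\<^sub>R b" a] by (simp only:)
      then have "(\<Sum>b\<in>B. u (?d b) * (b \<bullet> a)) = 0" by (simp add: inner_sum_left)
      moreover have "(\<Sum>b\<in>B. u (?d b) * (b \<bullet> a)) = (\<Sum>b\<in>B. if b = a then u (?d b) else 0)"
        using B(4) a by (intro sum.cong) auto
      ultimately show ?thesis using B(1) a by simp
    qed
    then show ?thesis using B(1) by (subst dependent_finite) auto
  qed
  have "v \<in> span (?d ` B)"
  proof (rule ccontr)
    assume nv: "v \<notin> span (?d ` B)"
    then have "v \<notin> ?d ` B" by (metis span_base)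
    then have "card (insert v (?d ` B)) = dim (model M) + 1"
      using B(1,3) card_image[OF inj] by simp
    moreover have "card (insert v (?d ` B)) \<le> dim (model M)"
      using nv ind B v chart_vec_tangent[OF c]
      by (intro independent_tangent_bound[OF e]) (auto simp: independent_insert)
    ultimately show False by simp
  qed
  then obtain r where "v = (\<Sum>b\<in>B. r (?d b) *\<^sub>R ?d b)"
    using B(1) by (auto simp: span_finite sum.reindex[OF inj])
  then have "v = ?d (\<Sum>b\<in>B. r (?d b) *\<^sub>R b)" by (simp add: chart_vec_linear[OF c B(1,2)])
  moreover have "(\<Sum>b\<in>B. r (?d b) *\<^sub>R b) \<in> model M"
    using B(2) model_subspace by (auto intro!: subspace_sum subspace_scale)
  ultimately show ?thesis by blast
qed

lemma std_frameD:
  assumes "(U, e) \<in> frames (std_courant M)"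
  shows "openin (mtop M) U"
    and "p \<in> U \<Longrightarrow> is_basis (2 * dim (model M)) (\<lambda>i. e i p) (tangent_space M p \<times> cotangent_space M p)"
    and "i < 2 * dim (model M) \<Longrightarrow> smooth_vf_on M U (\<lambda>p. fst (e i p))"
    and "i < 2 * dim (model M) \<Longrightarrow> smooth_form_on M U (\<lambda>p. snd (e i p))"
  using assms by (auto simp: std_courant_def)

lemma std_frame_mem:
  assumes "(U, e) \<in> frames (std_courant M)" "p \<in> U" "i < 2 * dim (model M)"
  shows "fst (e i p) \<in> tangent_space M p" "snd (e i p) \<in> cotangent_space M p"
  using is_basis_mem[OF std_frameD(2)[OF assms(1,2)] assms(3)] by auto

lemma std_frame_span:
  assumes "(U, e) \<in> frames (std_courant M)" "p \<in> U" "v \<in> tangent_space M p"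
  obtains c where "v = (\<Sum>i<2 * dim (model M). c i *\<^sub>R fst (e i p))"
proof -
  have "(v, 0) \<in> tangent_space M p \<times> cotangent_space M p"
    using assms(3) subspace_0[OF cotangent_subspace] by auto
  then obtain c where "(v, 0) = (\<Sum>i<2 * dim (model M). c i *\<^sub>R e i p)"
    using is_basis_repr[OF std_frameD(2)[OF assms(1,2)]] by blast
  from arg_cong[OF this, of fst] show ?thesis using that[of c] by (simp add: fst_sum)
qed

lemma tangent_extends_to_vector_field:
  assumes e: "(U, e) \<in> frames (std_courant M)" "p \<in> U" and v: "v \<in> tangent_space M p"
  obtains Z where "Z \<in> vector_fields M" "Z p = v"
proof -
  obtain c where c: "v = (\<Sum>i<2 * dim (model M). c i *\<^sub>R fst (e i p))"
    using std_frame_span[OF e v] .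
  define Y where "Y = (\<lambda>q. \<Sum>i<2 * dim (model M). c i *\<^sub>R fst (e i q))"
  have "smooth_vf_on M U Y" unfolding smooth_vf_on_def
  proof (intro conjI ballI)
    fix q assume "q \<in> U"
    then show "Y q \<in> tangent_space M q"
      unfolding Y_def using std_frame_mem[OF e(1)] by (intro subspace_sum tangent_subspace subspace_scale) auto
  next
    fix f assume f: "f \<in> C_inf M"
    have "smooth_fun_on M U (\<lambda>q. \<Sum>i<2 * dim (model M). c i * fst (e i q) f)"
      using std_frameD(3)[OF e(1)] f
      by (intro smooth_fun_on_sum smooth_fun_on_mult smooth_fun_on_const) (auto simp: smooth_vf_on_def)
    then show "smooth_fun_on M U (\<lambda>q. Y q f)" by (simp add: Y_def sum_fun_apply)
  qed
  from extend_vector_field[OF std_frameD(1)[OF e(1)] e(2) this] obtain Z N where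
    "Z \<in> vector_fields M" "p \<in> N" "\<And>q. q \<in> N \<Longrightarrow> Z q = Y q" by metis
  then show ?thesis using that[of Z] c by (simp add: Y_def)
qed

text \<open>Smoothness of the coefficients of a pair (vector field, one-form) in a frame follows by pairing
  with the frame and solving the resulting linear system.\<close>

lemma std_section:
  assumes Y: "Y \<in> vector_fields M" and \<alpha>: "\<alpha> \<in> one_forms M"
  shows "(\<lambda>p. (Y p, \<alpha> p)) \<in> sections (std_courant M)"
proof -
  let ?n = "2 * dim (model M)"
  have \<alpha>T: "\<alpha> p \<in> cotangent_space M p" if "p \<in> pts M" for p
    using \<alpha> that by (simp add: one_forms_def smooth_form_on_def)
  have mem: "(Y p, \<alpha> p) \<in> tangent_space M p \<times> cotangent_space M p" if "p \<in> pts M" for p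
    using vector_fieldsD(1)[OF Y that] \<alpha>T[OF that] by blast
  have co: "\<exists>c. (\<forall>i<?n. smooth_fun_on M (pts M \<inter> U) (c i)) \<and>
      (\<forall>q\<in>pts M \<inter> U. (Y q, \<alpha> q) = (\<Sum>i<?n. c i q *\<^sub>R e i q))"
    if e: "(U, e) \<in> frames (std_courant M)" for U e
  proof -
    have oU: "openin (mtop M) U" by (rule std_frameD(1)[OF e])
    have Up: "U \<subseteq> pts M" using oU openin_subset by blast
    have "\<forall>q\<in>U. \<exists>c. (Y q, \<alpha> q) = (\<Sum>i<?n. c i *\<^sub>R e i q)"
    proof
      fix q assume q: "q \<in> U"
      then have "(Y q, \<alpha> q) \<in> tangent_space M q \<times> cotangent_space M q" using mem Up by blast
      then obtain c where "(Y q, \<alpha> q) = (\<Sum>i<?n. c i *\<^sub>R e i q)"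
        by (rule is_basis_repr[OF std_frameD(2)[OF e q]])
      then show "\<exists>c. (Y q, \<alpha> q) = (\<Sum>i<?n. c i *\<^sub>R e i q)" by (rule exI[of _ c])
    qed
    from bchoice[OF this] obtain c' where c': "\<forall>q\<in>U. (Y q, \<alpha> q) = (\<Sum>i<?n. c' q i *\<^sub>R e i q)"
      by (elim exE) (rule that)
    define c where "c = (\<lambda>i q. c' q i)"
    have c: "(Y q, \<alpha> q) = (\<Sum>i<?n. c i q *\<^sub>R e i q)" if "q \<in> U" for q
      unfolding c_def using bspec[OF c' that] .
    have sY: "smooth_vf_on M U Y"
      using Y Up smooth_fun_on_subset[OF _ Up] by (auto simp: vector_fields_def smooth_vf_on_def)
    have s\<alpha>: "smooth_form_on M U \<alpha>"
      using \<alpha> Up smooth_fun_on_subset[OF _ Up] by (auto simp: one_forms_def smooth_form_on_def)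
    have "smooth_at p (c i)" if p: "p \<in> U" and i: "i < ?n" for p i
    proof -
      have pp: "p \<in> pts M" using p Up by blast
      interpret local_function_ring "smooth_at p" "nhdsin (mtop M) p" p
        by (rule local_function_ring_smooth_at[OF pp])
      have at: "smooth_at p (\<lambda>q. \<beta> q (Z q))" if "smooth_form_on M U \<beta>" "smooth_vf_on M U Z" for \<beta> Z
        using smooth_form_apply[OF oU that] oU p unfolding smooth_at_def by blast
      have fst_eq: "Y q = (\<Sum>i<?n. c i q *\<^sub>R fst (e i q))" and snd_eq: "\<alpha> q = (\<Sum>i<?n. c i q *\<^sub>R snd (e i q))"
        if "q \<in> U" for q
        using arg_cong[OF c[OF that], of fst] arg_cong[OF c[OF that], of snd] by (simp_all add: fst_sum snd_sum)
      have "\<forall>i\<in>{..<?n}. smooth_at p (c i)"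
      proof (rule solve[where I="{..<?n}" and
            M="\<lambda>j i q. snd (e i q) (fst (e j q)) + snd (e j q) (fst (e i q))" and
            b="\<lambda>j q. \<alpha> q (fst (e j q)) + snd (e j q) (Y q)"])
        show "smooth_at p (\<lambda>q. snd (e i q) (fst (e j q)) + snd (e j q) (fst (e i q)))"
          if "j \<in> {..<?n}" "i \<in> {..<?n}" for i j
          using that by (intro add[OF at[OF std_frameD(4)[OF e] std_frameD(3)[OF e]]
            at[OF std_frameD(4)[OF e] std_frameD(3)[OF e]]]) simp_all
        show "smooth_at p (\<lambda>q. \<alpha> q (fst (e j q)) + snd (e j q) (Y q))" if "j \<in> {..<?n}" for j
          using that by (intro add[OF at[OF s\<alpha> std_frameD(3)[OF e]]
            at[OF std_frameD(4)[OF e] sY]]) simp_all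
        show "eventually (\<lambda>q. (\<Sum>i<?n. (snd (e i q) (fst (e j q)) + snd (e j q) (fst (e i q))) * c i q) =
            \<alpha> q (fst (e j q)) + snd (e j q) (Y q)) (nhdsin (mtop M) p)" if j: "j \<in> {..<?n}" for j
        proof -
          have "(\<Sum>i<?n. (snd (e i q) (fst (e j q)) + snd (e j q) (fst (e i q))) * c i q) =
              \<alpha> q (fst (e j q)) + snd (e j q) (Y q)" if q: "q \<in> U" for q
          proof -
            have "snd (e j q) (Y q) = (\<Sum>i<?n. c i q * snd (e j q) (fst (e i q)))"
              unfolding fst_eq[OF q] using std_frame_mem[OF e q] j by (intro cotangent_sum) auto
            then show ?thesis
              by (simp add: snd_eq[OF q] sum_fun_apply distrib_left sum.distrib mult.commute)
          qed
          then show ?thesis using oU p by (auto simp: eventually_nhdsin)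
        qed
        show "\<forall>i\<in>{..<?n}. z i = 0"
          if z: "\<forall>j\<in>{..<?n}. (\<Sum>i<?n. (snd (e i p) (fst (e j p)) + snd (e j p) (fst (e i p))) * z i) = 0" for z
        proof -
          define u where "u = (\<Sum>i<?n. z i *\<^sub>R fst (e i p))"
          define \<theta> where "\<theta> = (\<Sum>i<?n. z i *\<^sub>R snd (e i p))"
          have u: "u \<in> tangent_space M p" and \<theta>: "\<theta> \<in> cotangent_space M p"
            unfolding u_def \<theta>_def using std_frame_mem[OF e p]
            by (auto intro!: subspace_sum subspace_scale tangent_subspace cotangent_subspace)
          have z': "\<theta> (fst (e j p)) + snd (e j p) u = 0" if j: "j < ?n" for j
          proof -
            have "snd (e j p) u = (\<Sum>i<?n. z i * snd (e j p) (fst (e i p)))"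
              unfolding u_def using std_frame_mem[OF e p] j by (intro cotangent_sum) auto
            then show ?thesis using z j
              by (simp add: \<theta>_def sum_fun_apply distrib_left sum.distrib mult.commute)
          qed
          have pair: "\<theta> w + \<beta> u = 0" if w: "w \<in> tangent_space M p" and \<beta>: "\<beta> \<in> cotangent_space M p" for w \<beta>
          proof -
            obtain r where r: "(w, \<beta>) = (\<Sum>i<?n. r i *\<^sub>R e i p)"
              using is_basis_repr[OF std_frameD(2)[OF e p], of "(w, \<beta>)"] w \<beta> by blast
            have "w = (\<Sum>i<?n. r i *\<^sub>R fst (e i p))" "\<beta> = (\<Sum>i<?n. r i *\<^sub>R snd (e i p))"
              using arg_cong[OF r, of fst] arg_cong[OF r, of snd] by (simp_all add: fst_sum snd_sum)
            then have "\<theta> w + \<beta> u = (\<Sum>i<?n. r i * (\<theta> (fst (e i p)) + snd (e i p) u))"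
              using cotangent_sum[OF \<theta>, of "{..<?n}" "\<lambda>i. fst (e i p)" r] std_frame_mem[OF e p]
              by (simp add: sum_fun_apply distrib_left sum.distrib)
            then show ?thesis using z' by simp
          qed
          have "\<theta> w = 0" for w
            using pair[of w 0] subspace_0[OF cotangent_subspace] cotangentD(3)[OF \<theta>, of w]
            by (cases "w \<in> tangent_space M p") auto
          then have \<theta>0: "\<theta> = 0" by auto
          have "u f = 0" for f
          proof (cases "f \<in> C_inf M")
            case True
            have "dfun M f p u = 0"
              using pair[OF subspace_0[OF tangent_subspace] dfun_cotangent[OF True]] \<theta>0 by simp
            then show ?thesis using u by (simp add: dfun_def)
          qed (simp add: tangentD(4)[OF u])
          then have "u = 0" by auto
          then have "(\<Sum>i<?n. z i *\<^sub>R e i p) = 0"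
            using \<theta>0 by (simp add: prod_eq_iff fst_sum snd_sum u_def \<theta>_def)
          then show ?thesis using is_basis_independent[OF std_frameD(2)[OF e p]] by blast
        qed
      qed simp
      then show ?thesis using i by simp
    qed
    then have "\<forall>i<?n. smooth_fun_on M U (c i)" using smooth_fun_on_iff_at[OF oU] by blast
    then show ?thesis using c Up by (intro exI[of _ c]) (simp add: Int_absorb1)
  qed
  show ?thesis unfolding sections_def smooth_section_on_def
  proof (intro CollectI conjI allI impI ballI)
    fix q assume "q \<in> pts (base (std_courant M))"
    then show "(Y q, \<alpha> q) \<in> fibre (std_courant M) q" using mem by (simp add: std_courant_def)
  next
    fix x assume x: "x \<in> frames (std_courant M)"
    obtain U e where x': "x = (U, e)" by (cases x)
    show "case x of (U, e) \<Rightarrow> \<exists>c. (\<forall>i<rank (std_courant M). smooth_fun_on (base (std_courant M))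
         (pts (base (std_courant M)) \<inter> U) (c i)) \<and>
         (\<forall>q\<in>pts (base (std_courant M)) \<inter> U. (Y q, \<alpha> q) = (\<Sum>i<rank (std_courant M). c i q *\<^sub>R e i q))"
      using co[OF x[unfolded x']] by (simp add: x' std_courant_def)
  next
    fix p assume "p \<notin> pts (base (std_courant M))"
    then show "(Y p, \<alpha> p) = 0"
      using vector_fieldsD(2)[OF Y] \<alpha> by (simp add: std_courant_def one_forms_def zero_prod_def)
  qed
qed

lemma one_form_of_eq:
  assumes span: "\<And>p v. p \<in> pts M \<Longrightarrow> v \<in> tangent_space M p \<Longrightarrow> \<exists>Z\<in>vector_fields M. Z p = v"
    and \<beta>: "\<beta> \<in> one_forms M" "\<And>Z p. Z \<in> vector_fields M \<Longrightarrow> p \<in> pts M \<Longrightarrow> \<beta> p (Z p) = \<Phi> Z p"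
  shows "one_form_of M \<Phi> = \<beta>"
  unfolding one_form_of_def
proof (rule the_equality)
  show "\<beta> \<in> one_forms M \<and> (\<forall>Z\<in>vector_fields M. \<forall>p\<in>pts M. \<beta> p (Z p) = \<Phi> Z p)" using \<beta> by blast
  fix \<beta>' assume \<beta>': "\<beta>' \<in> one_forms M \<and> (\<forall>Z\<in>vector_fields M. \<forall>p\<in>pts M. \<beta>' p (Z p) = \<Phi> Z p)"
  have ct: "\<gamma> p \<in> cotangent_space M p" if "\<gamma> \<in> one_forms M" "p \<in> pts M" for \<gamma> p
    using that by (simp add: one_forms_def smooth_form_on_def)
  show "\<beta>' = \<beta>"
  proof (intro ext)
    fix p v
    consider "p \<notin> pts M" | "p \<in> pts M" "v \<notin> tangent_space M p" | "p \<in> pts M" "v \<in> tangent_space M p" by blast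
    then show "\<beta>' p v = \<beta> p v"
    proof cases
      case 1
      then show ?thesis using \<beta>(1) \<beta>' by (simp add: one_forms_def)
    next
      case 2
      then show ?thesis using cotangentD(3) ct \<beta>(1) \<beta>' by metis
    next
      case 3
      then obtain Z where "Z \<in> vector_fields M" "Z p = v" using span by blast
      then show ?thesis using \<beta>' \<beta>(2) 3(1) by metis
    qed
  qed
qed

text \<open>Only exact terms survive, because \<open>\<L>\<^sub>Y dg = d(Yg)\<close> and \<open>d df = 0\<close>. Both one-forms are
  characterised by their values on vector fields, which by \<open>span\<close> reach every tangent vector.\<close>

lemma std_bracket_exact:
  assumes span: "\<And>p v. p \<in> pts M \<Longrightarrow> v \<in> tangent_space M p \<Longrightarrow> \<exists>Z\<in>vector_fields M. Z p = v"
    and Y: "Y \<in> vector_fields M" and Z: "Z \<in> vector_fields M" and f: "f \<in> C_inf M" and g: "g \<in> C_inf M"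
  shows "bracket (std_courant M) (\<lambda>p. (Y p, exact_form f p)) (\<lambda>p. (Z p, exact_form g p)) p =
    (lie_bracket Y Z p, exact_form (\<lambda>q. Y q g) p)"
proof -
  have ap: "(\<lambda>q. exact_form f q (W q)) = (\<lambda>q. W q f)" if "W \<in> vector_fields M" for W f
    using vector_fieldsD(1,2)[OF that] by (auto simp: exact_form_def dfun_def fun_eq_iff)
  have br: "exact_form f p (lie_bracket W W' p) = lie_bracket W W' p f"
    if "W \<in> vector_fields M" "W' \<in> vector_fields M" "p \<in> pts M" for W W' f p
    using lie_bracket_tangent[OF that] that(3) by (simp add: exact_form_def dfun_def)
  have "lie_deriv M Y (exact_form g) = exact_form (\<lambda>q. Y q g)"
    unfolding lie_deriv_def
  proof (rule one_form_of_eq[OF span exact_form_one_form[OF vector_fieldsD(3)[OF Y g]]])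
    fix W p assume W: "W \<in> vector_fields M" and p: "p \<in> pts M"
    show "exact_form (\<lambda>q. Y q g) p (W p) = Y p (\<lambda>q. exact_form g q (W q)) - exact_form g p (lie_bracket Y W p)"
      using fun_cong[OF ap[OF W, of "\<lambda>q. Y q g"], of p] br[OF Y W p, of g]
      by (simp add: ap[OF W] lie_bracket_def)
  qed
  moreover have "contract_d M Z (exact_form f) = 0"
    unfolding contract_d_def
  proof (rule one_form_of_eq[OF span])
    have "exact_form 0 \<in> one_forms M" by (rule exact_form_one_form[OF C_inf_0])
    moreover have "exact_form 0 = 0"
      using tangent_0 by (auto simp: exact_form_def dfun_def fun_eq_iff)
    ultimately show "0 \<in> one_forms M" by simp
    fix W p assume W: "W \<in> vector_fields M" and p: "p \<in> pts M"
    show "0 p (W p) = ext_deriv (exact_form f) Z W p"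
      using br[OF Z W p, of f] by (simp add: ext_deriv_def ap[OF W] ap[OF Z] lie_bracket_def)
  qed
  ultimately show ?thesis by (simp add: std_courant_def comp_def)
qed

end

section \<open>Hamiltonian spaces\<close>

lemma vector_bundle_frame:
  assumes E: "vector_bundle E" and f: "(U, e) \<in> frames E"
  shows "openin (mtop (base E)) U" and "p \<in> U \<Longrightarrow> is_basis (rank E) (\<lambda>i. e i p) (fibre E p)"
proof -
  have "\<forall>(U, e)\<in>frames E. openin (mtop (base E)) U \<and>
       (\<forall>p\<in>U. is_basis (rank E) (\<lambda>i. e i p) (fibre E p)) \<and>
       (\<forall>i<rank E. smooth_section_on (base E) E U (e i))"
    using E[unfolded vector_bundle_def] by (elim conjE)
  from bspec[OF this f] have *: "openin (mtop (base E)) U \<and>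
       (\<forall>p\<in>U. is_basis (rank E) (\<lambda>i. e i p) (fibre E p))" by simp
  show "openin (mtop (base E)) U" using * by (elim conjE)
  show "is_basis (rank E) (\<lambda>i. e i p) (fibre E p)" if "p \<in> U" using * that by blast
qed

lemma vector_bundle_cover:
  assumes E: "vector_bundle E" and p: "p \<in> pts (base E)"
  obtains U e where "(U, e) \<in> frames E" "p \<in> U"
proof -
  have "(\<Union>(U, e)\<in>frames E. U) = pts (base E)" using E[unfolded vector_bundle_def] by (elim conjE)
  then have "p \<in> (\<Union>(U, e)\<in>frames E. U)" using p by simp
  then show ?thesis using that by (elim UN_E) (auto split: prod.splits)
qed

lemma section_coefficients:
  assumes \<sigma>: "smooth_section_on Q E W \<sigma>" and f: "(U, e) \<in> frames E"
  shows "\<exists>c. (\<forall>i<rank E. smooth_fun_on Q (W \<inter> U) (c i)) \<and>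
    (\<forall>q\<in>W \<inter> U. \<sigma> q = (\<Sum>i<rank E. c i q *\<^sub>R e i q))"
proof -
  have "\<forall>(U, e)\<in>frames E. \<exists>c. (\<forall>i<rank E. smooth_fun_on Q (W \<inter> U) (c i)) \<and>
    (\<forall>q\<in>W \<inter> U. \<sigma> q = (\<Sum>i<rank E. c i q *\<^sub>R e i q))"
    using \<sigma> unfolding smooth_section_on_def by (elim conjE)
  from bspec[OF this f] show ?thesis by (simp only: prod.case)
qed

lemma courant_pairing:
  assumes "courant_algebroid E"
  shows "\<forall>p\<in>pts (base E). \<forall>u\<in>fibre E p. \<forall>v\<in>fibre E p. pairing E p u v = pairing E p v u \<and>
       (\<forall>w\<in>fibre E p. pairing E p (u + v) w = pairing E p u w + pairing E p v w) \<and>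
       (\<forall>c. pairing E p (c *\<^sub>R u) v = c * pairing E p u v)"
  using assms[unfolded courant_algebroid_def] by (elim conjE)

lemma courant_nondegenerate:
  assumes "courant_algebroid E"
  shows "\<forall>p\<in>pts (base E). \<forall>u\<in>fibre E p. (\<forall>v\<in>fibre E p. pairing E p u v = 0) \<longrightarrow> u = 0"
  using assms[unfolded courant_algebroid_def] by (elim conjE)

lemma courant_bundle: "courant_algebroid E \<Longrightarrow> vector_bundle E"
  by (unfold courant_algebroid_def) (elim conjE)

locale hamiltonian =
  fixes D :: "('s, 'e::euclidean_space, 'v::real_vector) courant"
    and A :: "'s \<Rightarrow> 'v set"
    and X :: "('x, 'f::euclidean_space) mfd"
    and J :: "'x \<Rightarrow> 's"
    and E :: "('s \<times> 'x, 'e \<times> 'f, 'v \<times> ('x tvec \<times> 'x ctvec)) courant"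
    and F :: "'s \<times> 'x \<Rightarrow> ('v \<times> ('x tvec \<times> 'x ctvec)) set"
  assumes manin: "manin_pair D A" and ham: "hamiltonian_space D A X J E F"
begin

abbreviation "S \<equiv> base D"
abbreviation "n \<equiv> 2 * dim (model X)"

lemma courD: "courant_algebroid D" and dirA: "dirac_structure D A"
  using manin by (auto simp: manin_pair_def)

lemma bundleD: "vector_bundle D"
  by (rule courant_bundle[OF courD])

lemma S_mfd: "smooth_manifold S"
  using bundleD by (simp add: vector_bundle_def)

lemma X_mfd: "smooth_manifold X" and J_smooth: "smooth_map X S J"
  and productE: "is_product_courant D (std_courant X) E"
  and diracF: "generalized_dirac E (graph_mfd S X J) F"
  using ham by (auto simp: hamiltonian_space_def)

sublocale X: manifold X by standard (rule X_mfd)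
sublocale S: manifold "base D" by standard (rule S_mfd)

lemma J_in: "x \<in> pts X \<Longrightarrow> J x \<in> pts S"
proof -
  assume x: "x \<in> pts X"
  have "continuous_map (mtop X) (mtop S) J" using J_smooth by (simp add: smooth_map_def)
  from continuous_map_image_subset_topspace[OF this] show ?thesis using x by blast
qed

lemma E_eq: "E = prod_data D (std_courant X) (bracket E)" and courE: "courant_algebroid E"
  using productE unfolding is_product_courant_def by blast+

lemma base_E: "base E = prod_mfd S X"
  using arg_cong[OF E_eq, of base] by (simp add: prod_data_def std_courant_def)

lemma pts_E: "pts (base E) = pts S \<times> pts X"
  by (simp add: base_E prod_mfd_def)

lemma fibre_E: "fibre E (s, x) = fibre D s \<times> (tangent_space X x \<times> cotangent_space X x)"
  using fun_cong[OF arg_cong[OF E_eq, of fibre], of "(s, x)"] by (simp add: prod_data_def std_courant_def)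

lemma pairing_E: "pairing E (s, x) (d1, (v1, a1)) (d2, (v2, a2)) = pairing D s d1 d2 + (a1 v2 + a2 v1) / 2"
  using fun_cong[OF arg_cong[OF E_eq, of pairing], of "(s, x)"] by (simp add: prod_data_def std_courant_def)

lemma rank_E: "rank E = rank D + n"
  using arg_cong[OF E_eq, of rank] by (simp add: prod_data_def std_courant_def)

lemma frames_E: "frames E = {(U \<times> W, \<lambda>i (s, x). if i < rank D then (e i s, 0) else (0, e' (i - rank D) x))
                 | U e W e'. (U, e) \<in> frames D \<and> (W, e') \<in> frames (std_courant X)}"
  using arg_cong[OF E_eq, of frames] by (simp add: prod_data_def)

lemma frames_at:
  assumes "x \<in> pts X"
  obtains U e W e' where "(U, e) \<in> frames D" "(W, e') \<in> frames (std_courant X)" "J x \<in> U" "x \<in> W"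
    "(U \<times> W, \<lambda>i (s, x). if i < rank D then (e i s, 0) else (0, e' (i - rank D) x)) \<in> frames E"
proof -
  have "(J x, x) \<in> pts (base E)" using J_in assms by (simp add: pts_E)
  then obtain Z ee where Z: "(Z, ee) \<in> frames E" "(J x, x) \<in> Z"
    using vector_bundle_cover[OF courant_bundle[OF courE]] by metis
  then obtain U e W e' where
    eq: "(Z, ee) = (U \<times> W, \<lambda>i (s, x). if i < rank D then (e i s, 0) else (0, e' (i - rank D) x))"
    and fr: "(U, e) \<in> frames D" "(W, e') \<in> frames (std_courant X)"
    unfolding frames_E mem_Collect_eq by (elim exE conjE) (rule that)
  show ?thesis
  proof (rule that[OF fr])
    show "J x \<in> U" "x \<in> W" using Z(2) eq by simp_all
    show "(U \<times> W, \<lambda>i (s, x). if i < rank D then (e i s, 0) else (0, e' (i - rank D) x)) \<in> frames E"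
      using Z(1) unfolding eq .
  qed
qed

lemma frame_basis:
  assumes "(U, e) \<in> frames D" "s \<in> U"
  shows "is_basis (rank D) (\<lambda>i. e i s) (fibre D s)"
  using vector_bundle_frame(2)[OF bundleD assms] .

lemma frame_open:
  assumes "(U, e) \<in> frames D"
  shows "openin (mtop S) U"
  using vector_bundle_frame(1)[OF bundleD assms] .

lemma fibreE_basis:
  assumes "x \<in> pts X"
  obtains k b where "is_basis k b (fibre E (J x, x))"
proof -
  obtain U e W e' where "(U, e) \<in> frames D" "(W, e') \<in> frames (std_courant X)" "J x \<in> U" "x \<in> W"
    "(U \<times> W, \<lambda>i (s, x). if i < rank D then (e i s, 0) else (0, e' (i - rank D) x)) \<in> frames E"
    by (rule frames_at[OF assms])
  note fr = this(3-5)
  have "(J x, x) \<in> U \<times> W" using fr by blast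
  from vector_bundle_frame(2)[OF courant_bundle[OF courE] fr(3) this] show ?thesis by (rule that)
qed

lemma fibreE_subspace: "x \<in> pts X \<Longrightarrow> subspace (fibre E (J x, x))"
  using fibreE_basis is_basis_subspace by metis

lemma fibreD_subspace:
  assumes "s \<in> pts S"
  shows "subspace (fibre D s)"
proof -
  obtain U e where "(U, e) \<in> frames D" "s \<in> U" using vector_bundle_cover[OF bundleD assms] .
  then show ?thesis using frame_basis is_basis_subspace by blast
qed

lemma pairingE:
  assumes "x \<in> pts X"
  shows "u \<in> fibre E (J x, x) \<Longrightarrow> v \<in> fibre E (J x, x) \<Longrightarrow> w \<in> fibre E (J x, x) \<Longrightarrow>
      pairing E (J x, x) (u + v) w = pairing E (J x, x) u w + pairing E (J x, x) v w"
    and "u \<in> fibre E (J x, x) \<Longrightarrow> w \<in> fibre E (J x, x) \<Longrightarrow>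
      pairing E (J x, x) (c *\<^sub>R u) w = c * pairing E (J x, x) u w"
    and "u \<in> fibre E (J x, x) \<Longrightarrow> v \<in> fibre E (J x, x) \<Longrightarrow> pairing E (J x, x) u v = pairing E (J x, x) v u"
    and "u \<in> fibre E (J x, x) \<Longrightarrow> \<forall>v\<in>fibre E (J x, x). pairing E (J x, x) u v = 0 \<Longrightarrow> u = 0"
proof -
  have p: "(J x, x) \<in> pts (base E)" using assms J_in by (simp add: pts_E)
  note 1 = courant_pairing[OF courE] and 2 = courant_nondegenerate[OF courE]
  from 1 p show "u \<in> fibre E (J x, x) \<Longrightarrow> v \<in> fibre E (J x, x) \<Longrightarrow> w \<in> fibre E (J x, x) \<Longrightarrow>
      pairing E (J x, x) (u + v) w = pairing E (J x, x) u w + pairing E (J x, x) v w"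
    "u \<in> fibre E (J x, x) \<Longrightarrow> w \<in> fibre E (J x, x) \<Longrightarrow>
      pairing E (J x, x) (c *\<^sub>R u) w = c * pairing E (J x, x) u w"
    "u \<in> fibre E (J x, x) \<Longrightarrow> v \<in> fibre E (J x, x) \<Longrightarrow> pairing E (J x, x) u v = pairing E (J x, x) v u"
    by blast+
  from 2 p show "u \<in> fibre E (J x, x) \<Longrightarrow> \<forall>v\<in>fibre E (J x, x). pairing E (J x, x) u v = 0 \<Longrightarrow> u = 0"
    by blast
qed

lemma pairingD_0:
  assumes "s \<in> pts S" "u \<in> fibre D s"
  shows "pairing D s 0 u = 0"
proof -
  have "\<forall>p\<in>pts S. \<forall>u\<in>fibre D p. \<forall>v\<in>fibre D p. \<forall>c. pairing D p (c *\<^sub>R u) v = c * pairing D p u v"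
    using courant_pairing[OF courD] by blast
  then have "pairing D s (0 *\<^sub>R u) u = 0 * pairing D s u u" using assms by blast
  then show ?thesis by simp
qed

lemma pts_graph: "pts (graph_mfd S X J) = (\<lambda>x. (J x, x)) ` pts X"
  using J_in by (auto simp: graph_mfd_def)

lemma F_lagrangian:
  assumes "x \<in> pts X"
  shows "F (J x, x) = {u \<in> fibre E (J x, x). \<forall>v\<in>F (J x, x). pairing E (J x, x) u v = 0}"
proof -
  have "(J x, x) \<in> pts (graph_mfd S X J)" using assms by (auto simp: pts_graph)
  moreover have "lagrangian E (pts (graph_mfd S X J)) F" using diracF by (simp add: generalized_dirac_def)
  ultimately show ?thesis unfolding lagrangian_def by blast
qed

lemma F_fibre: "x \<in> pts X \<Longrightarrow> u \<in> F (J x, x) \<Longrightarrow> u \<in> fibre E (J x, x)"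
  using F_lagrangian by blast

lemma F_isotropic: "x \<in> pts X \<Longrightarrow> u \<in> F (J x, x) \<Longrightarrow> v \<in> F (J x, x) \<Longrightarrow> pairing E (J x, x) u v = 0"
  using F_lagrangian by blast

lemma F_subspace:
  assumes x: "x \<in> pts X"
  shows "subspace (F (J x, x))"
proof (rule subspaceI)
  note sub = fibreE_subspace[OF x]
  have memI: "u \<in> F (J x, x)"
    if "u \<in> fibre E (J x, x)" "\<And>v. v \<in> F (J x, x) \<Longrightarrow> pairing E (J x, x) u v = 0" for u
    using F_lagrangian[OF x] that by blast
  show "0 \<in> F (J x, x)"
  proof (rule memI[OF subspace_0[OF sub]])
    fix v assume "v \<in> F (J x, x)"
    then have "pairing E (J x, x) (0 *\<^sub>R v) v = 0 * pairing E (J x, x) v v"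
      using F_fibre[OF x] by (intro pairingE(2)[OF x])
    then show "pairing E (J x, x) 0 v = 0" by simp
  qed
  show "u + v \<in> F (J x, x)" if "u \<in> F (J x, x)" "v \<in> F (J x, x)" for u v
    using that F_fibre[OF x] F_isotropic[OF x]
    by (intro memI subspace_add[OF sub]) (simp_all add: pairingE(1)[OF x])
  show "c *\<^sub>R u \<in> F (J x, x)" if "u \<in> F (J x, x)" for u c
    using that F_fibre[OF x] F_isotropic[OF x]
    by (intro memI subspace_scale[OF sub]) (simp_all add: pairingE(2)[OF x])
qed

lemma F_tangent_trivial:
  assumes x: "x \<in> pts X" and u: "(0, (v, 0)) \<in> F (J x, x)"
  shows "v = 0"
proof -
  have v: "v \<in> tangent_space X x" using F_fibre[OF x u] by (simp add: fibre_E)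
  have "F (J x, x) \<inter> {0} \<times> (tangent_space X x \<times> {0}) = {0}"
    using ham x by (simp add: hamiltonian_space_def)
  moreover have "(0, (v, 0)) \<in> F (J x, x) \<inter> {0} \<times> (tangent_space X x \<times> {0})" using u v by blast
  ultimately show ?thesis by (metis Pair_inject singletonD zero_prod_def)
qed

lemma F_tangent_unique:
  assumes x: "x \<in> pts X" and "(d, (v, a)) \<in> F (J x, x)" "(d, (w, a)) \<in> F (J x, x)"
  shows "v = w"
proof -
  have "(d, (v, a)) - (d, (w, a)) \<in> F (J x, x)" using assms F_subspace subspace_diff by blast
  then have "v - w = 0" using F_tangent_trivial[OF x, of "v - w"] by simp
  then show ?thesis by simp
qed

lemma F_action:
  assumes x: "x \<in> pts X"
  shows "d \<in> A (J x) \<longleftrightarrow> (\<exists>v. (d, (v, 0)) \<in> F (J x, x))"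
proof -
  have "fst ` (F (J x, x) \<inter> fibre D (J x) \<times> (tangent_space X x \<times> {0})) = A (J x)"
    using ham x by (simp add: hamiltonian_space_def)
  moreover have "d \<in> fst ` (F (J x, x) \<inter> fibre D (J x) \<times> (tangent_space X x \<times> {0})) \<longleftrightarrow>
      (\<exists>v. (d, (v, 0)) \<in> F (J x, x))"
    using F_fibre[OF x] by (force simp: fibre_E image_iff)
  ultimately show ?thesis by simp
qed

text \<open>A frame of \<open>E\<close> at \<open>(J x, x)\<close> is a product one of whose factors is a frame of \<open>TX \<oplus> T\<^sup>*X\<close> at \<open>x\<close>, as
  needed for the dimension count.\<close>

lemma X_charts: "(U, \<phi>) \<in> atlas X \<Longrightarrow> q \<in> U \<Longrightarrow> v \<in> tangent_space X q \<Longrightarrow>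
      \<exists>u\<in>model X. v = X.chart_vec U \<phi> q u"
proof -
  assume c: "(U, \<phi>) \<in> atlas X" "q \<in> U" and v: "v \<in> tangent_space X q"
  have "q \<in> pts X" using c X.chart_subset by blast
  then obtain W e where "(W, e) \<in> frames (std_courant X)" "q \<in> W" by (rule frames_at)
  from X.tangent_is_chart_vec[OF X.std_frameD(2)[OF this] c v] show ?thesis .
qed

lemma X_span: "x \<in> pts X \<Longrightarrow> v \<in> tangent_space X x \<Longrightarrow> \<exists>Z\<in>vector_fields X. Z x = v"
proof -
  assume x: "x \<in> pts X" and v: "v \<in> tangent_space X x"
  obtain W e where "(W, e) \<in> frames (std_courant X)" "x \<in> W" using x by (rule frames_at)
  from X.tangent_extends_to_vector_field[OF this v] show ?thesis by blast
qed

text \<open>The coefficients of \<open>(a, (v, \<alpha>))\<close> in a local frame of \<open>F\<close> are determined by \<open>a\<close> and \<open>\<alpha>\<close> alone, through a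
  linear system that \<open>F \<inter> TX = 0\<close> makes injective; hence they are smooth, and so is \<open>v\<close>.\<close>

lemma lift_smooth:
  assumes a: "a \<in> sections D" and \<alpha>: "\<alpha> \<in> one_forms X"
    and v: "\<And>x. x \<in> pts X \<Longrightarrow> (a (J x), (v x, \<alpha> x)) \<in> F (J x, x)"
  shows "smooth_vf_on X (pts X) v"
  unfolding smooth_vf_on_def
proof (intro conjI ballI)
  fix x assume x: "x \<in> pts X"
  show "v x \<in> tangent_space X x" using F_fibre[OF x v[OF x]] by (simp add: fibre_E)
next
  fix f assume f: "f \<in> C_inf X"
  let ?Q = "graph_mfd S X J"
  have "X.smooth_at x0 (\<lambda>x. v x f)" if x0: "x0 \<in> pts X" for x0
  proof -
    interpret local_function_ring "X.smooth_at x0" "nhdsin (mtop X) x0" x0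
      by (rule X.local_function_ring_smooth_at[OF x0])
    let ?r = "rank D"
    have "(J x0, x0) \<in> pts ?Q" using x0 by (auto simp: pts_graph)
    moreover have "smooth_subbundle ?Q E F" using diracF by (simp add: generalized_dirac_def)
    ultimately have "\<exists>U k \<sigma>. openin (mtop ?Q) U \<and> (J x0, x0) \<in> U \<and>
      (\<forall>i<k. smooth_section_on ?Q E U (\<sigma> i)) \<and> (\<forall>p\<in>U. is_basis k (\<lambda>i. \<sigma> i p) (F p))"
      unfolding smooth_subbundle_def by (rule bspec[rotated])
    then obtain U k \<sigma> where U: "openin (mtop ?Q) U" "(J x0, x0) \<in> U"
      and \<sigma>: "\<forall>i<k. smooth_section_on ?Q E U (\<sigma> i)" "\<forall>p\<in>U. is_basis k (\<lambda>i. \<sigma> i p) (F p)"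
      by (elim exE conjE) (rule that)
    obtain U1 e1 U2 e2 where fr: "(U1, e1) \<in> frames D" "(U2, e2) \<in> frames (std_courant X)" "J x0 \<in> U1" "x0 \<in> U2"
      "(U1 \<times> U2, \<lambda>i (s, x). if i < ?r then (e1 i s, 0) else (0, e2 (i - ?r) x)) \<in> frames E"
      by (rule frames_at[OF x0])
    define ee where "ee = (\<lambda>i (s, x). if i < ?r then (e1 i s, 0) else (0, e2 (i - ?r) x))"
    define W where "W = {x \<in> pts X. (J x, x) \<in> U \<and> J x \<in> U1 \<and> x \<in> U2}"
    have Wp: "W \<subseteq> pts X" by (auto simp: W_def)
    have x0W: "x0 \<in> W" using x0 U(2) fr by (simp add: W_def)
    have contJ: "continuous_map (mtop X) (mtop S) J" using J_smooth by (simp add: smooth_map_def)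
    have oW: "openin (mtop X) W"
    proof -
      obtain O1 where O1: "openin (prod_topology (mtop S) (mtop X)) O1" "U = O1 \<inter> (\<lambda>x. (J x, x)) ` pts X"
        using U(1) by (auto simp: graph_mfd_def openin_subtopology)
      have "continuous_map (mtop X) (prod_topology (mtop S) (mtop X)) (\<lambda>x. (J x, x))"
        using contJ by (intro continuous_map_pairedI) auto
      then have "openin (mtop X) {x \<in> pts X. (J x, x) \<in> O1}" using O1(1) by (rule openin_continuous_map_preimage)
      moreover have "openin (mtop X) {x \<in> pts X. J x \<in> U1}"
        using contJ frame_open[OF fr(1)] by (rule openin_continuous_map_preimage)
      moreover have "openin (mtop X) U2" by (rule X.std_frameD(1)[OF fr(2)])
      ultimately have "openin (mtop X) ({x \<in> pts X. (J x, x) \<in> O1} \<inter> {x \<in> pts X. J x \<in> U1} \<inter> U2)" by blast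
      moreover have "W = {x \<in> pts X. (J x, x) \<in> O1} \<inter> {x \<in> pts X. J x \<in> U1} \<inter> U2"
        by (auto simp: W_def O1(2))
      ultimately show ?thesis by simp
    qed
    have ev: "eventually P (nhdsin (mtop X) x0)" if "\<And>x. x \<in> W \<Longrightarrow> P x" for P
      unfolding eventually_nhdsin using oW x0W that by blast
    have at: "X.smooth_at x0 g" if "smooth_fun_on X W g" for g
      using that oW x0W unfolding X.smooth_at_def by blast

    have "\<forall>i\<in>{..<k}. \<exists>c. (\<forall>l<rank E. smooth_fun_on ?Q (U \<inter> U1 \<times> U2) (c l)) \<and>
        (\<forall>q\<in>U \<inter> U1 \<times> U2. \<sigma> i q = (\<Sum>l<rank E. c l q *\<^sub>R ee l q))"
    proof
      fix i assume "i \<in> {..<k}"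
      then have "smooth_section_on ?Q E U (\<sigma> i)" using \<sigma>(1) by simp
      from section_coefficients[OF this fr(5)] show "\<exists>c. (\<forall>l<rank E. smooth_fun_on ?Q (U \<inter> U1 \<times> U2) (c l)) \<and>
        (\<forall>q\<in>U \<inter> U1 \<times> U2. \<sigma> i q = (\<Sum>l<rank E. c l q *\<^sub>R ee l q))"
        unfolding ee_def .
    qed
    from bchoice[OF this] obtain cc where
      cc0: "\<forall>i\<in>{..<k}. (\<forall>l<rank E. smooth_fun_on ?Q (U \<inter> U1 \<times> U2) (cc i l)) \<and>
        (\<forall>q\<in>U \<inter> U1 \<times> U2. \<sigma> i q = (\<Sum>l<rank E. cc i l q *\<^sub>R ee l q))"
      by (elim exE) (rule that)
    have cc: "smooth_fun_on ?Q (U \<inter> U1 \<times> U2) (cc i l)" if "i < k" "l < rank E" for i l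
      using bspec[OF cc0, of i] that by simp
    have cc2: "\<sigma> i q = (\<Sum>l<rank E. cc i l q *\<^sub>R ee l q)" if "i < k" "q \<in> U \<inter> U1 \<times> U2" for i q
      using conjunct2[OF bspec[OF cc0], of i] that by blast
    define C where "C = (\<lambda>i l x. cc i l (J x, x))"
    have C: "smooth_fun_on X W (C i l)" if "i < k" "l < ?r + n" for i l
      unfolding C_def
      by (rule X.smooth_fun_on_subset[OF smooth_fun_on_graph[OF X_mfd cc]])
        (use that in \<open>auto simp: rank_E W_def\<close>)
    have \<sigma>x: "\<sigma> i (J x, x) = ((\<Sum>j<?r. C i j x *\<^sub>R e1 j (J x)),
        ((\<Sum>l<n. C i (?r + l) x *\<^sub>R fst (e2 l x)), (\<Sum>l<n. C i (?r + l) x *\<^sub>R snd (e2 l x))))"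
      if "i < k" "x \<in> W" for i x
    proof -
      have "(J x, x) \<in> U \<inter> U1 \<times> U2" using that(2) by (simp add: W_def)
      then have "\<sigma> i (J x, x) = (\<Sum>l<?r + n. C i l x *\<^sub>R ee l (J x, x))"
        using cc2[OF that(1)] by (simp add: rank_E C_def)
      also have "\<dots> = (\<Sum>l<?r. C i l x *\<^sub>R (e1 l (J x), 0)) + (\<Sum>l<n. C i (?r + l) x *\<^sub>R (0, e2 l x))"
        unfolding sum_lessThan_add by (simp add: ee_def)
      finally show ?thesis by (simp add: prod_eq_iff fst_sum snd_sum)
    qed

    have "\<forall>x\<in>W. \<exists>b. (a (J x), (v x, \<alpha> x)) = (\<Sum>i<k. b i *\<^sub>R \<sigma> i (J x, x))"
    proof
      fix x assume x: "x \<in> W"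
      then have "is_basis k (\<lambda>i. \<sigma> i (J x, x)) (F (J x, x))" using \<sigma>(2) by (simp add: W_def)
      then obtain b where "(a (J x), (v x, \<alpha> x)) = (\<Sum>i<k. b i *\<^sub>R \<sigma> i (J x, x))"
        by (rule is_basis_repr[OF _ v]) (use x Wp in blast)
      then show "\<exists>b. (a (J x), (v x, \<alpha> x)) = (\<Sum>i<k. b i *\<^sub>R \<sigma> i (J x, x))" by (rule exI[of _ b])
    qed
    from bchoice[OF this] obtain b' where
      b': "\<forall>x\<in>W. (a (J x), (v x, \<alpha> x)) = (\<Sum>i<k. b' x i *\<^sub>R \<sigma> i (J x, x))"
      by (elim exE) (rule that)
    define b where "b = (\<lambda>i x. b' x i)"
    have b: "a (J x) = (\<Sum>i<k. b i x *\<^sub>R fst (\<sigma> i (J x, x)))" "v x = (\<Sum>i<k. b i x *\<^sub>R fst (snd (\<sigma> i (J x, x))))"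
      "\<alpha> x = (\<Sum>i<k. b i x *\<^sub>R snd (snd (\<sigma> i (J x, x))))" if "x \<in> W" for x
    proof -
      have eq: "(a (J x), (v x, \<alpha> x)) = (\<Sum>i<k. b i x *\<^sub>R \<sigma> i (J x, x))" using bspec[OF b' that] by (simp add: b_def)
      from arg_cong[OF eq, of fst] arg_cong[OF eq, of "\<lambda>w. fst (snd w)"] arg_cong[OF eq, of "\<lambda>w. snd (snd w)"]
      show "a (J x) = (\<Sum>i<k. b i x *\<^sub>R fst (\<sigma> i (J x, x)))" "v x = (\<Sum>i<k. b i x *\<^sub>R fst (snd (\<sigma> i (J x, x))))"
        "\<alpha> x = (\<Sum>i<k. b i x *\<^sub>R snd (snd (\<sigma> i (J x, x))))"
        by (simp_all add: fst_sum snd_sum)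
    qed
    have \<sigma>1: "fst (\<sigma> i (J x, x)) = (\<Sum>j<?r. C i j x *\<^sub>R e1 j (J x))"
      "fst (snd (\<sigma> i (J x, x))) = (\<Sum>l<n. C i (?r + l) x *\<^sub>R fst (e2 l x))"
      "snd (snd (\<sigma> i (J x, x))) = (\<Sum>l<n. C i (?r + l) x *\<^sub>R snd (e2 l x))" if "i < k" "x \<in> W" for i x
      using \<sigma>x[OF that] by simp_all
    have swap: "(\<Sum>i<k. y i *\<^sub>R fst (\<sigma> i (J x, x))) = (\<Sum>j<?r. (\<Sum>i<k. C i j x * y i) *\<^sub>R e1 j (J x))"
      if "x \<in> W" for x y
    proof -
      have "(\<Sum>i<k. y i *\<^sub>R fst (\<sigma> i (J x, x))) = (\<Sum>i<k. \<Sum>j<?r. (C i j x * y i) *\<^sub>R e1 j (J x))"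
        using that \<sigma>1(1) by (simp add: scaleR_sum_right mult.commute)
      also have "\<dots> = (\<Sum>j<?r. \<Sum>i<k. (C i j x * y i) *\<^sub>R e1 j (J x))" by (rule sum.swap)
      finally show ?thesis by (simp add: scaleR_sum_left)
    qed

    \<comment> \<open>Unknowns \<open>b i\<close>; the first \<open>rank D\<close> equations are the components in \<open>D\<close>, the others pair the
      cotangent component with a spanning family of vector fields.\<close>
    define Y where "Y = (\<lambda>m x. fst (e2 m x))"
    define \<beta> where "\<beta> = (\<lambda>m x. snd (e2 m x))"
    define M where "M = (\<lambda>m i x. if m < ?r then C i m x else (\<Sum>l<n. C i (?r + l) x * \<beta> l x (Y (m - ?r) x)))"
    obtain ac where ac: "\<And>j. j < ?r \<Longrightarrow> smooth_fun_on S (pts S \<inter> U1) (ac j)"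
      "\<And>s. s \<in> pts S \<inter> U1 \<Longrightarrow> a s = (\<Sum>j<?r. ac j s *\<^sub>R e1 j s)"
    proof -
      have "smooth_section_on S D (pts S) a" using a by (simp add: sections_def)
      from section_coefficients[OF this fr(1)] show ?thesis using that by blast
    qed
    define rhs where "rhs = (\<lambda>m x. if m < ?r then ac m (J x) else \<alpha> x (Y (m - ?r) x))"
    have U2W: "smooth_fun_on X W g" if "smooth_fun_on X U2 g" for g
      using that by (rule X.smooth_fun_on_subset) (auto simp: W_def)
    have \<beta>Y: "smooth_fun_on X W (\<lambda>x. \<beta> l x (Y m x))" if "l < n" "m < n" for l m
      unfolding \<beta>_def Y_def
      by (rule U2W[OF X.smooth_form_apply[OF X.std_frameD(1)[OF fr(2)] X.std_frameD(4)[OF fr(2) that(1)]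
        X.std_frameD(3)[OF fr(2) that(2)]]])
    have YT: "Y m x \<in> tangent_space X x" "\<beta> m x \<in> cotangent_space X x" if "m < n" "x \<in> W" for m x
      unfolding Y_def \<beta>_def using X.std_frame_mem[OF fr(2) _ that(1)] that(2) by (auto simp: W_def)
    have "\<forall>i\<in>{..<k}. X.smooth_at x0 (b i)"
    proof (rule solve[where I="{..<?r + n}" and M=M and b=rhs])
      show "X.smooth_at x0 (M m i)" if m: "m \<in> {..<?r + n}" and i: "i \<in> {..<k}" for m i
      proof (cases "m < ?r")
        case True
        then show ?thesis using at[OF C[of i m]] i by (simp add: M_def)
      next
        case False
        then have "smooth_fun_on X W (\<lambda>x. \<Sum>l<n. C i (?r + l) x * \<beta> l x (Y (m - ?r) x))"
          using C i m \<beta>Y by (intro X.smooth_fun_on_sum X.smooth_fun_on_mult) auto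
        with False show ?thesis using at by (simp add: M_def)
      qed
      show "X.smooth_at x0 (rhs m)" if m: "m \<in> {..<?r + n}" for m
      proof (cases "m < ?r")
        case True
        have "S.smooth_at (J x0) (ac m)"
          using ac(1)[OF True] J_in[OF x0] fr(3) frame_open[OF fr(1)] unfolding S.smooth_at_def by blast
        from smooth_map_compose_at[OF X_mfd S_mfd J_smooth x0 this] show ?thesis using True by (simp add: rhs_def)
      next
        case False
        then have mn: "m - ?r < n" using m by auto
        have "smooth_form_on X U2 \<alpha>"
          using \<alpha> openin_subset[OF X.std_frameD(1)[OF fr(2)]] X.smooth_fun_on_subset
          unfolding one_forms_def smooth_form_on_def by blast
        from U2W[OF X.smooth_form_apply[OF X.std_frameD(1)[OF fr(2)] this X.std_frameD(3)[OF fr(2) mn]]]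
        show ?thesis using False at by (simp add: rhs_def Y_def)
      qed
      show "eventually (\<lambda>x. (\<Sum>i<k. M m i x * b i x) = rhs m x) (nhdsin (mtop X) x0)"
        if m: "m \<in> {..<?r + n}" for m
      proof (rule ev)
        fix x assume x: "x \<in> W"
        show "(\<Sum>i<k. M m i x * b i x) = rhs m x"
        proof (cases "m < ?r")
          case True
          have JU: "J x \<in> pts S \<inter> U1" using x J_in by (simp add: W_def)
          have "(\<Sum>j<?r. (\<Sum>i<k. C i j x * b i x) *\<^sub>R e1 j (J x)) = (\<Sum>j<?r. ac j (J x) *\<^sub>R e1 j (J x))"
            using b(1)[OF x] ac(2)[OF JU] swap[OF x, of "\<lambda>i. b i x"] by simp
          from is_basis_unique[OF frame_basis[OF fr(1)] this True] JU True
          show ?thesis by (simp add: M_def rhs_def)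
        next
          case False
          then show ?thesis using x \<sigma>1(3)
            by (simp add: M_def rhs_def b(3)[OF x] sum_fun_apply \<beta>_def mult.commute)
        qed
      qed
      show "\<forall>i\<in>{..<k}. z i = 0" if z: "\<forall>m\<in>{..<?r + n}. (\<Sum>i<k. M m i x0 * z i) = 0" for z
      proof -
        let ?w = "\<Sum>i<k. z i *\<^sub>R \<sigma> i (J x0, x0)"
        have bas: "is_basis k (\<lambda>i. \<sigma> i (J x0, x0)) (F (J x0, x0))" using \<sigma>(2) U(2) by blast
        have wF: "?w \<in> F (J x0, x0)"
          using is_basis_mem[OF bas] by (intro subspace_sum subspace_scale F_subspace[OF x0]) auto
        have fw: "fst ?w = 0"
        proof -
          have "fst ?w = (\<Sum>j<?r. (\<Sum>i<k. C i j x0 * z i) *\<^sub>R e1 j (J x0))"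
            using swap[OF x0W, of z] by (simp add: fst_sum)
          also have "\<dots> = 0"
          proof (rule sum.neutral, rule ballI)
            fix j assume "j \<in> {..<?r}"
            then have "(\<Sum>i<k. C i j x0 * z i) = 0" using bspec[OF z, of j] by (simp add: M_def)
            then show "(\<Sum>i<k. C i j x0 * z i) *\<^sub>R e1 j (J x0) = 0" by simp
          qed
          finally show ?thesis .
        qed
        define \<theta> where "\<theta> = snd (snd ?w)"
        have \<theta>T: "\<theta> \<in> cotangent_space X x0"
          using F_fibre[OF x0 wF] by (auto simp: fibre_E \<theta>_def)
        have \<theta>Y: "\<theta> (Y m x0) = 0" if m: "m < n" for m
        proof -
          have "\<theta> = (\<Sum>i<k. z i *\<^sub>R (\<Sum>l<n. C i (?r + l) x0 *\<^sub>R \<beta> l x0))"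
            using \<sigma>1(3)[OF _ x0W] by (simp add: \<theta>_def snd_sum \<beta>_def)
          then have "\<theta> (Y m x0) = (\<Sum>i<k. M (?r + m) i x0 * z i)"
            by (simp add: sum_fun_apply M_def mult.commute)
          then show ?thesis using bspec[OF z, of "?r + m"] m by simp
        qed
        have "\<theta> u = 0" for u
        proof (cases "u \<in> tangent_space X x0")
          case True
          obtain r where "u = (\<Sum>i<n. r i *\<^sub>R fst (e2 i x0))"
            using X.std_frame_span[OF fr(2,4) True] by blast
          then have "\<theta> u = (\<Sum>i<n. r i * \<theta> (Y i x0))"
            using X.cotangent_sum[OF \<theta>T, of "{..<n}" "\<lambda>i. Y i x0" r] YT(1)[OF _ x0W] by (simp add: Y_def)
          then show ?thesis using \<theta>Y by simp
        next
          case False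
          then show ?thesis using X.cotangentD(3)[OF \<theta>T] by blast
        qed
        then have "\<theta> = 0" by auto
        then have w: "?w = (0, (fst (snd ?w), 0))" using fw by (simp add: prod_eq_iff \<theta>_def)
        have "fst (snd ?w) = 0" by (rule F_tangent_trivial[OF x0]) (use w wF in argo)
        then have "?w = 0" using w by (simp add: prod_eq_iff)
        then show ?thesis using is_basis_independent[OF bas] by blast
      qed
    qed simp
    moreover have "X.smooth_at x0 (\<lambda>x. \<Sum>l<n. C i (?r + l) x * Y l x f)" if i: "i < k" for i
    proof (rule at, intro X.smooth_fun_on_sum X.smooth_fun_on_mult)
      fix l assume l: "l \<in> {..<n}"
      show "smooth_fun_on X W (C i (?r + l))" using C i l by auto
      show "smooth_fun_on X W (\<lambda>x. Y l x f)"
        using U2W X.std_frameD(3)[OF fr(2), of l] l f by (simp add: smooth_vf_on_def Y_def)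
    qed
    ultimately have "X.smooth_at x0 (\<lambda>x. \<Sum>i<k. b i x * (\<Sum>l<n. C i (?r + l) x * Y l x f))"
      by - (rule sum, rule mult, auto)
    moreover have "(\<Sum>i<k. b i x * (\<Sum>l<n. C i (?r + l) x * Y l x f)) = v x f" if "x \<in> W" for x
      using that \<sigma>1(2) by (simp add: b(2)[OF that] sum_fun_apply Y_def)
    ultimately show ?thesis by (rule X.smooth_at_cong[OF _ oW x0W])
  qed
  then show "smooth_fun_on X (pts X) (\<lambda>p. v p f)" by (simp add: X.smooth_fun_on_iff_at)
qed

end

section \<open>Orbits of the action\<close>

text \<open>Initial pieces of integral curves and reversed integral curves arise as the cases \<open>p = 0\<close> and
  \<open>p = 1, q = -1\<close>.\<close>

lemma integral_curve_affine:
  assumes \<gamma>: "integral_curve M Y \<gamma>" and I: "\<And>t. t \<in> {0..1} \<Longrightarrow> p + q * t \<in> {0..1}"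
  shows "integral_curve M (\<lambda>x. q *\<^sub>R Y x) (\<lambda>t. \<gamma> (p + q * t))"
  unfolding integral_curve_def
proof (intro conjI ballI)
  have "continuous_on {0..1} (\<lambda>t. p + q * t)" by (intro continuous_intros)
  moreover have "(\<lambda>t. p + q * t) ` {0..1} \<subseteq> {0..1}" using I by blast
  ultimately have "continuous_map (top_of_set {0..1}) (top_of_set {0..1}) (\<lambda>t. p + q * t)"
    by (simp add: continuous_map_in_subtopology image_subset_iff_funcset)
  moreover have "continuous_map (top_of_set {0..1}) (mtop M) \<gamma>" using \<gamma> by (simp add: integral_curve_def)
  ultimately have "continuous_map (top_of_set {0..1}) (mtop M) (\<gamma> \<circ> (\<lambda>t. p + q * t))"
    by (rule continuous_map_compose)
  then show "continuous_map (top_of_set {0..1}) (mtop M) (\<lambda>t. \<gamma> (p + q * t))" by (simp add: comp_def)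
next
  fix t f assume t: "t \<in> {0..1::real}" and f: "f \<in> C_inf M"
  have "((\<lambda>s. f (\<gamma> s)) has_real_derivative Y (\<gamma> (p + q * t)) f) (at (p + q * t) within {0..1})"
    using \<gamma> I[OF t] f unfolding integral_curve_def by blast
  then have 1: "((\<lambda>s. f (\<gamma> s)) has_real_derivative Y (\<gamma> (p + q * t)) f)
      (at (p + q * t) within (\<lambda>t. p + q * t) ` {0..1})"
    by (rule DERIV_subset) (use I in blast)
  have 2: "((\<lambda>t. p + q * t) has_real_derivative q) (at t within {0..1})"
    by (auto intro!: derivative_eq_intros)
  have "((\<lambda>s. f (\<gamma> s)) \<circ> (\<lambda>t. p + q * t) has_real_derivative Y (\<gamma> (p + q * t)) f * q) (at t within {0..1})"
    by (rule DERIV_image_chain[OF 1 2])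
  then show "((\<lambda>t. f (\<gamma> (p + q * t))) has_real_derivative (q *\<^sub>R Y (\<gamma> (p + q * t))) f) (at t within {0..1})"
    by (simp add: comp_def mult.commute)
qed

lemma integral_curve_in: "integral_curve M Y \<gamma> \<Longrightarrow> t \<in> {0..1} \<Longrightarrow> \<gamma> t \<in> pts M"
  unfolding integral_curve_def
  using continuous_map_image_subset_topspace[of "top_of_set {0..1}" "mtop M" \<gamma>] by auto

context hamiltonian
begin

abbreviation "\<Gamma>A \<equiv> sections_in D (pts S) A"
abbreviation "hat \<equiv> induced_field X J F"
abbreviation "orb \<equiv> orbit_rel D A X J F"
abbreviation "\<pi> \<equiv> orbit_proj D A X J F"

lemma A_lagrangian: "s \<in> pts S \<Longrightarrow> A s = {u \<in> fibre D s. \<forall>v\<in>A s. pairing D s u v = 0}"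
  using dirA unfolding dirac_structure_def lagrangian_def by blast

lemma A_subspace:
  assumes s: "s \<in> pts S"
  shows "subspace (A s)"
proof (rule subspaceI)
  have fib: "u \<in> fibre D s" and iso: "v \<in> A s \<Longrightarrow> pairing D s u v = 0" if "u \<in> A s" for u v
    using A_lagrangian[OF s] that by blast+
  have memI: "u \<in> A s" if "u \<in> fibre D s" "\<And>v. v \<in> A s \<Longrightarrow> pairing D s u v = 0" for u
    using A_lagrangian[OF s] that by blast
  note sub = fibreD_subspace[OF s]
  have pr1: "pairing D s (u + v) w = pairing D s u w + pairing D s v w"
    if "u \<in> fibre D s" "v \<in> fibre D s" "w \<in> fibre D s" for u v w
    using courant_pairing[OF courD] s that by blast
  have pr2: "pairing D s (c *\<^sub>R u) w = c * pairing D s u w"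
    if "u \<in> fibre D s" "w \<in> fibre D s" for u w c
    using courant_pairing[OF courD] s that by blast
  show "0 \<in> A s" using subspace_0[OF sub] pairingD_0[OF s] fib by (intro memI) auto
  show "u + v \<in> A s" if "u \<in> A s" "v \<in> A s" for u v
    using that fib iso by (intro memI subspace_add[OF sub]) (simp_all add: pr1)
  show "c *\<^sub>R u \<in> A s" if "u \<in> A s" for u c
    using that fib iso by (intro memI subspace_scale[OF sub]) (simp_all add: pr2)
qed

lemma A_sections_scaleR:
  assumes a: "a \<in> \<Gamma>A"
  shows "r *\<^sub>R a \<in> \<Gamma>A"
proof -
  have sec: "smooth_section_on S D (pts S) a" "\<And>p. p \<notin> pts S \<Longrightarrow> a p = 0" "\<And>s. s \<in> pts S \<Longrightarrow> a s \<in> A s"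
    using a by (auto simp: sections_in_def sections_def)
  have 1: "\<forall>q\<in>pts S. (r *\<^sub>R a) q \<in> fibre D q"
    using sec(1) fibreD_subspace by (simp add: smooth_section_on_def subspace_scale)
  have 2: "\<forall>(U, e)\<in>frames D. \<exists>c. (\<forall>i<rank D. smooth_fun_on S (pts S \<inter> U) (c i)) \<and>
       (\<forall>q\<in>pts S \<inter> U. (r *\<^sub>R a) q = (\<Sum>i<rank D. c i q *\<^sub>R e i q))"
  proof (intro ballI, clarify)
    fix U e assume Ue: "(U, e) \<in> frames D"
    note section_coefficients[OF sec(1) Ue]
    then obtain c where c: "\<forall>i<rank D. smooth_fun_on S (pts S \<inter> U) (c i)"
       "\<forall>q\<in>pts S \<inter> U. a q = (\<Sum>i<rank D. c i q *\<^sub>R e i q)" by (elim exE conjE) (rule that)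
    show "\<exists>c. (\<forall>i<rank D. smooth_fun_on S (pts S \<inter> U) (c i)) \<and>
       (\<forall>q\<in>pts S \<inter> U. (r *\<^sub>R a) q = (\<Sum>i<rank D. c i q *\<^sub>R e i q))"
    proof (intro exI[of _ "\<lambda>i q. r * c i q"] conjI allI impI ballI)
      show "smooth_fun_on S (pts S \<inter> U) (\<lambda>q. r * c i q)" if "i < rank D" for i
        using c(1) that by (intro S.smooth_fun_on_mult S.smooth_fun_on_const) auto
      show "(r *\<^sub>R a) q = (\<Sum>i<rank D. (r * c i q) *\<^sub>R e i q)" if "q \<in> pts S \<inter> U" for q
        using c(2) that by (simp add: scaleR_sum_right)
    qed
  qed
  show ?thesis
    unfolding sections_in_def sections_def smooth_section_on_def
    using 1 2 sec(2,3) A_subspace by (simp add: subspace_scale)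
qed

lemma hat_eq:
  assumes "x \<in> pts X" "(a (J x), (v, 0)) \<in> F (J x, x)"
  shows "hat a x = v"
proof -
  have "v \<in> tangent_space X x" using F_fibre[OF assms] by (simp add: fibre_E)
  then have "(THE v. v \<in> tangent_space X x \<and> (a (J x), (v, 0)) \<in> F (J x, x)) = v"
    using assms F_tangent_unique by (intro the_equality) auto
  then show ?thesis using assms(1) by (simp add: induced_field_def)
qed

lemma hat_mem:
  assumes a: "a \<in> \<Gamma>A" and x: "x \<in> pts X"
  shows "(a (J x), (hat a x, 0)) \<in> F (J x, x)"
proof -
  have "a (J x) \<in> A (J x)" using a J_in[OF x] by (simp add: sections_in_def)
  then obtain v where "(a (J x), (v, 0)) \<in> F (J x, x)" using F_action[OF x] by blast
  then show ?thesis using hat_eq[OF x] by simp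
qed

lemma hat_vector_field:
  assumes a: "a \<in> \<Gamma>A"
  shows "hat a \<in> vector_fields X"
proof -
  have "(\<lambda>x. 0) \<in> one_forms X"
    using subspace_0[OF X.cotangent_subspace]
    by (auto simp: one_forms_def smooth_form_on_def intro: X.smooth_fun_on_const)
  moreover have "a \<in> sections D" using a by (simp add: sections_in_def)
  ultimately have "smooth_vf_on X (pts X) (hat a)" using hat_mem[OF a] by (intro lift_smooth) auto
  then show ?thesis by (simp add: vector_fields_def induced_field_def)
qed

lemma hat_scaleR:
  assumes a: "a \<in> \<Gamma>A"
  shows "hat (r *\<^sub>R a) = (\<lambda>x. r *\<^sub>R hat a x)"
proof
  fix x show "hat (r *\<^sub>R a) x = r *\<^sub>R hat a x"
  proof (cases "x \<in> pts X")
    case True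
    have "r *\<^sub>R (a (J x), (hat a x, 0)) \<in> F (J x, x)"
      using hat_mem[OF a True] F_subspace[OF True] by (simp only: subspace_scale)
    then show ?thesis using hat_eq[OF True, of "r *\<^sub>R a"] by simp
  qed (simp add: induced_field_def)
qed

lemma orb_step:
  assumes a: "a \<in> \<Gamma>A" and \<gamma>: "integral_curve X (\<lambda>x. r *\<^sub>R hat a x) \<gamma>"
  shows "(\<gamma> 0, \<gamma> 1) \<in> orb"
proof -
  have "integral_curve X (hat (r *\<^sub>R a)) \<gamma>" using \<gamma> hat_scaleR[OF a] by simp
  then have "(\<gamma> 0, \<gamma> 1) \<in> {(\<gamma> 0, \<gamma> 1) | \<gamma> a. a \<in> \<Gamma>A \<and> integral_curve X (hat a) \<gamma>}"
    using A_sections_scaleR[OF a] by blast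
  moreover have "\<gamma> 0 \<in> pts X" "\<gamma> 1 \<in> pts X" using integral_curve_in[OF \<gamma>] by auto
  ultimately show ?thesis by (auto simp: orbit_rel_def)
qed

lemma orb_equiv: "equiv (pts X) orb"
proof (rule equivI)
  let ?R = "{(\<gamma> 0, \<gamma> 1) | \<gamma> a. a \<in> \<Gamma>A \<and> integral_curve X (hat a) \<gamma>}"
  show "orb \<subseteq> pts X \<times> pts X" by (auto simp: orbit_rel_def)
  show "refl_on (pts X) orb" by (auto simp: refl_on_def orbit_rel_def)
  show "trans orb" unfolding orbit_rel_def
    by (rule transI) (auto intro: rtrancl_trans)
  have "sym ?R"
  proof (rule symI)
    fix x y assume "(x, y) \<in> ?R"
    then obtain \<gamma> a where \<gamma>: "x = \<gamma> 0" "y = \<gamma> 1" "a \<in> \<Gamma>A" "integral_curve X (hat a) \<gamma>" by blast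
    have "integral_curve X (\<lambda>x. (-1) *\<^sub>R hat a x) (\<lambda>t. \<gamma> (1 + (-1) * t))"
      by (rule integral_curve_affine[OF \<gamma>(4)]) auto
    then have "integral_curve X (hat ((-1) *\<^sub>R a)) (\<lambda>t. \<gamma> (1 + (-1) * t))"
      unfolding hat_scaleR[OF \<gamma>(3)] .
    moreover have "(-1) *\<^sub>R a \<in> \<Gamma>A" by (rule A_sections_scaleR[OF \<gamma>(3)])
    moreover have "y = (\<lambda>t. \<gamma> (1 + (-1) * t)) 0" "x = (\<lambda>t. \<gamma> (1 + (-1) * t)) 1" using \<gamma> by simp_all
    ultimately show "(y, x) \<in> ?R"
      by (intro CollectI exI[of _ "\<lambda>t. \<gamma> (1 + (-1) * t)"] exI[of _ "(-1) *\<^sub>R a"] conjI) auto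
  qed
  then have "sym (?R\<^sup>*)" by (rule sym_rtrancl)
  then show "sym orb" unfolding orbit_rel_def by (auto simp: sym_def)
qed

lemma \<pi>_eq_iff: "x \<in> pts X \<Longrightarrow> y \<in> pts X \<Longrightarrow> \<pi> x = \<pi> y \<longleftrightarrow> (x, y) \<in> orb"
  unfolding orbit_proj_def by (rule eq_equiv_class_iff[OF orb_equiv])

lemma \<pi>_surj: "\<pi> ` pts X = orbit_space D A X J F"
  by (auto simp: orbit_space_def quotient_def orbit_proj_def)

definition orbit_invariant :: "('x \<Rightarrow> real) \<Rightarrow> bool"
  where "orbit_invariant h \<longleftrightarrow> h \<in> C_inf X \<and> (\<forall>x\<in>pts X. \<forall>y\<in>pts X. (x, y) \<in> orb \<longrightarrow> h x = h y)"

text \<open>A function annihilated by the fields is constant along the integral curves that generate the orbits.\<close>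

lemma orbit_invariantI:
  assumes h: "h \<in> C_inf X" and 0: "\<And>a x. a \<in> \<Gamma>A \<Longrightarrow> x \<in> pts X \<Longrightarrow> hat a x h = 0"
  shows "orbit_invariant h"
proof -
  have step: "h (\<gamma> 0) = h (\<gamma> 1)" if a: "a \<in> \<Gamma>A" and \<gamma>: "integral_curve X (hat a) \<gamma>" for \<gamma> a
  proof -
    have "((\<lambda>t. h (\<gamma> t)) has_field_derivative 0) (at t within {0..1})" if t: "t \<in> {0..1}" for t
    proof -
      have "((\<lambda>t. h (\<gamma> t)) has_real_derivative hat a (\<gamma> t) h) (at t within {0..1})"
        using \<gamma> h t unfolding integral_curve_def by blast
      then show ?thesis using 0[OF a integral_curve_in[OF \<gamma> t]] by simp
    qed
    then obtain c where "\<And>t. t \<in> {0..1} \<Longrightarrow> h (\<gamma> t) = c"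
      using has_field_derivative_zero_constant[of "{0..1}" "\<lambda>t. h (\<gamma> t)"] by auto
    then show ?thesis by simp
  qed
  have "h x = h y" if "(x, y) \<in> {(\<gamma> 0, \<gamma> 1) | \<gamma> a. a \<in> \<Gamma>A \<and> integral_curve X (hat a) \<gamma>}\<^sup>*" for x y
    using that by (induction rule: rtrancl_induct) (auto dest: step)
  then show ?thesis using h by (auto simp: orbit_invariant_def orbit_rel_def)
qed

text \<open>The function is constant along a short integral curve that starts at \<open>x\<close>, since all points of the
  curve lie in the orbit of \<open>x\<close>.\<close>

lemma hat_kills_invariant:
  assumes h: "orbit_invariant h" and a: "a \<in> \<Gamma>A" and x: "x \<in> pts X"
  shows "hat a x h = 0"
proof -
  have hC: "h \<in> C_inf X" using h by (simp add: orbit_invariant_def)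
  obtain \<delta> \<gamma> where \<gamma>: "0 < \<delta>" "\<gamma> 0 = x" "integral_curve X (\<lambda>q. \<delta> *\<^sub>R hat a q) \<gamma>"
    by (rule X.short_integral_curve[OF X_charts hat_vector_field[OF a] x])
  have const: "h (\<gamma> t) = h x" if t: "t \<in> {0..1}" for t
  proof -
    have "integral_curve X (\<lambda>q. t *\<^sub>R (\<delta> *\<^sub>R hat a q)) (\<lambda>s. \<gamma> (0 + t * s))"
      by (rule integral_curve_affine[OF \<gamma>(3)]) (use t in \<open>auto intro: mult_le_one\<close>)
    then have "integral_curve X (\<lambda>q. (t * \<delta>) *\<^sub>R hat a q) (\<lambda>s. \<gamma> (0 + t * s))" by simp
    from orb_step[OF a this] have "(x, \<gamma> t) \<in> orb" using \<gamma>(2) by simp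
    then show ?thesis using h integral_curve_in[OF \<gamma>(3) t] x unfolding orbit_invariant_def by metis
  qed
  have 1: "((\<lambda>t. h (\<gamma> t)) has_real_derivative (\<delta> *\<^sub>R hat a (\<gamma> 0)) h) (at 0 within {0..1})"
    using \<gamma>(3) hC unfolding integral_curve_def by auto
  have "((\<lambda>t. h x) has_derivative (*) 0) (at 0 within {0..1::real})"
    unfolding has_field_derivative_def[symmetric] by simp
  then have 2: "((\<lambda>t. h (\<gamma> t)) has_real_derivative 0) (at 0 within {0..1})"
    unfolding has_field_derivative_def
    by (rule has_derivative_transform[rotated 2]) (auto simp: const)
  have "(\<delta> *\<^sub>R hat a (\<gamma> 0)) h = 0"
    by (rule vector_derivative_unique_within_closed_interval[of 0 1 0 "\<lambda>t. h (\<gamma> t)"])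
      (use 1 2 in \<open>simp_all add: has_real_derivative_iff_has_vector_derivative\<close>)
  then show ?thesis using \<gamma>(1,2) by simp
qed

text \<open>The extension is a section with constant coefficients in a local frame of \<open>A\<close>, cut off by a bump
  function.\<close>

lemma A_section_extends:
  assumes s: "s \<in> pts S" and a0: "a0 \<in> A s"
  obtains a where "a \<in> \<Gamma>A" "a s = a0"
proof -
  have "smooth_subbundle S D A" using dirA by (simp add: dirac_structure_def)
  then have "\<exists>U k \<sigma>. openin (mtop S) U \<and> s \<in> U \<and>
      (\<forall>i<k. smooth_section_on S D U (\<sigma> i)) \<and> (\<forall>p\<in>U. is_basis k (\<lambda>i. \<sigma> i p) (A p))"
    unfolding smooth_subbundle_def using s by (rule bspec)
  then obtain U k \<sigma> where U: "openin (mtop S) U" "s \<in> U"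
      and \<sigma>: "\<forall>i<k. smooth_section_on S D U (\<sigma> i)" "\<forall>p\<in>U. is_basis k (\<lambda>i. \<sigma> i p) (A p)"
    by (elim exE conjE) (rule that)
  have Up: "U \<subseteq> pts S" using U(1) openin_subset by blast
  obtain r where r: "a0 = (\<Sum>i<k. r i *\<^sub>R \<sigma> i s)"
    by (rule is_basis_repr[OF bspec[OF \<sigma>(2) U(2)] a0])
  obtain \<eta> N K where \<eta>: "\<eta> \<in> C_inf S" "openin (mtop S) N" "s \<in> N" "N \<subseteq> K" "closedin (mtop S) K" "K \<subseteq> U"
    "\<And>q. q \<in> N \<Longrightarrow> \<eta> q = 1" "\<And>q. q \<notin> K \<Longrightarrow> \<eta> q = 0"
    using S.bump[OF U] by metis
  define a where "a = (\<lambda>q. if q \<in> U then \<eta> q *\<^sub>R (\<Sum>i<k. r i *\<^sub>R \<sigma> i q) else 0)"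
  have aA: "a q \<in> A q" if q: "q \<in> pts S" for q
  proof (cases "q \<in> U")
    case True
    have "\<sigma> i q \<in> A q" if "i < k" for i using is_basis_mem[OF bspec[OF \<sigma>(2) True] that] .
    then have "(\<Sum>i<k. r i *\<^sub>R \<sigma> i q) \<in> A q"
      using A_subspace[OF q] by (auto intro: subspace_sum subspace_scale)
    then show ?thesis using True A_subspace[OF q] by (simp add: a_def subspace_scale)
  next
    case False
    then show ?thesis using subspace_0[OF A_subspace[OF q]] by (simp add: a_def)
  qed
  have fib: "\<forall>q\<in>pts S. a q \<in> fibre D q" using aA A_lagrangian by blast
  have "\<forall>(U', e)\<in>frames D. \<exists>c. (\<forall>j<rank D. smooth_fun_on S (pts S \<inter> U') (c j)) \<and>
       (\<forall>q\<in>pts S \<inter> U'. a q = (\<Sum>j<rank D. c j q *\<^sub>R e j q))"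
  proof (intro ballI, clarify)
    fix U' e assume Ue: "(U', e) \<in> frames D"
    have oU': "openin (mtop S) U'" by (rule frame_open[OF Ue])
    have "\<forall>i\<in>{..<k}. \<exists>c. (\<forall>j<rank D. smooth_fun_on S (U \<inter> U') (c j)) \<and>
       (\<forall>q\<in>U \<inter> U'. \<sigma> i q = (\<Sum>j<rank D. c j q *\<^sub>R e j q))"
    proof
      fix i assume "i \<in> {..<k}"
      then have "smooth_section_on S D U (\<sigma> i)" using \<sigma>(1) by simp
      from section_coefficients[OF this Ue] show "\<exists>c. (\<forall>j<rank D. smooth_fun_on S (U \<inter> U') (c j)) \<and>
        (\<forall>q\<in>U \<inter> U'. \<sigma> i q = (\<Sum>j<rank D. c j q *\<^sub>R e j q))" .
    qed
    from bchoice[OF this] obtain C where C: "\<forall>i\<in>{..<k}. (\<forall>j<rank D. smooth_fun_on S (U \<inter> U') (C i j)) \<and>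
       (\<forall>q\<in>U \<inter> U'. \<sigma> i q = (\<Sum>j<rank D. C i j q *\<^sub>R e j q))"
      by (elim exE) (rule that)
    define c where "c = (\<lambda>j q. if q \<in> U then \<eta> q * (\<Sum>i<k. r i * C i j q) else 0)"
    have "smooth_fun_on S U' (c j)" if j: "j < rank D" for j
    proof (rule S.smooth_fun_on_local[OF oU'])
      fix p assume p: "p \<in> U'"
      show "\<exists>N. openin (mtop S) N \<and> p \<in> N \<and> smooth_fun_on S N (c j)"
      proof (cases "p \<in> U")
        case True
        have "smooth_fun_on S (U \<inter> U') (C i j)" if "i \<in> {..<k}" for i using bspec[OF C that] j by blast
        then have "smooth_fun_on S (U \<inter> U') (\<lambda>q. \<eta> q * (\<Sum>i<k. r i * C i j q))"
          using S.C_inf_smooth_on[OF \<eta>(1), of "U \<inter> U'"] Up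
          by (intro S.smooth_fun_on_mult S.smooth_fun_on_sum S.smooth_fun_on_const) auto
        then have "smooth_fun_on S (U \<inter> U') (c j)"
          by (rule S.smooth_fun_on_cong) (simp add: c_def)
        moreover have "openin (mtop S) (U \<inter> U')" using U(1) oU' by blast
        ultimately show ?thesis using True p by blast
      next
        case False
        have "openin (mtop S) (U' - K)" using oU' \<eta>(5) by (rule openin_diff)
        moreover have "p \<in> U' - K" using p False \<eta>(6) by blast
        moreover have "smooth_fun_on S (U' - K) (c j)"
          by (rule S.smooth_fun_on_cong[OF S.smooth_fun_on_const[of _ 0]]) (simp add: c_def \<eta>(8))
        ultimately show ?thesis by blast
      qed
    qed
    moreover have "pts S \<inter> U' = U'" using openin_subset[OF oU'] by blast
    moreover have "a q = (\<Sum>j<rank D. c j q *\<^sub>R e j q)" if q: "q \<in> U'" for q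
    proof (cases "q \<in> U")
      case True
      have \<sigma>q: "\<sigma> i q = (\<Sum>j<rank D. C i j q *\<^sub>R e j q)" if "i \<in> {..<k}" for i
        using bspec[OF conjunct2[OF bspec[OF C that]], of q] True q by blast
      have "(\<Sum>i<k. r i *\<^sub>R \<sigma> i q) = (\<Sum>i<k. \<Sum>j<rank D. (r i * C i j q) *\<^sub>R e j q)"
        using \<sigma>q by (intro sum.cong) (simp_all add: scaleR_sum_right)
      also have "\<dots> = (\<Sum>j<rank D. \<Sum>i<k. (r i * C i j q) *\<^sub>R e j q)" by (rule sum.swap)
      finally show ?thesis using True by (simp add: a_def c_def scaleR_sum_left scaleR_sum_right sum_distrib_left)
    qed (simp add: a_def c_def)
    ultimately show "\<exists>c. (\<forall>j<rank D. smooth_fun_on S (pts S \<inter> U') (c j)) \<and>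
       (\<forall>q\<in>pts S \<inter> U'. a q = (\<Sum>j<rank D. c j q *\<^sub>R e j q))"
      by (intro exI[of _ c]) simp
  qed
  moreover have "a p = 0" if "p \<notin> pts S" for p using that Up by (auto simp: a_def)
  ultimately have "a \<in> \<Gamma>A" using fib aA by (simp add: sections_in_def sections_def smooth_section_on_def)
  moreover have "a s = a0" using U(2) \<eta>(3,7) by (simp add: a_def r)
  ultimately show ?thesis by (rule that)
qed

lemma action_kills_invariant:
  assumes h: "orbit_invariant h" and x: "x \<in> pts X" and w: "(d, (w, 0)) \<in> F (J x, x)"
  shows "w h = 0"
proof -
  have "d \<in> A (J x)" using F_action[OF x] w by blast
  then obtain a where a: "a \<in> \<Gamma>A" "a (J x) = d" using A_section_extends[OF J_in[OF x]] by blast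
  then have "hat a x = w" using hat_eq[OF x, of a w] w by simp
  then show ?thesis using hat_kills_invariant[OF h a(1) x] by simp
qed


section \<open>Hamiltonian vector fields of invariant functions\<close>

text \<open>Existence of the Hamiltonian vector is linear algebra: \<open>(0, (0, dh))\<close> is orthogonal to
  \<open>F \<inter> (D \<times> TX)\<close>, which is the orthogonal complement of \<open>F + TX\<close>.\<close>

lemma hamiltonian_vector_exists:
  assumes h: "orbit_invariant h" and x: "x \<in> pts X"
  shows "\<exists>v. (0, (v, dfun X h x)) \<in> F (J x, x)"
proof -
  let ?W = "fibre E (J x, x)" and ?T = "tangent_space X x"
  let ?G = "{u. \<exists>g\<in>F (J x, x). \<exists>t\<in>?T. u = g + (0, (t, 0))}"
  have hC: "h \<in> C_inf X" using h by (simp add: orbit_invariant_def)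
  note sub = F_subspace[OF x] and subT = X.tangent_subspace[of x]
  have D0: "0 \<in> fibre D (J x)" by (rule subspace_0[OF fibreD_subspace[OF J_in[OF x]]])
  have inW: "(0, (t, b)) \<in> ?W" if "t \<in> ?T" "b \<in> cotangent_space X x" for t b
    using that D0 by (simp add: fibre_E)
  have cot0: "0 \<in> cotangent_space X x" by (rule subspace_0[OF X.cotangent_subspace])
  obtain k b where bas: "is_basis k b ?W" by (rule fibreE_basis[OF x])
  have GI: "g + (0, (t, 0)) \<in> ?G" if "g \<in> F (J x, x)" "t \<in> ?T" for g t using that by blast
  have FG: "g \<in> ?G" if "g \<in> F (J x, x)" for g
    using GI[OF that subspace_0[OF subT]] by (simp flip: zero_prod_def)
  have "(0, (0, dfun X h x)) \<in> ?G"
  proof (rule double_orthogonal[OF bas, where pr="pairing E (J x, x)"])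
    show "subspace ?G"
    proof (rule subspaceI)
      show "0 \<in> ?G" by (rule FG[OF subspace_0[OF sub]])
      show "u + u' \<in> ?G" if uG: "u \<in> ?G" "u' \<in> ?G" for u u'
      proof -
        obtain g t g' t' where "g \<in> F (J x, x)" "t \<in> ?T" "u = g + (0, (t, 0))"
          "g' \<in> F (J x, x)" "t' \<in> ?T" "u' = g' + (0, (t', 0))" using uG by blast
        then have "u + u' = (g + g') + (0, (t + t', 0))" "g + g' \<in> F (J x, x)" "t + t' \<in> ?T"
          using subspace_add[OF sub] subspace_add[OF subT] by (auto simp: prod_eq_iff algebra_simps)
        then show ?thesis by blast
      qed
      show "c *\<^sub>R u \<in> ?G" if uG: "u \<in> ?G" for c u
      proof -
        obtain g t where "g \<in> F (J x, x)" "t \<in> ?T" "u = g + (0, (t, 0))" using uG by blast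
        then have "c *\<^sub>R u = c *\<^sub>R g + (0, (c *\<^sub>R t, 0))" "c *\<^sub>R g \<in> F (J x, x)" "c *\<^sub>R t \<in> ?T"
          using subspace_scale[OF sub] subspace_scale[OF subT]
          by (auto simp: prod_eq_iff scaleR_add_right)
        then show ?thesis by blast
      qed
    qed
    show "?G \<subseteq> ?W"
      using F_fibre[OF x] inW[OF _ cot0] subspace_add[OF fibreE_subspace[OF x]] by blast
    show "(0, (0, dfun X h x)) \<in> ?W"
      by (rule inW[OF subspace_0[OF subT] X.dfun_cotangent[OF hC]])
    fix w assume w: "w \<in> ?W" and orth: "\<forall>g\<in>?G. pairing E (J x, x) g w = 0"
    obtain d w1 \<theta> where w': "w = (d, (w1, \<theta>))" by (metis prod.exhaust)
    have memD: "d \<in> fibre D (J x)" "w1 \<in> ?T" "\<theta> \<in> cotangent_space X x" using w by (simp_all add: w' fibre_E)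
    have "pairing E (J x, x) w g = 0" if g: "g \<in> F (J x, x)" for g
    proof -
      have "g \<in> ?G" by (rule FG[OF g])
      with orth have "pairing E (J x, x) g w = 0" by (rule bspec)
      then show ?thesis using pairingE(3)[OF x w F_fibre[OF x g]] by (simp only:)
    qed
    then have wF: "w \<in> F (J x, x)" using F_lagrangian[OF x] w by blast
    have "\<theta> t = 0" for t
    proof (cases "t \<in> ?T")
      case True
      then have "(0, (t, 0)) \<in> ?G" using GI[OF subspace_0[OF sub], of t] by (simp only: add_0)
      then have "pairing E (J x, x) (0, (t, 0)) w = 0" using orth by blast
      then show ?thesis using pairingD_0[OF J_in[OF x] memD(1)] by (simp add: w' pairing_E)
    next
      case False
      then show ?thesis using X.cotangentD(3)[OF memD(3)] by blast
    qed
    then have "\<theta> = 0" by auto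
    then have "w1 h = 0" using action_kills_invariant[OF h x, of d w1] wF by (simp add: w')
    then show "pairing E (J x, x) (0, (0, dfun X h x)) w = 0"
      using pairingD_0[OF J_in[OF x] memD(1)] \<open>\<theta> = 0\<close> by (simp add: w' pairing_E dfun_def)
  qed (use pairingE[OF x] in blast)+
  then obtain g t where g: "g \<in> F (J x, x)" "(0, (0, dfun X h x)) = g + (0, (t, 0))" by blast
  then have "g = (0, (- t, dfun X h x))" by (auto simp: prod_eq_iff eq_neg_iff_add_eq_0)
  with g(1) show ?thesis by blast
qed

definition ham_field :: "('x \<Rightarrow> real) \<Rightarrow> 'x \<Rightarrow> 'x tvec"
  where "ham_field h x = (if x \<in> pts X then THE v. (0, (v, dfun X h x)) \<in> F (J x, x) else 0)"

lemma ham_field_eq: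
  assumes "x \<in> pts X" "(0, (v, dfun X h x)) \<in> F (J x, x)"
  shows "ham_field h x = v"
  using assms F_tangent_unique by (auto simp: ham_field_def intro: the_equality)

lemma ham_field_mem:
  assumes "orbit_invariant h" "x \<in> pts X"
  shows "(0, (ham_field h x, dfun X h x)) \<in> F (J x, x)"
  using hamiltonian_vector_exists[OF assms] ham_field_eq[OF assms(2)] by blast

lemma zero_section: "0 \<in> sections D"
  unfolding sections_def smooth_section_on_def
  using subspace_0[OF fibreD_subspace]
  by (auto intro!: exI[of _ "\<lambda>_ _. 0"] S.smooth_fun_on_const)

lemma ham_field_vector_field:
  assumes h: "orbit_invariant h"
  shows "ham_field h \<in> vector_fields X"
proof -
  have hC: "h \<in> C_inf X" using h by (simp add: orbit_invariant_def)
  have "smooth_vf_on X (pts X) (ham_field h)"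
    by (rule lift_smooth[OF zero_section X.exact_form_one_form[OF hC]])
      (use ham_field_mem[OF h] in \<open>simp add: X.exact_form_def\<close>)
  then show ?thesis by (simp add: vector_fields_def ham_field_def)
qed

lemma pull2_section:
  assumes w: "w \<in> sections (std_courant X)"
  shows "pull2 S w \<in> sections E"
proof -
  have std: "base (std_courant X) = X" "rank (std_courant X) = n"
    "\<And>p. fibre (std_courant X) p = tangent_space X p \<times> cotangent_space X p" by (simp_all add: std_courant_def)
  have w1: "\<And>p. p \<in> pts X \<Longrightarrow> w p \<in> tangent_space X p \<times> cotangent_space X p"
    "\<And>p. p \<notin> pts X \<Longrightarrow> w p = 0"
    using w unfolding sections_def smooth_section_on_def std by blast+
  have w2: "smooth_section_on X (std_courant X) (pts X) w" using w by (simp add: sections_def std)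
  let ?r = "rank D"
  have 1: "pull2 S w q \<in> fibre E q" if "q \<in> pts S \<times> pts X" for q
    using that w1(1) subspace_0[OF fibreD_subspace] by (cases q) (auto simp: pull2_def fibre_E mem_Times_iff)
  have 2: "\<exists>c. (\<forall>i<?r + n. smooth_fun_on (prod_mfd S X) (pts S \<times> pts X \<inter> U) (c i)) \<and>
       (\<forall>q\<in>pts S \<times> pts X \<inter> U. pull2 S w q = (\<Sum>i<?r + n. c i q *\<^sub>R e i q))"
    if fe: "(U, e) \<in> frames E" for U e
  proof -
    obtain U1 e1 U2 e2 where
      eq: "(U, e) = (U1 \<times> U2, \<lambda>i (s, x). if i < ?r then (e1 i s, 0) else (0, e2 (i - ?r) x))"
      and fr: "(U1, e1) \<in> frames D" "(U2, e2) \<in> frames (std_courant X)"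
      using fe unfolding frames_E mem_Collect_eq by (elim exE conjE) (rule that)
    note section_coefficients[OF w2 fr(2), unfolded std]
    then obtain c where c: "\<forall>i<n. smooth_fun_on X (pts X \<inter> U2) (c i)"
       "\<forall>q\<in>pts X \<inter> U2. w q = (\<Sum>i<n. c i q *\<^sub>R e2 i q)" by (elim exE conjE) (rule that)
    define c' where "c' = (\<lambda>i (s::'s, x). if i < ?r then 0 else c (i - ?r) x)"
    have "smooth_fun_on (prod_mfd S X) (pts S \<times> pts X \<inter> U) (c' i)" if i: "i < ?r + n" for i
    proof -
      have "smooth_fun_on X (pts X \<inter> U2) (\<lambda>x. if i < ?r then 0 else c (i - ?r) x)"
        using c(1) i by (cases "i < ?r") (auto intro: X.smooth_fun_on_const)
      from smooth_fun_on_prod_snd[OF S_mfd X_mfd this, of "pts S \<times> pts X \<inter> U" UNIV]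
      show ?thesis using eq by (auto simp: c'_def)
    qed
    moreover have "pull2 S w q = (\<Sum>i<?r + n. c' i q *\<^sub>R e i q)" if q: "q \<in> pts S \<times> pts X \<inter> U" for q
    proof -
      obtain s x where sx: "q = (s, x)" by (cases q)
      have "s \<in> pts S" "x \<in> pts X \<inter> U2" using q eq by (auto simp: sx)
      then have "pull2 S w q = (0, \<Sum>i<n. c i x *\<^sub>R e2 i x)" using c(2) by (simp add: sx pull2_def)
      also have "\<dots> = (\<Sum>i<?r + n. c' i q *\<^sub>R e i q)"
        unfolding sum_lessThan_add using eq by (simp add: c'_def sx prod_eq_iff fst_sum snd_sum)
      finally show ?thesis .
    qed
    ultimately show ?thesis by blast
  qed
  have 3: "pull2 S w q = 0" if "q \<notin> pts S \<times> pts X" for q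
    using that w1(2) by (cases q) (auto simp: pull2_def zero_prod_def)
  show ?thesis unfolding sections_def smooth_section_on_def mem_Collect_eq pts_E rank_E
    unfolding base_E using 1 2 3 by blast
qed

text \<open>The pullbacks to \<open>S \<times> X\<close> of \<open>(Y, dg)\<close> and \<open>(Z, dh)\<close> are global sections with values in \<open>F\<close> over the
  graph, and the product bracket of pullbacks is the pullback of the bracket.\<close>

lemma bracket_closed:
  assumes Y: "Y \<in> vector_fields X" "Z \<in> vector_fields X" and h: "g \<in> C_inf X" "h \<in> C_inf X"
    and F: "\<And>x. x \<in> pts X \<Longrightarrow> (0, (Y x, dfun X g x)) \<in> F (J x, x)"
      "\<And>x. x \<in> pts X \<Longrightarrow> (0, (Z x, dfun X h x)) \<in> F (J x, x)"
    and x: "x \<in> pts X"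
  shows "(0, (lie_bracket Y Z x, dfun X (\<lambda>q. Y q h) x)) \<in> F (J x, x)"
proof -
  let ?w1 = "\<lambda>p. (Y p, X.exact_form g p)" and ?w2 = "\<lambda>p. (Z p, X.exact_form h p)"
  have s: "?w1 \<in> sections (std_courant X)" "?w2 \<in> sections (std_courant X)"
    using Y h by (auto intro: X.std_section X.exact_form_one_form)
  have mem: "pull2 S (\<lambda>p. (V p, X.exact_form f p)) \<in> sections_in E (pts (graph_mfd S X J)) F"
    if "(\<lambda>p. (V p, X.exact_form f p)) \<in> sections (std_courant X)"
      "\<And>x. x \<in> pts X \<Longrightarrow> (0, (V x, dfun X f x)) \<in> F (J x, x)" for V f
    unfolding sections_in_def pts_graph using pull2_section[OF that(1)] that(2) J_in
    by (auto simp: pull2_def X.exact_form_def)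
  have "bracket E (pull2 S ?w1) (pull2 S ?w2) \<in> sections_in E (pts (graph_mfd S X J)) F"
    using diracF mem[OF s(1) F(1)] mem[OF s(2) F(2)] unfolding generalized_dirac_def by blast
  then have "bracket E (pull2 S ?w1) (pull2 S ?w2) (J x, x) \<in> F (J x, x)"
    using x by (auto simp: sections_in_def pts_graph)
  moreover have "bracket E (pull2 S ?w1) (pull2 S ?w2) = pull2 S (bracket (std_courant X) ?w1 ?w2)"
    using productE s unfolding is_product_courant_def by blast
  ultimately have "pull2 S (bracket (std_courant X) ?w1 ?w2) (J x, x) \<in> F (J x, x)" by simp
  then show ?thesis
    using J_in[OF x] x X.std_bracket_exact[OF X_span Y h, of x] by (simp add: pull2_def X.exact_form_def)
qed

text \<open>Invariance of \<open>v\<^sub>g h\<close> is the isotropy of \<open>F\<close>: its differential occurs in the first element of \<open>F\<close>, and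
  pairing with \<open>(a, (hat a, 0))\<close> evaluates it on \<open>hat a\<close>.\<close>

lemma ham_bracket:
  assumes g: "orbit_invariant g" and h: "orbit_invariant h"
  shows "x \<in> pts X \<Longrightarrow> (0, (lie_bracket (ham_field g) (ham_field h) x, dfun X (\<lambda>q. ham_field g q h) x)) \<in> F (J x, x)"
    and "orbit_invariant (\<lambda>q. ham_field g q h)"
proof -
  have C: "g \<in> C_inf X" "h \<in> C_inf X" using g h by (simp_all add: orbit_invariant_def)
  note vf = ham_field_vector_field[OF g] ham_field_vector_field[OF h]
  have mem: "(0, (lie_bracket (ham_field g) (ham_field h) x, dfun X (\<lambda>q. ham_field g q h) x)) \<in> F (J x, x)"
    if "x \<in> pts X" for x
    by (rule bracket_closed[OF vf C ham_field_mem[OF g] ham_field_mem[OF h] that])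
  then show "x \<in> pts X \<Longrightarrow> (0, (lie_bracket (ham_field g) (ham_field h) x, dfun X (\<lambda>q. ham_field g q h) x)) \<in> F (J x, x)" .
  show "orbit_invariant (\<lambda>q. ham_field g q h)"
  proof (rule orbit_invariantI[OF X.vector_fieldsD(3)[OF vf(1) C(2)]])
    fix a x assume a: "a \<in> \<Gamma>A" and x: "x \<in> pts X"
    have aD: "a (J x) \<in> fibre D (J x)" using F_fibre[OF x hat_mem[OF a x]] by (simp add: fibre_E)
    have "pairing E (J x, x) (0, (lie_bracket (ham_field g) (ham_field h) x, dfun X (\<lambda>q. ham_field g q h) x))
        (a (J x), (hat a x, 0)) = 0"
      by (rule F_isotropic[OF x mem[OF x] hat_mem[OF a x]])
    then show "hat a x (\<lambda>q. ham_field g q h) = 0"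
      using pairingD_0[OF J_in[OF x] aD] X.vector_fieldsD(1)[OF hat_vector_field[OF a] x]
      by (simp add: pairing_E dfun_def)
  qed
qed

lemma ham_field_bracket:
  assumes "orbit_invariant g" "orbit_invariant h" "x \<in> pts X"
  shows "ham_field (\<lambda>q. ham_field g q h) x = lie_bracket (ham_field g) (ham_field h) x"
  by (rule ham_field_eq[OF assms(3) ham_bracket(1)[OF assms]])

text \<open>This is the isotropy of \<open>F\<close> for the elements \<open>(0, (v\<^sub>g, dg))\<close> and \<open>(0, (v\<^sub>h, dh))\<close>.\<close>

lemma ham_field_antisym:
  assumes g: "orbit_invariant g" and h: "orbit_invariant h"
  shows "ham_field g x h = - ham_field h x g"
proof (cases "x \<in> pts X")
  case True
  have "pairing E (J x, x) (0, (ham_field g x, dfun X g x)) (0, (ham_field h x, dfun X h x)) = 0"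
    by (rule F_isotropic[OF True ham_field_mem[OF g True] ham_field_mem[OF h True]])
  moreover have "pairing D (J x) 0 0 = 0"
    by (rule pairingD_0[OF J_in[OF True] subspace_0[OF fibreD_subspace[OF J_in[OF True]]]])
  ultimately show ?thesis
    using X.vector_fieldsD(1)[OF ham_field_vector_field True] g h by (simp add: pairing_E dfun_def)
qed (simp add: ham_field_def)

end

section \<open>The Poisson structure on the orbit space\<close>

theorem theorem3p5:
  fixes D :: "('s, 'e::euclidean_space, 'v::real_vector) courant"
    and A :: "'s \<Rightarrow> 'v set"
    and X :: "('x, 'f::euclidean_space) mfd"
    and J :: "'x \<Rightarrow> 's"
    and E :: "('s \<times> 'x, 'e \<times> 'f, 'v \<times> ('x tvec \<times> 'x ctvec)) courant"
    and F :: "'s \<times> 'x \<Rightarrow> ('v \<times> ('x tvec \<times> 'x ctvec)) set"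
    and B :: "('x set, 'b::euclidean_space) mfd"
  assumes "manin_pair D A"
    and "hamiltonian_space D A X J E F"
    and "smooth_manifold B"
    and "pts B = orbit_space D A X J F"
    and "submersion X B (orbit_proj D A X J F)"
  shows "\<exists>br. poisson_structure B br \<and>
    induced_bracket X J F B (orbit_proj D A X J F) br"
proof -
  interpret hamiltonian D A X J E F by standard (rule assms)+
  interpret B: manifold B by standard (rule assms)
  have surj: "\<pi> ` pts X = pts B" using \<pi>_surj assms(4) by simp
  have \<pi>s: "smooth_map X B \<pi>" using assms(5) by (simp add: submersion_def)
  let ?p = "pullback X \<pi>"
  have inv: "orbit_invariant (?p f)" if "f \<in> C_inf B" for f
    unfolding orbit_invariant_def
  proof (intro conjI ballI impI)
    show "?p f \<in> C_inf X" by (rule pullback_C_inf[OF X_mfd assms(3) \<pi>s that])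
    show "?p f x = ?p f y" if "x \<in> pts X" "y \<in> pts X" "(x, y) \<in> orb" for x y
      using that \<pi>_eq_iff[of x y] by (simp add: pullback_def)
  qed
  have ext: "f = g" if "?p f = ?p g" "\<And>b. b \<notin> pts B \<Longrightarrow> f b = g b" for f g
  proof
    fix b show "f b = g b"
    proof (cases "b \<in> pts B")
      case True
      then obtain x where "x \<in> pts X" "b = \<pi> x" using surj by blast
      then show ?thesis using fun_cong[OF that(1), of x] by (simp add: pullback_def)
    qed (rule that(2))
  qed
  \<comment> \<open>The choice of a point in the orbit does not matter because \<open>v\<^sub>f (\<pi>\<^sup>*g)\<close> is constant on orbits.\<close>
  define br where "br = (\<lambda>f g b. if b \<in> pts B
    then ham_field (?p f) (SOME x. x \<in> pts X \<and> \<pi> x = b) (?p g) else 0)"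
  have br_\<pi>: "br f g (\<pi> x) = ham_field (?p f) x (?p g)"
    if f: "f \<in> C_inf B" and g: "g \<in> C_inf B" and x: "x \<in> pts X" for f g x
  proof -
    define y where "y = (SOME y. y \<in> pts X \<and> \<pi> y = \<pi> x)"
    have y: "y \<in> pts X \<and> \<pi> y = \<pi> x" unfolding y_def by (rule someI[of _ x]) (use x in simp)
    then have "(y, x) \<in> orb" using \<pi>_eq_iff x by blast
    then have "ham_field (?p f) y (?p g) = ham_field (?p f) x (?p g)"
      using ham_bracket(2)[OF inv[OF f] inv[OF g]] x y unfolding orbit_invariant_def by blast
    moreover have "\<pi> x \<in> pts B" using surj x by blast
    ultimately show ?thesis by (simp add: br_def y_def)
  qed
  have br_out: "br f g b = 0" if "b \<notin> pts B" for f g b using that by (simp add: br_def)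
  have p_br: "?p (br f g) = (\<lambda>q. ham_field (?p f) q (?p g))" if "f \<in> C_inf B" "g \<in> C_inf B" for f g
    using br_\<pi>[OF that] by (auto simp: pullback_def ham_field_def)
  have br_C: "br f g \<in> C_inf B" if f: "f \<in> C_inf B" and g: "g \<in> C_inf B" for f g
  proof (rule smooth_descends_along_submersion[OF X_mfd assms(3,5) X_charts surj _ br_out])
    show "?p (br f g) \<in> C_inf X"
      using ham_bracket(2)[OF inv[OF f] inv[OF g]] unfolding p_br[OF f g] by (simp add: orbit_invariant_def)
  qed
  have pC: "?p f \<in> C_inf X" if "f \<in> C_inf B" for f using inv[OF that] by (simp add: orbit_invariant_def)
  have tan: "ham_field (?p f) q \<in> tangent_space X q" if "f \<in> C_inf B" "q \<in> pts X" for f q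
    by (rule X.vector_fieldsD(1)[OF ham_field_vector_field[OF inv[OF that(1)]] that(2)])
  have p_add: "?p (f + g) = ?p f + ?p g" and p_mult: "?p (f * g) = ?p f * ?p g"
    and p_scale: "?p (c *\<^sub>R f) = c *\<^sub>R ?p f" for f g c
    by (auto simp: pullback_def)

  have antisym: "br f g = - br g f" if f: "f \<in> C_inf B" and g: "g \<in> C_inf B" for f g
  proof (rule ext)
    show "?p (br f g) = ?p (- br g f)"
      using ham_field_antisym[OF inv[OF f] inv[OF g]] br_\<pi>[OF f g] br_\<pi>[OF g f]
      by (auto simp: pullback_def)
  qed (simp add: br_out)
  have add_right: "br f (g + h) = br f g + br f h"
    if f: "f \<in> C_inf B" and g: "g \<in> C_inf B" and h: "h \<in> C_inf B" for f g h
  proof (rule ext)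
    show "?p (br f (g + h)) = ?p (br f g + br f h)"
      using X.tangentD(1)[OF tan[OF f] pC[OF g] pC[OF h]] br_\<pi>[OF f g] br_\<pi>[OF f h]
        br_\<pi>[OF f B.C_inf_add[OF g h]]
      by (auto simp: pullback_def[of X \<pi> "br _ _"] pullback_def[of X \<pi> "br _ _ + _"] p_add)
  qed (simp add: br_out)
  have scale_right: "br f (c *\<^sub>R g) = c *\<^sub>R br f g" if f: "f \<in> C_inf B" and g: "g \<in> C_inf B" for f g c
  proof (rule ext)
    show "?p (br f (c *\<^sub>R g)) = ?p (c *\<^sub>R br f g)"
      using X.tangentD(3)[OF tan[OF f] pC[OF g]] br_\<pi>[OF f g] br_\<pi>[OF f B.C_inf_scaleR[OF g]]
      by (auto simp: pullback_def[of X \<pi> "br _ _"] pullback_def[of X \<pi> "_ *\<^sub>R br _ _"] p_scale)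
  qed (simp add: br_out)
  have leibniz: "br f (g * h) = br f g * h + g * br f h"
    if f: "f \<in> C_inf B" and g: "g \<in> C_inf B" and h: "h \<in> C_inf B" for f g h
  proof (rule ext)
    show "?p (br f (g * h)) = ?p (br f g * h + g * br f h)"
    proof
      fix x show "?p (br f (g * h)) x = ?p (br f g * h + g * br f h) x"
      proof (cases "x \<in> pts X")
        case True
        have "ham_field (?p f) x (?p g * ?p h) =
            ham_field (?p f) x (?p g) * h (\<pi> x) + g (\<pi> x) * ham_field (?p f) x (?p h)"
          using X.tangentD(2)[OF tan[OF f True] pC[OF g] pC[OF h]] True by (simp add: pullback_def)
        then show ?thesis
          using True br_\<pi>[OF f g True] br_\<pi>[OF f h True] br_\<pi>[OF f B.C_inf_mult[OF g h] True]
          by (simp add: pullback_def[of X \<pi> "br _ _"] pullback_def[of X \<pi> "_ + _"] p_mult)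
      qed (simp add: pullback_def)
    qed
  qed (simp add: br_out)
  have ham_br: "ham_field (?p (br f g)) x = lie_bracket (ham_field (?p f)) (ham_field (?p g)) x"
    if "f \<in> C_inf B" "g \<in> C_inf B" "x \<in> pts X" for f g x
    unfolding p_br[OF that(1,2)] by (rule ham_field_bracket[OF inv[OF that(1)] inv[OF that(2)] that(3)])

  \<comment> \<open>With \<open>v\<^sub>f\<close> the Hamiltonian field of \<open>f\<close>, the three terms of the Jacobi identity are
    \<open>v\<^sub>f v\<^sub>g h\<close>, \<open>- v\<^sub>g v\<^sub>f h\<close> and \<open>- [v\<^sub>f, v\<^sub>g] h\<close>.\<close>
  have jacobi: "br f (br g h) + br g (br h f) + br h (br f g) = 0"
    if f: "f \<in> C_inf B" and g: "g \<in> C_inf B" and h: "h \<in> C_inf B" for f g h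
  proof (rule ext)
    have "(br f (br g h) + br g (br h f) + br h (br f g)) (\<pi> x) = 0" if x: "x \<in> pts X" for x
    proof -
      let ?v = "\<lambda>f. ham_field (?p f)"
      have "br h (br f g) (\<pi> x) = - br (br f g) h (\<pi> x)"
        using antisym[OF h br_C[OF f g]] by simp
      also have "\<dots> = - lie_bracket (?v f) (?v g) x (?p h)"
        using br_\<pi>[OF br_C[OF f g] h x] ham_br[OF f g x] by simp
      finally have 1: "br h (br f g) (\<pi> x) = - (?v f x (\<lambda>q. ?v g q (?p h)) - ?v g x (\<lambda>q. ?v f q (?p h)))"
        by (simp add: lie_bracket_def)
      have 2: "br f (br g h) (\<pi> x) = ?v f x (\<lambda>q. ?v g q (?p h))"
        using br_\<pi>[OF f br_C[OF g h] x] p_br[OF g h] by simp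
      have "br g (br h f) = br g ((-1) *\<^sub>R br f h)" using antisym[OF h f] by simp
      also have "\<dots> = (-1) *\<^sub>R br g (br f h)" by (rule scale_right[OF g br_C[OF f h]])
      finally have 3: "br g (br h f) (\<pi> x) = - ?v g x (\<lambda>q. ?v f q (?p h))"
        using br_\<pi>[OF g br_C[OF f h] x] p_br[OF f h] by simp
      show ?thesis using 1 2 3 by simp
    qed
    then show "?p (br f (br g h) + br g (br h f) + br h (br f g)) = ?p 0"
      by (auto simp: pullback_def)
  qed (simp add: br_out)

  have "poisson_structure B br" unfolding poisson_structure_def
  proof (intro ballI conjI allI)
    fix f g assume f: "f \<in> C_inf B" and g: "g \<in> C_inf B"
    show "br f g \<in> C_inf B" by (rule br_C[OF f g])
    show "br f g = - br g f" by (rule antisym[OF f g])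
    show "br (c *\<^sub>R f) g = c *\<^sub>R br f g" for c
      using antisym[OF B.C_inf_scaleR[OF f] g] antisym[OF f g] scale_right[OF g f] by simp
    fix h assume h: "h \<in> C_inf B"
    show "br (f + g) h = br f h + br g h"
      using antisym[OF B.C_inf_add[OF f g] h] antisym[OF f h] antisym[OF g h] add_right[OF h f g] by simp
    show "br f (g * h) = br f g * h + g * br f h" by (rule leibniz[OF f g h])
    show "br f (br g h) + br g (br h f) + br h (br f g) = 0" by (rule jacobi[OF f g h])
  qed
  moreover have "induced_bracket X J F B \<pi> br" unfolding induced_bracket_def
  proof (intro conjI ballI impI)
    fix f x assume f: "f \<in> C_inf B" and x: "x \<in> pts X"
    show "\<exists>!v. v \<in> tangent_space X x \<and> (0, (v, dfun X (?p f) x)) \<in> F (J x, x)"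
    proof (rule ex1I[of _ "ham_field (?p f) x"])
      show "ham_field (?p f) x \<in> tangent_space X x \<and> (0, (ham_field (?p f) x, dfun X (?p f) x)) \<in> F (J x, x)"
        using tan[OF f x] ham_field_mem[OF inv[OF f] x] by blast
      show "v = ham_field (?p f) x"
        if "v \<in> tangent_space X x \<and> (0, (v, dfun X (?p f) x)) \<in> F (J x, x)" for v
        using that ham_field_eq[OF x, of v "?p f"] by blast
    qed
    fix g v assume g: "g \<in> C_inf B" and "(0, (v, dfun X (?p f) x)) \<in> F (J x, x)"
    then show "br f g (\<pi> x) = v (?p g)" using br_\<pi>[OF f g x] ham_field_eq[OF x] by metis
  qed
  ultimately show ?thesis by blast
qed

end
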